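(* Let $F(z,v)=G\big(H(z)-(1-v)h_jz^j\big)M(z)$, $j\in\{1,2,\dots\}$, be a critical and pure size-refined composition scheme with $0<\lambda_H<1$ (terms and standing assumptions as in the context), and let $X_{n,j}$ be the number of $\mathcal H$-components of size $j$: $\mathbb P\{X_{n,j}=k\}=\frac{[z^nv^k]F(z,v)}{[z^n]F(z,1)}$. Put $$\xi_{n,j}=\frac{\rho_H^{\,j}}{-c_H}\,h_j\,n^{\lambda_H},$$ and let $X\sim\mathrm{ML}(\alpha,\beta,\gamma)$ be three-parameter Mittag-Leffler distributed with $\alpha=\lambda_H$, $\beta=-\lambda_G\lambda_H$, $\gamma=-\min(0,\lambda_M)$. Let $j=j(n)$ (with $h_j>0$). As $n\to\infty$: (i) If $j\ll n^{\lambda_H/(1+\lambda_H)}$, then $\xi_{n,j}\to+\infty$ and $X_{n,j}/\xi_{n,j}\to X$ in distribution and with convergence of all moments. (ii) If $j\sim r\cdot n^{\lambda_H/(1+\lambda_H)}$ with $r\in(0,\infty)$, then $\xi_{n,j}\to\xi$ with $$\xi=r^{-(1+\lambda_H)}\cdot\frac{1}{-\Gamma(-\lambda_H)},$$ and $X_{n,j}\to\mathrm{MPo}(\xi X)$ in distribution and with convergence of all moments. (iii) If $j\gg n^{\lambda_H/(1+\lambda_H)}$, then $\xi_{n,j}\to0$ and $X_{n,j}$ converges in distribution to the Dirac distribution at $0$.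
   Context: Standing assumptions. $G(z)=\sum_n g_nz^n$, $H(z)=\sum_n h_nz^n$, $M(z)$ are power series with nonnegative coefficients, analytic at $0$, with $H(0)=0$ and $M\not\equiv0$; $\rho_G,\rho_H$ (finite) and $\rho_M\in(0,\infty]$ are their radii of convergence. For $f\in\{G,H\}$: $z=\rho_f$ is the only singularity of $f$ on $|z|\le\rho_f$, $f$ is analytic in a domain $\{|z|<\rho_f+\varepsilon,\ |\arg(z-\rho_f)|>\theta\}$ for some $\varepsilon>0$, $0<\theta<\pi/2$, and there, as $z\to\rho_f$, $$f(z)=P_f(1-z/\rho_f)+c_f(1-z/\rho_f)^{\lambda_f}(1+o(1)),$$ with $c_f\ne0$, singular exponent $\lambda_f\in\mathbb R\setminus\{0,1,2,\dots\}$ and $P_f$ a polynomial ($P_f=0$ if $\lambda_f<0$, $P_f$ constant if $0<\lambda_f<1$, $1\le\deg P_f\le\lfloor\lambda_f\rfloor$ if $\lambda_f>1$). If $\rho_M=\rho_H$, the same is assumed for $M$; if $\rho_M>\rho_H$ (e.g. $M=1$) one sets $\lambda_M=+\infty$. Critical: $H(\rho_H)=\rho_G$ and $\rho_M\ge\rho_H$. Pure (for $0<\lambda_H<1$): either $\lambda_G<0$, or $0<\lambda_G<1$ and $\lambda_M>\min(\lambda_G\lambda_H,\lambda_H)$. Distributions. For $\alpha\in(0,1)$, $\beta>-\alpha$, $\mathrm{ML}(\alpha,\beta)$ is the law on $(0,\infty)$ uniquely determined by the moments $\mathbb E(Y^s)=\frac{\Gamma(s+\beta/\alpha+1)\Gamma(\beta+1)}{\Gamma(\alpha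 s+\beta+1)\Gamma(\beta/\alpha+1)}$. $\mathrm{ML}(\alpha,\beta,\gamma)$ ($0<\alpha<1$, $\beta>0$, $\gamma\ge0$) is the law of $Y\cdot B^{\alpha}$ with $Y\sim\mathrm{ML}(\alpha,\beta)$, $B\sim\mathrm{Beta}(\beta,\gamma)$ independent, where $\mathrm{Beta}(\beta,0)$ is the constant $1$. When $\gamma=0$, $\mathrm{ML}(\alpha,\beta,0)=\mathrm{ML}(\alpha,\beta)$, a convention also used for $-\alpha<\beta<0$. Mixed Poisson distribution: for a nonnegative random variable $X$ and $\xi\ge0$, $Y\sim\mathrm{MPo}(\xi X)$ means $\mathbb P\{Y=\ell\}=\frac{\xi^\ell}{\ell!}\mathbb E(X^\ell e^{-\xi X})$ for integers $\ell\ge0$. Convergence of all moments: the $s$-th moments converge to those of the limit for every integer $s\ge1$. $a_n\ll b_n$ (resp. $a_n\gg b_n$) means $a_n/b_n\to0$ (resp. $\to\infty$). *)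

theory Defs
  imports
    "HOL-Probability.Probability"
    "HOL-Computational_Algebra.Computational_Algebra"
    "HOL-Library.Landau_Symbols"
begin

section \<open>Algebraic singularities\<close>

text \<open>
  For \<open>\<theta> < pi / 2\<close> this domain contains the closed disc of radius \<open>\<rho>\<close> except for the
  point \<open>\<rho>\<close> itself (\<open>Arg 0 = 0\<close>).
\<close>
definition delta_domain :: "real \<Rightarrow> real \<Rightarrow> real \<Rightarrow> complex set" where
  "delta_domain \<rho> \<epsilon> \<theta> =
     {z. norm z < \<rho> + \<epsilon> \<and> \<bar>Arg (z - complex_of_real \<rho>)\<bar> > \<theta>}"

text \<open>
  The function \<open>\<phi>\<close> is the analytic continuation of the power series \<open>f\<close>. Analyticity on the
  domain makes \<open>\<rho>\<close> the only possible singularity on the closed disc of radius \<open>\<rho>\<close>; it is one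
  by Pringsheim's theorem, as the coefficients are nonnegative and the radius is \<open>\<rho>\<close>.
  The constant \<open>c\<close> and the polynomial \<open>P\<close> are real since \<open>f\<close> is real on \<open>(0, \<rho>)\<close>.
\<close>
definition singular_expansion :: "real fps \<Rightarrow> real \<Rightarrow> real \<Rightarrow> real \<Rightarrow> bool" where
  "singular_expansion f \<rho> lam c \<longleftrightarrow>
     0 < \<rho> \<and> fps_conv_radius f = ereal \<rho> \<and> c \<noteq> 0 \<and> lam \<notin> \<nat> \<and>
     (\<exists>\<epsilon> \<theta> (\<phi> :: complex \<Rightarrow> complex) (P :: real poly).
        0 < \<epsilon> \<and> 0 < \<theta> \<and> \<theta> < pi / 2 \<and>
        (\<forall>z. norm z < \<rho> \<longrightarrow> (\<lambda>n. complex_of_real (fps_nth f n) * z ^ n) sums \<phi> z) \<and>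
        \<phi> analytic_on delta_domain \<rho> \<epsilon> \<theta> \<and>
        (lam < 0 \<longrightarrow> P = 0) \<and>
        (0 < lam \<and> lam < 1 \<longrightarrow> degree P = 0) \<and>
        (1 < lam \<longrightarrow> 1 \<le> degree P \<and> int (degree P) \<le> \<lfloor>lam\<rfloor>) \<and>
        (\<exists>e :: complex \<Rightarrow> complex.
           (e \<longlongrightarrow> 0) (at (complex_of_real \<rho>) within delta_domain \<rho> \<epsilon> \<theta>) \<and>
           (\<forall>z \<in> delta_domain \<rho> \<epsilon> \<theta>.
              \<phi> z = poly (map_poly complex_of_real P) (1 - z / complex_of_real \<rho>)
                  + complex_of_real c * (1 - z / complex_of_real \<rho>) powr complex_of_real lam
                    * (1 + e z))))"

section \<open>Size-refined composition schemes\<close>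

definition nonneg_coeffs :: "real fps \<Rightarrow> bool" where
  "nonneg_coeffs f \<longleftrightarrow> (\<forall>n. 0 \<le> fps_nth f n)"

text \<open>
  In this locale \<open>lam\<^sub>M\<close> is extended real: it is \<open>\<infinity>\<close> when \<open>M\<close> has a larger radius of convergence
  than \<open>H\<close>. The case of a smaller radius is excluded by criticality.
\<close>
locale composition_scheme =
  fixes G H M :: "real fps"
    and \<rho>\<^sub>G lam\<^sub>G c\<^sub>G \<rho>\<^sub>H lam\<^sub>H c\<^sub>H :: real
    and lam\<^sub>M :: ereal
  assumes nonneg: "nonneg_coeffs G" "nonneg_coeffs H" "nonneg_coeffs M"
    and H_0: "fps_nth H 0 = 0"
    and M_nonzero: "M \<noteq> 0"
    and M_radius: "0 < fps_conv_radius M"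
    and G_singular: "singular_expansion G \<rho>\<^sub>G lam\<^sub>G c\<^sub>G"
    and H_singular: "singular_expansion H \<rho>\<^sub>H lam\<^sub>H c\<^sub>H"
    and M_singular: "fps_conv_radius M = ereal \<rho>\<^sub>H \<Longrightarrow>
          \<exists>l c. lam\<^sub>M = ereal l \<and> singular_expansion M \<rho>\<^sub>H l c"
    and M_regular: "ereal \<rho>\<^sub>H < fps_conv_radius M \<Longrightarrow> lam\<^sub>M = \<infinity>"

definition critical :: "real fps \<Rightarrow> real fps \<Rightarrow> real \<Rightarrow> real \<Rightarrow> bool" where
  "critical H M \<rho>\<^sub>G \<rho>\<^sub>H \<longleftrightarrow>
     (\<lambda>n. fps_nth H n * \<rho>\<^sub>H ^ n) sums \<rho>\<^sub>G \<and> ereal \<rho>\<^sub>H \<le> fps_conv_radius M"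

definition pure :: "real \<Rightarrow> real \<Rightarrow> ereal \<Rightarrow> bool" where
  "pure lam\<^sub>G lam\<^sub>H lam\<^sub>M \<longleftrightarrow>
     lam\<^sub>G < 0 \<or> (0 < lam\<^sub>G \<and> lam\<^sub>G < 1 \<and> ereal (min (lam\<^sub>G * lam\<^sub>H) lam\<^sub>H) < lam\<^sub>M)"

definition lift_fps :: "real fps \<Rightarrow> real poly fps" where
  "lift_fps f = Abs_fps (\<lambda>n. [:fps_nth f n:])"

text \<open>
  The bivariate series \<open>F(z,v) = G(H(z) - (1 - v) h\<^sub>j z\<^sup>j) M(z)\<close>, as a power series in \<open>z\<close>
  whose coefficients are polynomials in \<open>v = [:0, 1:]\<close>. The formal composition is the intended one
  if the inner series has no constant term, that is, for \<open>H(0) = 0\<close> and \<open>j \<ge> 1\<close>.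
\<close>
definition size_refined_scheme :: "real fps \<Rightarrow> real fps \<Rightarrow> real fps \<Rightarrow> nat \<Rightarrow> real poly fps" where
  "size_refined_scheme G H M j =
     fps_compose (lift_fps G)
       (lift_fps H - fps_const ((1 - [:0, 1:]) * [:fps_nth H j:]) * fps_X ^ j)
     * lift_fps M"

text \<open>
  The law of \<open>X\<^sub>n\<^sub>,\<^sub>j\<close>. It is meaningful only if \<open>[z\<^sup>n] F(z,1) \<noteq> 0\<close>, which may fail
  for finitely many \<open>n\<close>; for these the value is an unspecified probability mass function.
\<close>
definition component_count_pmf ::
    "real fps \<Rightarrow> real fps \<Rightarrow> real fps \<Rightarrow> nat \<Rightarrow> nat \<Rightarrow> nat pmf" where
  "component_count_pmf G H M n j =
     embed_pmf (\<lambda>k. coeff (fps_nth (size_refined_scheme G H M j) n) k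
                    / poly (fps_nth (size_refined_scheme G H M j) n) 1)"

section \<open>Limit laws\<close>

definition mittag_leffler :: "real \<Rightarrow> real \<Rightarrow> real measure \<Rightarrow> bool" where
  "mittag_leffler \<alpha> \<beta> L \<longleftrightarrow>
     real_distribution L \<and> (AE y in L. 0 < y) \<and>
     (\<forall>s::nat. has_bochner_integral L (\<lambda>y. y ^ s)
        ((Gamma (real s + \<beta> / \<alpha> + 1) * Gamma (\<beta> + 1))
         / (Gamma (\<alpha> * real s + \<beta> + 1) * Gamma (\<beta> / \<alpha> + 1))))"

definition beta_distribution :: "real \<Rightarrow> real \<Rightarrow> real measure" where
  "beta_distribution a b =
     (if b = 0 then return borel 1
      else density lborel (\<lambda>x. ennreal
             (indicator {0<..<1} x * (x powr (a - 1) * (1 - x) powr (b - 1) / Beta a b))))"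

text \<open>
  The law of \<open>Y * B powr \<alpha>\<close> for independent \<open>Y\<close> and \<open>B\<close>. For \<open>\<gamma> = 0\<close> the factor \<open>B\<close> is
  the constant 1 and this is the two-parameter law, also for negative \<open>\<beta>\<close>.
\<close>
definition mittag_leffler3 :: "real \<Rightarrow> real \<Rightarrow> real \<Rightarrow> real measure \<Rightarrow> bool" where
  "mittag_leffler3 \<alpha> \<beta> \<gamma> L \<longleftrightarrow>
     (\<exists>L'. mittag_leffler \<alpha> \<beta> L' \<and>
        L = distr (L' \<Otimes>\<^sub>M beta_distribution \<beta> \<gamma>) borel (\<lambda>(y, b). y * b powr \<alpha>))"

definition mixed_poisson_pmf :: "real \<Rightarrow> real measure \<Rightarrow> nat pmf" where
  "mixed_poisson_pmf \<xi> L =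
     embed_pmf (\<lambda>l. \<xi> ^ l / fact l * (\<integral>x. x ^ l * exp (- \<xi> * x) \<partial>L))"

section \<open>Modes of convergence\<close>

definition moments_converge :: "(nat \<Rightarrow> real measure) \<Rightarrow> real measure \<Rightarrow> bool" where
  "moments_converge \<mu> L \<longleftrightarrow>
     (\<forall>s::nat. 1 \<le> s \<longrightarrow>
        (\<forall>\<^sub>F n in sequentially. integrable (\<mu> n) (\<lambda>x. x ^ s)) \<and>
        integrable L (\<lambda>x. x ^ s) \<and>
        (\<lambda>n. \<integral>x. x ^ s \<partial>\<mu> n) \<longlonglongrightarrow> (\<integral>x. x ^ s \<partial>L))"

definition real_law :: "nat pmf \<Rightarrow> real measure" where
  "real_law p = distr (measure_pmf p) borel real"

definition scaled_law :: "nat pmf \<Rightarrow> real \<Rightarrow> real measure" where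
  "scaled_law p a = distr (measure_pmf p) borel (\<lambda>k. real k / a)"

end

theory Submission
  imports Defs "HOL-Complex_Analysis.Complex_Analysis" "HOL-Real_Asymp.Real_Asymp"
begin

text \<open>
  The factorial moments of the number of components of size \<open>j\<close> are
  \<open>h\<^sub>j\<^sup>s [z\<^sup>n\<^sup>-\<^sup>j\<^sup>s] G\<^sup>(\<^sup>s\<^sup>)(H(z)) M(z) / [z\<^sup>n] G(H(z)) M(z)\<close>, by expanding \<open>G\<close> around \<open>H\<close> in powers of
  \<open>(v - 1) h\<^sub>j z\<^sup>j\<close>. Since \<open>lam\<^sub>H < 1\<close>, the function \<open>H\<close> maps a sector at \<open>\<rho>\<^sub>H\<close> that is slightly wider
  than a half-plane into the half-plane to the left of \<open>\<rho>\<^sub>G\<close>, so \<open>G\<^sup>(\<^sup>s\<^sup>)(H) M\<close> continues beyond the circle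
  of convergence and behaves like a multiple of \<open>(1 - z / \<rho>\<^sub>H)\<close> to the power
  \<open>lam\<^sub>H (lam\<^sub>G - s) + min 0 lam\<^sub>M\<close>. Singularity analysis gives the coefficients, and for \<open>j = o(n)\<close> the
  factorial moments divided by \<open>\<xi>\<^sup>s\<close> converge to the moments of the Mittag-Leffler law. These, and
  those of the mixed Poisson law, determine the limit, so the method of moments applies when \<open>\<xi>\<close> tends
  to infinity or to a positive constant. If \<open>\<xi>\<close> tends to 0, the first moment tends to 0, by a bound
  that is uniform in \<open>j\<close> up to \<open>n\<close>.

  The transfer theorem is proved without a keyhole contour: Cauchy's inequality on discs of radius
  proportional to \<open>\<bar>z - \<rho>\<bar>\<close> bounds a high derivative on the open disc, and this derivative is integrable
  against the Poisson kernel on the circle of radius \<open>\<rho> (1 - 1 / (2 n))\<close>.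
\<close>

section \<open>Transfer of singular behaviour to coefficients\<close>

text \<open>The threshold comes from \<open>h_j \<rho>^j\<close> being of order
  \<open>j powr (- (1 + lam\<^sub>H))\<close>. Thus \<xi> is
  \<open>x powr (- (1 + lam\<^sub>H))\<close> times a factor bounded away from 0 and infinity, where
  \<open>x = j / n powr \<delta>\<close> and
  \<open>\<delta> = lam\<^sub>H / (1 + lam\<^sub>H)\<close>. In the first two regimes
  \<open>x\<close> is bounded and \<delta> < 1, so \<open>j\<close> is automatically small against
  \<open>n\<close>. Purity enters through the order \<open>s = 0\<close>: for positive
  \<open>lam\<^sub>G\<close> the constant term of \<open>G\<close> at its singularity contributes a
  multiple of \<open>M\<close> itself, whose singular part must be smaller than the power
  \<open>lam\<^sub>G * lam\<^sub>H\<close>. All orders \<open>s\<close> share one leading constant,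
  which cancels in quotients of coefficients; what matters is that it is real and nonzero. The
  derivative in the transfer theorem is taken so often that the singular exponent drops to -2 or
  below, whatever it was. Then the Poisson kernel can be split off, and bounded contributions from
  elsewhere on the disc become negligible.\<close>

lemma not_nonpos_Int_gt_minus_1:
  fixes x :: real
  assumes "-1 < x" "x \<noteq> 0"
  shows "x \<notin> \<int>\<^sub>\<le>\<^sub>0"
proof
  assume "x \<in> \<int>\<^sub>\<le>\<^sub>0"
  then obtain i where i: "x = real_of_int i" "i \<le> 0" by (auto elim: nonpos_Ints_cases)
  hence "-1 < real_of_int i" using assms by simp
  hence "i = 0" using i(2) by linarith
  thus False using i assms by simp
qed

text \<open>
  For \<open>\<kappa> = cos \<theta>\<close> this is the region \<open>\<bar>Arg (z - \<rho>)\<bar> > \<theta>\<close>; for \<open>\<kappa> = 0\<close> it is the open half-plane to the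
  left of \<open>\<rho>\<close>.
\<close>
definition sector :: "real \<Rightarrow> real \<Rightarrow> complex set" where
  "sector \<rho> \<kappa> = {z. Re (z - of_real \<rho>) < \<kappa> * norm (z - of_real \<rho>)}"

abbreviation at_sector :: "real \<Rightarrow> real \<Rightarrow> complex filter" where
  "at_sector \<rho> \<kappa> \<equiv> at (of_real \<rho>) within sector \<rho> \<kappa>"

text \<open>The kernel reaches the order \<open>1 / (1 - r / \<rho>)\<^sup>2\<close> on the circle,
  but its mean is only \<open>1 / (1 - (r / \<rho>)\<^sup>2)\<close>. This gain of one factor
  \<open>1 - r / \<rho>\<close> over the maximum bound is what gives the right order of the
  coefficients.\<close>

lemma Taylor_coeff_bound:
  fixes f :: "complex \<Rightarrow> complex"
  assumes holf: "f holomorphic_on ball 0 \<rho>" and r: "0 < r" "r < \<rho>"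
    and bound: "\<And>z. norm z = r \<Longrightarrow> norm (f z) \<le> A / norm (1 - z / of_real \<rho>) ^ 2 + B"
  shows "norm ((deriv ^^ n) f 0 / fact n) * r ^ n \<le> A / (1 - (r / \<rho>)\<^sup>2) + B"
proof -
  \<comment> \<open>On \<open>\<bar>u\<bar> = r\<close> the kernel \<open>1 / \<bar>1 - u / \<rho>\<bar>\<^sup>2\<close> equals \<open>u / ((1 - u / \<rho>) (u - r\<^sup>2 / \<rho>))\<close>, so its mean over the
    circle is a Cauchy integral at \<open>r\<^sup>2 / \<rho>\<close>.\<close>
  let ?\<gamma> = "circlepath 0 r"
  let ?P = "\<lambda>t. 1 / norm (1 - ?\<gamma> t / of_real \<rho>) ^ 2"
  have \<rho>: "0 < \<rho>" using r by simp
  have normg: "norm (?\<gamma> t) = r" for t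
    using r by (simp add: circlepath norm_mult)
  have g0: "?\<gamma> t \<noteq> 0" for t
    using normg[of t] r by (metis norm_zero less_irrefl)
  have vd: "vector_derivative ?\<gamma> (at t within {0..1}) = 2 * of_real pi * \<i> * ?\<gamma> t"
    if "t \<in> {0..1}" for t
    using vector_derivative_circlepath01[of t 0 r] that by (simp add: circlepath)
  have eq: "u / ((1 - u / of_real \<rho>) * (u - of_real (r\<^sup>2 / \<rho>))) = of_real (1 / norm (1 - u / of_real \<rho>) ^ 2)"
    if u: "norm u = r" for u :: complex
  proof -
    have u0: "u \<noteq> 0" using u r by auto
    have "u * cnj u = of_real (r\<^sup>2)"
      using u by (metis complex_norm_square)
    hence cu: "cnj u = of_real (r\<^sup>2) / u" using u0 by (simp add: field_simps)
    have "complex_of_real (norm (1 - u / of_real \<rho>) ^ 2) = (1 - u / of_real \<rho>) * cnj (1 - u / of_real \<rho>)"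
      by (rule complex_norm_square)
    also have "cnj (1 - u / of_real \<rho>) = 1 - (of_real (r\<^sup>2) / u) / of_real \<rho>"
      using cu by simp
    also have "\<dots> = (u - of_real (r\<^sup>2 / \<rho>)) / u"
      using u0 \<rho> by (simp add: field_simps)
    finally show ?thesis by (simp add: of_real_divide)
  qed
  have w: "norm (complex_of_real (r\<^sup>2 / \<rho>) - 0) < r"
    using r \<rho> by (simp add: norm_divide norm_mult power2_eq_square field_simps)
  have nz: "1 - u / complex_of_real \<rho> \<noteq> 0" if "norm u \<le> r" for u
  proof
    assume "1 - u / complex_of_real \<rho> = 0"
    hence "u = of_real \<rho>" using \<rho> by (simp add: field_simps)
    thus False using that r by simp
  qed
  have "((\<lambda>u. (1 / (1 - u / of_real \<rho>)) / (u - of_real (r\<^sup>2 / \<rho>))) has_contour_integral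
     2 * of_real pi * \<i> * (1 / (1 - of_real (r\<^sup>2 / \<rho>) / of_real \<rho>))) ?\<gamma>"
    by (rule Cauchy_integral_circlepath_simple[OF _ w])
       (use nz \<rho> in \<open>auto intro!: holomorphic_intros\<close>)
  hence "((\<lambda>t. (1 / (1 - ?\<gamma> t / of_real \<rho>)) / (?\<gamma> t - of_real (r\<^sup>2 / \<rho>)) *
       vector_derivative ?\<gamma> (at t within {0..1})) has_integral
     2 * of_real pi * \<i> * (1 / (1 - of_real (r\<^sup>2 / \<rho>) / of_real \<rho>))) {0..1}"
    by (simp add: has_contour_integral_def)
  hence "((\<lambda>t. 2 * of_real pi * \<i> * of_real (?P t)) has_integral
     2 * of_real pi * \<i> * (1 / (1 - of_real (r\<^sup>2 / \<rho>) / of_real \<rho>))) {0..1}"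
  proof (rule has_integral_eq[rotated])
    fix t :: real assume "t \<in> {0..1}"
    thus "(1 / (1 - ?\<gamma> t / of_real \<rho>)) / (?\<gamma> t - of_real (r\<^sup>2 / \<rho>)) *
       vector_derivative ?\<gamma> (at t within {0..1}) = 2 * of_real pi * \<i> * of_real (?P t)"
      unfolding eq[OF normg[of t], symmetric] by (simp add: vd)
  qed
  from has_integral_mult_right[OF this, of "1 / (2 * of_real pi * \<i>)"]
  have "((\<lambda>t. of_real (?P t)) has_integral complex_of_real (1 / (1 - (r / \<rho>)\<^sup>2))) {0..1}"
    using \<rho> by (simp add: power_divide power2_eq_square)
  from has_integral_Re[OF this]
  have P: "(?P has_integral 1 / (1 - (r / \<rho>)\<^sup>2)) {0..1}" by simp
  have "((\<lambda>u. f u / (u - 0) ^ Suc n) has_contour_integral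
      ((2 * pi * \<i>) / (fact n) * (deriv ^^ n) f 0)) ?\<gamma>"
    by (rule Cauchy_has_contour_integral_higher_derivative_circlepath)
       (use r in \<open>auto intro!: holomorphic_on_imp_continuous_on holomorphic_on_subset[OF holf]\<close>)
  hence "((\<lambda>t. f (?\<gamma> t) / ?\<gamma> t ^ Suc n * vector_derivative ?\<gamma> (at t within {0..1})) has_integral
     ((2 * pi * \<i>) / (fact n) * (deriv ^^ n) f 0)) {0..1}"
    by (simp add: has_contour_integral_def)
  hence "((\<lambda>t. 2 * of_real pi * \<i> * (f (?\<gamma> t) / ?\<gamma> t ^ n)) has_integral
      ((2 * pi * \<i>) / (fact n) * (deriv ^^ n) f 0)) {0..1}"
    by (rule has_integral_eq[rotated])
       (use g0 in \<open>auto simp: vd\<close>)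
  from has_integral_mult_right[OF this, of "1 / (2 * of_real pi * \<i>)"]
  have I: "((\<lambda>t. f (?\<gamma> t) / ?\<gamma> t ^ n) has_integral (deriv ^^ n) f 0 / fact n) {0..1}"
    by simp
  have J: "((\<lambda>t. (A * ?P t + B) / r ^ n) has_integral (A * (1 / (1 - (r / \<rho>)\<^sup>2)) + B) / r ^ n) {0..1}"
    using has_integral_mult_right[OF has_integral_add[OF has_integral_mult_right[OF P, of A]
        has_integral_const_real[of B 0 1]], of "1 / r ^ n"] by simp
  have "norm (integral {0..1} (\<lambda>t. f (?\<gamma> t) / ?\<gamma> t ^ n)) \<le> integral {0..1} (\<lambda>t. (A * ?P t + B) / r ^ n)"
  proof (rule integral_norm_bound_integral)
    fix t :: real
    show "norm (f (?\<gamma> t) / ?\<gamma> t ^ n) \<le> (A * ?P t + B) / r ^ n"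
      using bound[OF normg[of t]] r by (simp add: norm_divide norm_power normg divide_right_mono)
  qed (use I J in \<open>auto simp: integrable_on_def\<close>)
  hence "norm ((deriv ^^ n) f 0 / fact n) \<le> (A * (1 / (1 - (r / \<rho>)\<^sup>2)) + B) / r ^ n"
    unfolding integral_unique[OF I] integral_unique[OF J] .
  thus ?thesis using r by (subst (asm) pos_le_divide_eq) auto
qed

text \<open>Absorbs a change of the argument by a factor of at most 2 without a case distinction on
  the sign of the exponent.\<close>

lemma powr_between_half_double:
  fixes t a :: real
  assumes "1/2 \<le> t" "t \<le> 2"
  shows "t powr a \<le> 2 powr \<bar>a\<bar>"
proof (cases "0 \<le> a")
  case True
  thus ?thesis using assms by (simp add: powr_mono2)
next
  case False
  have "t powr a \<le> (1/2) powr a"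
    using False assms by (intro powr_mono2') auto
  also have "\<dots> = 2 powr (-a)" by (simp add: powr_minus powr_divide field_simps)
  finally show ?thesis using False by simp
qed

text \<open>Cauchy's inequality on a disc around \<open>z\<close> whose radius is proportional to
  the distance from \<rho>: within the disc this distance changes by a factor of at most 2, so
  \<open>m\<close> derivatives cost the power \<open>- m\<close>. The disc needs room outside the
  half-plane, hence a hypothesis on a sector and a conclusion on the half-plane.\<close>

lemma higher_deriv_smallo_boundary:
  fixes f :: "complex \<Rightarrow> complex"
  assumes U: "open U" and holf: "f holomorphic_on U" and \<kappa>: "0 < \<kappa>" and \<rho>: "0 < \<rho>"
    and ev: "\<forall>\<^sub>F z in at_sector \<rho> \<kappa>. z \<in> U"
    and lim: "((\<lambda>z. f z / of_real (norm (1 - z / of_real \<rho>) powr a)) \<longlongrightarrow> 0)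
               (at_sector \<rho> \<kappa>)"
  shows "((\<lambda>z. (deriv ^^ m) f z / of_real (norm (1 - z / of_real \<rho>) powr (a - real m))) \<longlongrightarrow> 0)
               (at (of_real \<rho>) within {z. Re z < \<rho>})"
proof (rule tendstoI)
  fix e :: real assume e: "0 < e"
  \<comment> \<open>\<open>\<tau> \<le> 1/2\<close> keeps distances to \<rho> between
    \<open>D / 2\<close> and \<open>2 * D\<close>; \<open>\<tau> \<le> \<kappa> / 2\<close> keeps
    the disc inside the sector.\<close>
  define \<tau> where "\<tau> = min \<kappa> 1 / 2"
  have \<tau>: "0 < \<tau>" "\<tau> \<le> 1/2" "\<tau> \<le> \<kappa> / 2" using \<kappa> by (auto simp: \<tau>_def)
  define K where "K = fact m * 2 powr \<bar>a\<bar> / (\<tau> * \<rho>) ^ m"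
  have K: "0 < K" using \<tau> \<rho> by (simp add: K_def)
  define \<eta> where "\<eta> = e / (2 * K)"
  have \<eta>: "0 < \<eta>" using e K by (simp add: \<eta>_def)
  from tendstoD[OF lim \<eta>] ev
  have "\<forall>\<^sub>F z in at_sector \<rho> \<kappa>. z \<in> U \<and>
     norm (f z / of_real (norm (1 - z / of_real \<rho>) powr a)) < \<eta>"
    by eventually_elim simp
  then obtain d where d: "0 < d" and dU: "\<And>w. w \<in> sector \<rho> \<kappa> \<Longrightarrow> w \<noteq> of_real \<rho> \<Longrightarrow> dist w (of_real \<rho>) < d \<Longrightarrow>
      w \<in> U \<and> norm (f w / of_real (norm (1 - w / of_real \<rho>) powr a)) < \<eta>"
    unfolding eventually_at by blast
  show "\<forall>\<^sub>F z in at (of_real \<rho>) within {z. Re z < \<rho>}.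
      dist ((deriv ^^ m) f z / of_real (norm (1 - z / of_real \<rho>) powr (a - real m))) 0 < e"
    unfolding eventually_at
  proof (intro exI[of _ "d / 2"] conjI ballI impI)
    fix z assume z: "z \<in> {z. Re z < \<rho>}" "z \<noteq> of_real \<rho> \<and> dist z (of_real \<rho>) < d / 2"
    define D where "D = norm (z - of_real \<rho>)"
    have D: "0 < D" "D < d / 2" using z by (auto simp: D_def dist_norm)
    have Dn: "norm (1 - z / of_real \<rho>) = D / \<rho>"
    proof -
      have "1 - z / of_real \<rho> = - (z - of_real \<rho>) / of_real \<rho>" using \<rho> by (simp add: field_simps)
      thus ?thesis using \<rho> unfolding D_def by (simp only: norm_divide norm_minus_cancel) simp
    qed
    define u where "u = D / \<rho>"
    have u: "0 < u" using D \<rho> by (simp add: u_def)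
    have near: "w \<in> U \<and> norm (f w) \<le> \<eta> * (2 powr \<bar>a\<bar> * u powr a)" if w: "norm (z - w) \<le> \<tau> * D" for w
    proof -
      define E where "E = norm (w - of_real \<rho>)"
      have "norm (z - of_real \<rho>) \<le> norm (z - w) + norm (w - of_real \<rho>)"
        by (metis diff_add_cancel norm_triangle_ineq add_diff_eq)
      hence E1: "(1 - \<tau>) * D \<le> E" using w by (simp add: D_def E_def algebra_simps)
      have "norm (w - of_real \<rho>) \<le> norm (w - z) + norm (z - of_real \<rho>)"
        by (metis diff_add_cancel norm_triangle_ineq add_diff_eq)
      hence E2: "E \<le> (1 + \<tau>) * D" using w by (simp add: D_def E_def algebra_simps norm_minus_commute)
      have E1': "D / 2 \<le> E"
        using mult_right_mono[of "1/2" "1 - \<tau>" D] D \<tau> E1 by linarith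
      have E2': "E \<le> 2 * D"
        using mult_right_mono[of "1 + \<tau>" 2 D] D \<tau> E2 by linarith
      have wne: "w \<noteq> of_real \<rho>" using E1' D by (auto simp: E_def)
      have "Re (w - of_real \<rho>) = Re (z - of_real \<rho>) - Re (z - w)" by simp
      also have "\<dots> < 0 + norm (z - w)" using z abs_Re_le_cmod[of "z - w"] by simp
      also have "\<dots> \<le> \<tau> * D" using w by simp
      also have "\<dots> \<le> (\<kappa> / 2) * D" using \<tau> D by (intro mult_right_mono) auto
      also have "\<dots> = \<kappa> * (D / 2)" by simp
      also have "\<dots> \<le> \<kappa> * E" using \<kappa> E1' by (intro mult_left_mono) auto
      finally have wc: "w \<in> sector \<rho> \<kappa>" by (simp add: sector_def E_def)
      have "dist w (of_real \<rho>) < d" using E2 \<tau> D mult_right_mono[of "\<tau>" "1/2" D] E2'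
        by (simp add: E_def dist_norm)
      from dU[OF wc wne this] have wU: "w \<in> U"
        and fw: "norm (f w / of_real (norm (1 - w / of_real \<rho>) powr a)) < \<eta>" by auto
      have "1 - w / of_real \<rho> = - (w - of_real \<rho>) / of_real \<rho>" using \<rho> by (simp add: field_simps)
      hence En: "norm (1 - w / of_real \<rho>) = E / \<rho>"
        using \<rho> unfolding E_def by (simp only: norm_divide norm_minus_cancel) simp
      have E0: "0 < E" using E1' D by simp
      have "norm (f w) \<le> \<eta> * (E / \<rho>) powr a"
        using fw E0 \<rho> unfolding En by (simp add: norm_divide field_simps)
      also have "(E / \<rho>) powr a = ((E / D) * u) powr a" using D by (simp add: u_def)
      also have "\<dots> = (E / D) powr a * u powr a" using E0 D u by (subst powr_mult) auto
      also have "\<dots> \<le> 2 powr \<bar>a\<bar> * u powr a"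
        by (intro mult_right_mono powr_between_half_double) (use E1' E2' D in \<open>auto simp: field_simps\<close>)
      finally show ?thesis using wU \<eta> by simp
    qed
    have sub: "cball z (\<tau> * D) \<subseteq> U" using near by (auto simp: dist_norm)
    have "norm ((deriv ^^ m) f z) \<le> fact m * (\<eta> * (2 powr \<bar>a\<bar> * u powr a)) / (\<tau> * D) ^ m"
    proof (rule Cauchy_inequality)
      show "f holomorphic_on ball z (\<tau> * D)"
        using sub holf by (meson ball_subset_cball holomorphic_on_subset order_trans)
      show "continuous_on (cball z (\<tau> * D)) f"
        using sub holf by (meson holomorphic_on_imp_continuous_on holomorphic_on_subset)
      show "0 < \<tau> * D" using \<tau> D by simp
    qed (use near in auto)
    also have "\<dots> = \<eta> * K * (u powr a / u ^ m)"
      using \<rho> by (simp add: K_def u_def power_mult_distrib power_divide field_simps)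
    also have "u powr a / u ^ m = u powr (a - real m)"
      using u by (simp add: powr_diff powr_realpow)
    finally have "norm ((deriv ^^ m) f z) \<le> \<eta> * K * u powr (a - real m)" .
    also have "\<dots> < e * u powr (a - real m)"
      using u K e by (simp add: \<eta>_def)
    finally have "norm ((deriv ^^ m) f z) < e * u powr (a - real m)" .
    thus "dist ((deriv ^^ m) f z / of_real (norm (1 - z / of_real \<rho>) powr (a - real m))) 0 < e"
      using u by (simp add: norm_divide Dn u_def[symmetric] field_simps)
  qed (use d in auto)
qed

text \<open>The \<open>m\<close>-th derivative is bounded on the whole open disc by a small multiple
  of \<open>norm (1 - z / \<rho>) powr (a - m)\<close> plus a constant: near \<rho> by the boundary
  estimate, elsewhere by compactness. \<open>Taylor_coeff_bound\<close> turns this into a bound for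
  its coefficients, and passing back to \<open>f\<close> gains a factor of order
  \<open>n powr (- m)\<close>.\<close>

lemma coeff_smallo_transfer:
  fixes f :: "complex \<Rightarrow> complex"
  assumes U: "open U" and holf: "f holomorphic_on U" and sub: "cball 0 \<rho> - {of_real \<rho>} \<subseteq> U"
    and \<kappa>: "0 < \<kappa>" and \<rho>: "0 < \<rho>"
    and ev: "\<forall>\<^sub>F z in at_sector \<rho> \<kappa>. z \<in> U"
    and lim: "((\<lambda>z. f z / of_real (norm (1 - z / of_real \<rho>) powr a)) \<longlongrightarrow> 0)
               (at_sector \<rho> \<kappa>)"
  shows "(\<lambda>n. norm ((deriv ^^ n) f 0 / fact n) * \<rho> ^ n * real n powr (a + 1)) \<longlonglongrightarrow> 0"
proof -
  \<comment> \<open>With \<open>a - m + 2 \<le> 0\<close> the power \<open>a - m\<close> splits into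
    the Poisson kernel and a power that is largest where its base is smallest. Moreover
    \<open>p \<ge> 1\<close>, so the contribution of the constant \<open>B\<close> vanishes in the
    limit.\<close>
  obtain m :: nat where m: "a + 2 \<le> real m" using real_arch_simple by blast
  define p where "p = real m - a - 1"
  have p: "1 \<le> p" using m by (simp add: p_def)
  define g where "g = (deriv ^^ m) f"
  have holg: "g holomorphic_on U" unfolding g_def using holf U by (rule holomorphic_higher_deriv)
  have ballU: "ball 0 \<rho> \<subseteq> U" using sub \<rho> by auto
  have glim: "((\<lambda>z. g z / of_real (norm (1 - z / of_real \<rho>) powr (a - real m))) \<longlongrightarrow> 0)
               (at (of_real \<rho>) within {z. Re z < \<rho>})"
    unfolding g_def using U holf \<kappa> \<rho> ev lim by (rule higher_deriv_smallo_boundary)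
  have step1: "\<exists>B. \<forall>z\<in>ball 0 \<rho>. norm (g z) \<le> \<eta> * norm (1 - z / of_real \<rho>) powr (a - real m) + B"
    if \<eta>: "0 < \<eta>" for \<eta>
  proof -
    from tendstoD[OF glim \<eta>] obtain d where d: "0 < d" and
      dg: "\<And>z. Re z < \<rho> \<Longrightarrow> z \<noteq> of_real \<rho> \<Longrightarrow> dist z (of_real \<rho>) < d \<Longrightarrow>
         norm (g z / of_real (norm (1 - z / of_real \<rho>) powr (a - real m))) < \<eta>"
      unfolding eventually_at by (auto simp: dist_norm)
    define S :: "complex set" where "S = cball 0 \<rho> - ball (of_real \<rho>) d"
    have "compact S" unfolding S_def by (intro compact_diff compact_cball) auto
    moreover have "S \<subseteq> U" using sub d by (auto simp: S_def)
    ultimately have "compact (g ` S)"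
      using holg by (meson compact_continuous_image holomorphic_on_imp_continuous_on holomorphic_on_subset)
    then obtain B where B: "\<And>z. z \<in> S \<Longrightarrow> norm (g z) \<le> B"
      by (metis bounded_iff compact_imp_bounded imageI)
    show ?thesis
    proof (intro exI[of _ "\<bar>B\<bar>"] ballI)
      fix z :: complex assume z: "z \<in> ball 0 \<rho>"
      show "norm (g z) \<le> \<eta> * norm (1 - z / of_real \<rho>) powr (a - real m) + \<bar>B\<bar>"
      proof (cases "z \<in> S")
        case True
        hence "norm (g z) \<le> \<bar>B\<bar>" using B by fastforce
        thus ?thesis using \<eta> by (simp add: add_increasing)
      next
        case False
        have ne: "z \<noteq> of_real \<rho>" using z \<rho> by auto
        have "Re z < \<rho>" using z abs_Re_le_cmod[of z] by simp
        moreover have "dist z (of_real \<rho>) < d" using False z by (auto simp: S_def dist_commute)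
        ultimately have "norm (g z / of_real (norm (1 - z / of_real \<rho>) powr (a - real m))) < \<eta>"
          using dg ne by blast
        moreover have "0 < norm (1 - z / of_real \<rho>)" using ne \<rho> by (auto simp: field_simps)
        ultimately have "norm (g z) \<le> \<eta> * norm (1 - z / of_real \<rho>) powr (a - real m)"
          by (simp add: norm_divide field_simps)
        thus ?thesis by simp
      qed
    qed
  qed
  have step2: "norm ((deriv ^^ (n + m)) f 0 / fact (n + m)) * \<rho> ^ n * real n powr (a + 1)
       \<le> 2 * \<eta> * 2 powr p + 2 * B * real n powr (-p)"
    if B: "\<And>z. z \<in> ball 0 \<rho> \<Longrightarrow> norm (g z) \<le> \<eta> * norm (1 - z / of_real \<rho>) powr (a - real m) + B"
      and n: "1 \<le> n" and \<eta>: "0 < \<eta>" for B \<eta> n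
  proof -
    \<comment> \<open>The circle of radius \<open>\<rho> * (1 - 1 / N)\<close> is at relative
      distance of order \<open>1 / n\<close> from the singularity, and there \<open>r ^ n\<close> is
      at least half of \<open>\<rho> ^ n\<close> by Bernoulli's inequality.\<close>
    define N where "N = 2 * real n"
    have N: "2 \<le> N" using n by (simp add: N_def)
    define r where "r = \<rho> * (1 - 1 / N)"
    have r: "0 < r" "r < \<rho>" using N \<rho> by (auto simp: r_def field_simps)
    have rr: "r / \<rho> = 1 - 1 / N" using \<rho> by (simp add: r_def)
    have "norm ((deriv ^^ n) g 0 / fact n) * r ^ n \<le> \<eta> * N powr (p - 1) / (1 - (r / \<rho>)\<^sup>2) + B"
    proof (rule Taylor_coeff_bound)
      fix z :: complex assume z: "norm z = r"
      define u where "u = norm (1 - z / of_real \<rho>)"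
      have "norm (1 :: complex) - norm (z / of_real \<rho>) \<le> u" unfolding u_def by (rule norm_triangle_ineq2)
      hence u: "1 / N \<le> u" using z \<rho> rr by (simp add: norm_divide)
      have u0: "0 < u" using u N by (smt (verit) divide_pos_pos)
      have "u powr (a - real m) = u powr (a - real m + 2) / u ^ 2"
        using u0 by (simp add: powr_add)
      also have "u powr (a - real m + 2) \<le> (1 / N) powr (a - real m + 2)"
        using u N m by (intro powr_mono2') auto
      also have "(1 / N) powr (a - real m + 2) = N powr (p - 1)"
        using N by (simp add: powr_divide p_def powr_minus[symmetric] powr_diff powr_add field_simps)
      finally have *: "u powr (a - real m) \<le> N powr (p - 1) / u\<^sup>2" using u0 by (simp add: divide_right_mono)
      have "norm (g z) \<le> \<eta> * u powr (a - real m) + B" unfolding u_def by (rule B) (use z r in auto)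
      also have "\<dots> \<le> \<eta> * (N powr (p - 1) / u\<^sup>2) + B"
        using mult_left_mono[OF *, of \<eta>] \<eta> by simp
      finally show "norm (g z) \<le> \<eta> * N powr (p - 1) / norm (1 - z / of_real \<rho>) ^ 2 + B"
        by (simp add: u_def)
    qed (use r holg ballU holomorphic_on_subset in auto)
    also have "\<eta> * N powr (p - 1) / (1 - (r / \<rho>)\<^sup>2) \<le> \<eta> * N powr (p - 1) / (1 / N)"
    proof (rule divide_left_mono)
      have "1 - (r / \<rho>)\<^sup>2 = 1 / N + (1 / N) * (1 - 1 / N)" unfolding rr by (simp add: power2_eq_square algebra_simps)
      also have "\<dots> \<ge> 1 / N" using N by simp
      finally show "1 / N \<le> 1 - (r / \<rho>)\<^sup>2" .
      thus "0 < (1 - (r / \<rho>)\<^sup>2) * (1 / N)" using N by (smt (verit) divide_pos_pos mult_pos_pos)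
    qed (use \<eta> in auto)
    also have "\<eta> * N powr (p - 1) / (1 / N) = \<eta> * N powr p"
      using N by (simp add: powr_diff)
    finally have g1: "norm ((deriv ^^ n) g 0 / fact n) * r ^ n \<le> \<eta> * N powr p + B" by simp
    have "1 / 2 \<le> (1 - 1 / N) ^ n"
      using Bernoulli_inequality[of "- 1 / N" n] N n by (simp add: N_def field_simps)
    hence "\<rho> ^ n / 2 \<le> r ^ n" using \<rho> by (simp add: r_def power_mult_distrib)
    hence "norm ((deriv ^^ n) g 0 / fact n) * (\<rho> ^ n / 2) \<le> \<eta> * N powr p + B"
      using g1 by (meson mult_left_mono norm_ge_zero order_trans)
    hence g2: "norm ((deriv ^^ n) g 0) / fact n * \<rho> ^ n \<le> 2 * (\<eta> * N powr p + B)"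
      by (simp add: norm_divide)
    \<comment> \<open>Coefficient \<open>n + m\<close> of \<open>f\<close> is coefficient
      \<open>n\<close> of \<open>g\<close> times \<open>fact n / fact (n + m)\<close>.\<close>
    have "fact n * real n ^ m \<le> fact (n + m)"
    proof (induction m)
      case (Suc m)
      have "fact n * real n ^ Suc m = real n * (fact n * real n ^ m)" by simp
      also have "\<dots> \<le> real (Suc (n + m)) * fact (n + m)" by (intro mult_mono Suc) auto
      finally show ?case by simp
    qed auto
    hence "real n ^ m / fact (n + m) \<le> 1 / fact n" by (simp add: field_simps)
    hence "norm ((deriv ^^ (n + m)) f 0) * (real n ^ m / fact (n + m)) * \<rho> ^ n
        \<le> norm ((deriv ^^ (n + m)) f 0) * (1 / fact n) * \<rho> ^ n"
      using \<rho> by (intro mult_right_mono mult_left_mono) auto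
    moreover have "(deriv ^^ (n + m)) f = (deriv ^^ n) g" by (simp add: g_def funpow_add)
    ultimately have g3: "norm ((deriv ^^ (n + m)) f 0) * (real n ^ m / fact (n + m)) * \<rho> ^ n
        \<le> 2 * (\<eta> * N powr p + B)" using g2 by simp
    have pw: "real n powr (a + 1) = real n ^ m * real n powr (-p)"
      using n by (simp add: p_def powr_realpow[symmetric] powr_add[symmetric] add.commute)
    have "norm ((deriv ^^ (n + m)) f 0 / fact (n + m)) * \<rho> ^ n * real n powr (a + 1) =
      (norm ((deriv ^^ (n + m)) f 0) * (real n ^ m / fact (n + m)) * \<rho> ^ n) * real n powr (-p)"
      unfolding pw by (simp add: norm_divide)
    also have "\<dots> \<le> 2 * (\<eta> * N powr p + B) * real n powr (-p)"
      by (intro mult_right_mono g3) auto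
    also have "\<dots> = 2 * \<eta> * 2 powr p * (real n powr p * real n powr (-p)) + 2 * B * real n powr (-p)"
      unfolding N_def by (subst powr_mult) (auto simp: algebra_simps)
    also have "real n powr p * real n powr (-p) = 1" using n by (simp add: powr_add[symmetric])
    finally show ?thesis by simp
  qed
  define S where "S n = norm ((deriv ^^ (n + m)) f 0 / fact (n + m)) * \<rho> ^ n * real n powr (a + 1)" for n
  have S0: "0 \<le> S n" for n using \<rho> by (simp add: S_def)
  have "S \<longlonglongrightarrow> 0"
  proof (rule tendstoI)
    fix e :: real assume e: "0 < e"
    define \<eta> where "\<eta> = e / (4 * 2 powr p)"
    have \<eta>: "0 < \<eta>" using e by (simp add: \<eta>_def)
    from step1[OF \<eta>] obtain B where
      B: "\<And>z. z \<in> ball 0 \<rho> \<Longrightarrow> norm (g z) \<le> \<eta> * norm (1 - z / of_real \<rho>) powr (a - real m) + B" by blast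
    have "(\<lambda>n. 2 * B * real n powr (-p)) \<longlonglongrightarrow> 2 * B * 0"
      using p by (intro tendsto_mult tendsto_const tendsto_neg_powr filterlim_real_sequentially) auto
    hence "\<forall>\<^sub>F n in sequentially. 2 * B * real n powr (-p) < e / 2"
      using e by (intro order_tendstoD(2)) auto
    thus "\<forall>\<^sub>F n in sequentially. dist (S n) 0 < e"
      using eventually_ge_at_top[of 1]
    proof eventually_elim
      case (elim n)
      have "S n \<le> 2 * \<eta> * 2 powr p + 2 * B * real n powr (-p)"
        unfolding S_def using B elim(2) \<eta> by (rule step2)
      also have "2 * \<eta> * 2 powr p = e / 2" by (simp add: \<eta>_def)
      finally show ?case using elim S0[of n] by simp
    qed
  qed
  \<comment> \<open>\<open>S\<close> is normalized at index \<open>n\<close>, while the coefficient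
    has index \<open>n + m\<close>; the ratio of the two powers of the index tends to 1.\<close>
  hence "(\<lambda>n. S n * (\<rho> ^ m * (real (n + m) / real n) powr (a + 1))) \<longlonglongrightarrow> 0 * (\<rho> ^ m * 1 powr (a + 1))"
    using \<open>S \<longlonglongrightarrow> 0\<close>
    by (intro tendsto_mult tendsto_powr tendsto_const) (assumption | real_asymp | simp)+
  hence "(\<lambda>n. S n * (\<rho> ^ m * (real (n + m) / real n) powr (a + 1))) \<longlonglongrightarrow> 0" by simp
  hence "(\<lambda>n. norm ((deriv ^^ (n + m)) f 0 / fact (n + m)) * \<rho> ^ (n + m) * real (n + m) powr (a + 1)) \<longlonglongrightarrow> 0"
  proof (rule Lim_transform_eventually)
    show "\<forall>\<^sub>F n in sequentially. S n * (\<rho> ^ m * (real (n + m) / real n) powr (a + 1)) =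
        norm ((deriv ^^ (n + m)) f 0 / fact (n + m)) * \<rho> ^ (n + m) * real (n + m) powr (a + 1)"
      using eventually_gt_at_top[of 0]
    proof eventually_elim
      case (elim n)
      have "real n powr (a + 1) * (real (n + m) / real n) powr (a + 1) = real (n + m) powr (a + 1)"
        using elim by (subst powr_mult[symmetric]) auto
      thus ?case by (simp add: S_def power_add mult_ac)
    qed
  qed
  thus ?thesis by (rule LIMSEQ_offset)
qed

section \<open>Coefficients of a function with an algebraic leading term\<close>

lemma has_fps_expansion_of_sums:
  fixes f :: "complex \<Rightarrow> complex"
  assumes "0 < \<rho>" and sums: "\<And>z. norm z < \<rho> \<Longrightarrow> (\<lambda>n. c n * z ^ n) sums f z"
  shows "f has_fps_expansion Abs_fps c"
proof -
  have "ereal \<rho> \<le> fps_conv_radius (Abs_fps c)"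
    unfolding fps_conv_radius_def
  proof (rule conv_radius_geI_ex)
    fix r :: real assume r: "0 < r" "ereal r < ereal \<rho>"
    show "\<exists>z. norm z = r \<and> summable (\<lambda>n. fps_nth (Abs_fps c) n * z ^ n)"
      by (rule exI[of _ "of_real r"]) (use r sums[of "of_real r"] in \<open>auto simp: sums_iff\<close>)
  qed
  moreover have "\<forall>\<^sub>F z in nhds 0. eval_fps (Abs_fps c) z = f z"
  proof -
    have "\<forall>\<^sub>F z in nhds 0. z \<in> ball (0::complex) \<rho>"
      using assms by (intro eventually_nhds_in_open) auto
    thus ?thesis
      by eventually_elim (use sums in \<open>auto simp: eval_fps_def sums_iff\<close>)
  qed
  ultimately show ?thesis using assms(1)
    by (auto simp: has_fps_expansion_def intro: less_le_trans[of _ "ereal \<rho>"])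
qed

text \<open>For a real exponent the modulus of the principal power is the power of the modulus, so
  the limit of the quotient is a little-o statement about the difference. The branch cut of
  \<open>q\<close> runs along the real ray to the right of \<rho>: it is removed from
  \<open>U\<close>, and the sector is narrowed so as to miss it.\<close>

lemma sector_remainder:
  fixes f :: "complex \<Rightarrow> complex"
  assumes U: "open U" and \<kappa>: "0 < \<kappa>" and \<rho>: "0 < \<rho>"
    and ev: "\<forall>\<^sub>F z in at_sector \<rho> \<kappa>. z \<in> U"
    and lim: "((\<lambda>z. (f z - A) / (1 - z / of_real \<rho>) powr of_real a) \<longlongrightarrow> C)
               (at_sector \<rho> \<kappa>)"
  defines "q \<equiv> \<lambda>z. (1 - z / of_real \<rho>) powr complex_of_real a"
  defines "V \<equiv> U \<inter> {z. 1 - z / of_real \<rho> \<in> - \<real>\<^sub>\<le>\<^sub>0}"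
  obtains \<kappa>' where "0 < \<kappa>'" "\<kappa>' \<le> \<kappa>" "open V" "q holomorphic_on V"
    "U \<inter> (cball 0 \<rho> - {of_real \<rho>}) \<subseteq> V"
    "\<forall>\<^sub>F z in at_sector \<rho> \<kappa>'. z \<in> V"
    "((\<lambda>z. (f z - A - C * q z) / of_real (norm (1 - z / of_real \<rho>) powr a)) \<longlongrightarrow> 0)
               (at_sector \<rho> \<kappa>')"
proof -
  \<comment> \<open>Any bound below 1 makes the sector avoid the ray, on which
    \<open>Re (z - \<rho>)\<close> equals the norm.\<close>
  define \<kappa>' where "\<kappa>' = min \<kappa> (1/2)"
  have \<kappa>': "0 < \<kappa>'" "\<kappa>' \<le> \<kappa>" "\<kappa>' \<le> 1/2" using \<kappa> by (auto simp: \<kappa>'_def)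
  have cc: "sector \<rho> \<kappa>' \<subseteq> sector \<rho> \<kappa>"
    unfolding sector_def using mult_right_mono[OF \<kappa>'(2) norm_ge_zero] by (auto intro: less_le_trans)
  have slitI: "1 - z / of_real \<rho> \<in> - \<real>\<^sub>\<le>\<^sub>0" if "Re z < \<rho> \<or> Im z \<noteq> 0" for z
    using that \<rho> by (auto simp: complex_nonpos_Reals_iff field_simps)
  have "open {z::complex. 1 - z / of_real \<rho> \<in> - \<real>\<^sub>\<le>\<^sub>0}"
  proof -
    have "open (- (\<real>\<^sub>\<le>\<^sub>0 :: complex set))" by (simp add: open_Compl)
    moreover have "continuous_on UNIV (\<lambda>z. 1 - z / complex_of_real \<rho>)"
      by (intro continuous_intros) (use \<rho> in auto)
    ultimately have "open ((\<lambda>z. 1 - z / complex_of_real \<rho>) -` (- \<real>\<^sub>\<le>\<^sub>0))" by (simp add: open_vimage)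
    thus ?thesis by (simp add: vimage_def)
  qed
  hence V: "open V" using U by (auto simp: V_def)
  have holq: "q holomorphic_on V"
    unfolding q_def V_def using \<rho> by (auto intro!: holomorphic_intros)
  have subV: "U \<inter> (cball 0 \<rho> - {of_real \<rho>}) \<subseteq> V"
  proof
    fix z :: complex assume z: "z \<in> U \<inter> (cball 0 \<rho> - {of_real \<rho>})"
    have "Re z < \<rho> \<or> Im z \<noteq> 0"
    proof (rule ccontr)
      assume "\<not> (Re z < \<rho> \<or> Im z \<noteq> 0)"
      moreover have "Re z \<le> \<rho>" using z abs_Re_le_cmod[of z] by auto
      ultimately have "z = of_real \<rho>" by (auto simp: complex_eq_iff)
      thus False using z by simp
    qed
    thus "z \<in> V" using z slitI by (auto simp: V_def)
  qed
  have in_sector: "1 - z / of_real \<rho> \<in> - \<real>\<^sub>\<le>\<^sub>0" if "z \<in> sector \<rho> \<kappa>'" for z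
  proof (rule slitI, rule ccontr)
    assume "\<not> (Re z < \<rho> \<or> Im z \<noteq> 0)"
    hence "norm (z - of_real \<rho>) = Re z - \<rho>" "Re z - \<rho> \<ge> 0" by (auto simp: cmod_def)
    moreover have "\<kappa>' * (Re z - \<rho>) \<le> 1 * (Re z - \<rho>)" using \<kappa>' calculation by (intro mult_right_mono) auto
    ultimately show False using that by (simp add: sector_def)
  qed
  have evc: "\<forall>\<^sub>F z in at_sector \<rho> \<kappa>'. z \<in> sector \<rho> \<kappa>'"
    by (simp add: eventually_at_filter)
  have evV: "\<forall>\<^sub>F z in at_sector \<rho> \<kappa>'. z \<in> V"
    using evc filter_leD[OF at_le[OF cc] ev] by eventually_elim (use in_sector in \<open>auto simp: V_def\<close>)
  have lim': "((\<lambda>z. (f z - A) / q z) \<longlongrightarrow> C) (at_sector \<rho> \<kappa>')"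
    using tendsto_mono[OF at_le[OF cc] lim] by (simp add: q_def)
  have "((\<lambda>z. (f z - A) / q z - C) \<longlongrightarrow> 0) (at_sector \<rho> \<kappa>')"
    using tendsto_diff[OF lim' tendsto_const[of C]] by simp
  hence "((\<lambda>z. norm ((f z - A) / q z - C)) \<longlongrightarrow> 0) (at_sector \<rho> \<kappa>')"
    by (rule tendsto_norm_zero)
  hence lim0: "((\<lambda>z. (f z - A - C * q z) / of_real (norm (1 - z / of_real \<rho>) powr a)) \<longlongrightarrow> 0)
               (at_sector \<rho> \<kappa>')"
  proof (rule tendsto_norm_zero_cancel[OF Lim_transform_eventually])
    show "\<forall>\<^sub>F z in at_sector \<rho> \<kappa>'. norm ((f z - A) / q z - C) =
       norm ((f z - A - C * q z) / of_real (norm (1 - z / of_real \<rho>) powr a))"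
      using evc
    proof eventually_elim
      case (elim z)
      have nz: "1 - z / of_real \<rho> \<noteq> 0" using in_sector[OF elim] by auto
      hence "q z \<noteq> 0" by (simp add: q_def)
      moreover have "norm (q z) = norm (1 - z / of_real \<rho>) powr a"
        unfolding q_def by (subst norm_powr_real_powr') auto
      ultimately show ?case
        by (simp add: norm_divide[symmetric] field_simps) (simp add: norm_divide)
    qed
  qed
  show ?thesis using that[OF \<kappa>'(1,2) V holq subV evV lim0] .
qed

text \<open>The remainder after \<open>A + C * q\<close> has negligible coefficients by
  \<open>coeff_smallo_transfer\<close>, a constant contributes only to index 0, and the coefficients
  of \<open>q\<close> are binomial ones with known asymptotics. If \<open>a\<close> is a nonnegative
  integer, \<open>Gamma (- a)\<close> is 0 by convention and so is the limit, as it should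
  be.\<close>

lemma singularity_transfer:
  fixes f :: "complex \<Rightarrow> complex"
  assumes U: "open U" and holf: "f holomorphic_on U" and sub: "cball 0 \<rho> - {of_real \<rho>} \<subseteq> U"
    and \<kappa>: "0 < \<kappa>" and \<rho>: "0 < \<rho>"
    and ev: "\<forall>\<^sub>F z in at_sector \<rho> \<kappa>. z \<in> U"
    and lim: "((\<lambda>z. (f z - A) / (1 - z / of_real \<rho>) powr of_real a) \<longlongrightarrow> C)
               (at_sector \<rho> \<kappa>)"
    and F: "f has_fps_expansion F"
  shows "(\<lambda>n. fps_nth F n * of_real (\<rho> ^ n * real n powr (a + 1))) \<longlonglongrightarrow> C / of_real (Gamma (-a))"
proof -
  define q where "q z = (1 - z / of_real \<rho>) powr complex_of_real a" for z :: complex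
  define V where "V = U \<inter> {z. 1 - z / of_real \<rho> \<in> - \<real>\<^sub>\<le>\<^sub>0}"
  obtain \<kappa>' where \<kappa>': "0 < \<kappa>'" and V: "open V" and holq: "q holomorphic_on V"
    and subV: "U \<inter> (cball 0 \<rho> - {of_real \<rho>}) \<subseteq> V"
    and evV: "\<forall>\<^sub>F z in at_sector \<rho> \<kappa>'. z \<in> V"
    and lim0: "((\<lambda>z. (f z - A - C * q z) / of_real (norm (1 - z / of_real \<rho>) powr a)) \<longlongrightarrow> 0)
               (at_sector \<rho> \<kappa>')"
    by (rule sector_remainder[OF U \<kappa> \<rho> ev lim], rule that)
       (unfold q_def[abs_def] V_def, assumption+)
  have holg: "(\<lambda>z. f z - A - C * q z) holomorphic_on V"
    by (intro holomorphic_intros holq holomorphic_on_subset[OF holf]) (auto simp: V_def)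
  have subV': "cball 0 \<rho> - {of_real \<rho>} \<subseteq> V" using subV sub by blast
  define B where "B = Abs_fps (\<lambda>n. (complex_of_real a gchoose n) * (- 1 / of_real \<rho>) ^ n)"
  have qB: "q has_fps_expansion B"
    unfolding B_def
  proof (rule has_fps_expansion_of_sums[OF \<rho>])
    fix z :: complex assume z: "norm z < \<rho>"
    have "(\<lambda>n. (complex_of_real a gchoose n) * (- z / of_real \<rho>) ^ n) sums (1 + (- z / of_real \<rho>)) powr of_real a"
      by (rule gen_binomial_complex) (use z \<rho> in \<open>simp add: norm_divide\<close>)
    moreover have "(- z / of_real \<rho>) ^ n = (- 1 / of_real \<rho>) ^ n * z ^ n" for n
      by (simp add: power_mult_distrib[symmetric])
    ultimately show "(\<lambda>n. (complex_of_real a gchoose n) * (- 1 / of_real \<rho>) ^ n * z ^ n) sums q z"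
      by (simp add: q_def mult.assoc)
  qed
  have "(\<lambda>z. f z - A - C * q z) has_fps_expansion F - fps_const A - fps_const C * B"
    by (intro fps_expansion_intros F qB)
  hence coef: "(deriv ^^ n) (\<lambda>z. f z - A - C * q z) 0 / fact n = fps_nth (F - fps_const A - fps_const C * B) n" for n
    using fps_nth_fps_expansion by metis
  have "(\<lambda>n. norm ((deriv ^^ n) (\<lambda>z. f z - A - C * q z) 0 / fact n) * \<rho> ^ n * real n powr (a + 1)) \<longlonglongrightarrow> 0"
    by (rule coeff_smallo_transfer[OF V holg subV' \<kappa>' \<rho> evV lim0])
  hence "(\<lambda>n. norm (fps_nth (F - fps_const A - fps_const C * B) n * of_real (\<rho> ^ n * real n powr (a + 1)))) \<longlonglongrightarrow> 0"
    using \<rho> by (simp only: coef) (simp add: norm_mult norm_power mult.assoc)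
  hence T1: "(\<lambda>n. fps_nth (F - fps_const A - fps_const C * B) n * of_real (\<rho> ^ n * real n powr (a + 1))) \<longlonglongrightarrow> 0"
    by (rule tendsto_norm_zero_cancel)
  have "(\<lambda>n. C * ((complex_of_real a gchoose n) / ((-1) ^ n / exp ((of_real a + 1) * of_real (ln (real n)))))) \<longlonglongrightarrow>
      C * inverse (Gamma (- of_real a))"
    by (intro tendsto_mult tendsto_const gbinomial_asymptotic)
  also have "C * inverse (Gamma (- of_real a)) = C / of_real (Gamma (-a))"
    by (simp add: divide_inverse Gamma_complex_of_real[symmetric])
  finally have T2: "(\<lambda>n. C * ((complex_of_real a gchoose n) / ((-1) ^ n / exp ((of_real a + 1) * of_real (ln (real n)))))) \<longlonglongrightarrow>
      C / of_real (Gamma (-a))" .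
  from tendsto_add[OF T1 T2]
  have "(\<lambda>n. fps_nth (F - fps_const A - fps_const C * B) n * of_real (\<rho> ^ n * real n powr (a + 1)) +
     C * ((complex_of_real a gchoose n) / ((-1) ^ n / exp ((of_real a + 1) * of_real (ln (real n)))))) \<longlonglongrightarrow>
      C / of_real (Gamma (-a))" by simp
  thus ?thesis
  proof (rule Lim_transform_eventually)
    show "\<forall>\<^sub>F n in sequentially. fps_nth (F - fps_const A - fps_const C * B) n * of_real (\<rho> ^ n * real n powr (a + 1)) +
     C * ((complex_of_real a gchoose n) / ((-1) ^ n / exp ((of_real a + 1) * of_real (ln (real n))))) =
       fps_nth F n * of_real (\<rho> ^ n * real n powr (a + 1))"
      using eventually_gt_at_top[of 0]
    proof eventually_elim
      case (elim n)
      have e: "exp ((of_real a + 1) * of_real (ln (real n))) = complex_of_real (real n powr (a + 1))"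
        using elim by (simp add: powr_def exp_of_real[symmetric] mult.commute)
      have "fps_nth (fps_const A) n = 0" using elim by simp
      hence "fps_nth (F - fps_const A - fps_const C * B) n =
          fps_nth F n - C * ((complex_of_real a gchoose n) * (- 1 / of_real \<rho>) ^ n)"
        by (simp add: B_def)
      moreover have "(- 1 / complex_of_real \<rho>) ^ n * of_real (\<rho> ^ n) = (-1) ^ n"
        unfolding of_real_power power_mult_distrib[symmetric] using \<rho> by simp
      hence "C * ((complex_of_real a gchoose n) * (- 1 / of_real \<rho>) ^ n) * of_real (\<rho> ^ n * real n powr (a + 1)) =
         C * (complex_of_real a gchoose n) * (-1) ^ n * of_real (real n powr (a + 1))"
        by (simp add: mult_ac)
      moreover have "inverse ((-1::complex) ^ n) = (-1) ^ n" by (simp add: power_inverse[symmetric])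
      ultimately show ?case unfolding e by (simp add: algebra_simps divide_inverse)
    qed
  qed
qed

section \<open>Sectors at a singularity\<close>

lemma Re_eq_norm_cos_Arg: "Re w = norm w * cos (Arg w)"
  by (metis Re_rcis rcis_cmod_Arg)

text \<open>Cosine is strictly decreasing between 0 and \<open>pi\<close>. At \<open>w = 0\<close>
  both sides are false, since \<open>Arg 0 = 0\<close>.\<close>

lemma abs_Arg_gt_iff:
  assumes "0 \<le> \<theta>" "\<theta> \<le> pi"
  shows "\<bar>Arg w\<bar> > \<theta> \<longleftrightarrow> Re w < cos \<theta> * norm w"
proof (cases "w = 0")
  case False
  have "Re w < cos \<theta> * norm w \<longleftrightarrow> cos \<bar>Arg w\<bar> < cos \<theta>"
    using False by (simp add: Re_eq_norm_cos_Arg[of w])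
  also have "\<dots> \<longleftrightarrow> \<theta> < \<bar>Arg w\<bar>"
    using assms Arg_bounded[of w] by (intro cos_mono_less_eq) auto
  finally show ?thesis by simp
qed (use assms in \<open>auto simp: Arg_zero\<close>)

lemma delta_domain_eq:
  assumes "0 \<le> \<theta>" "\<theta> \<le> pi"
  shows "delta_domain \<rho> \<epsilon> \<theta> = ball 0 (\<rho> + \<epsilon>) \<inter> sector \<rho> (cos \<theta>)"
  using abs_Arg_gt_iff[OF assms] by (auto simp: delta_domain_def sector_def)

lemma open_sector: "open (sector \<rho> \<kappa>)"
  unfolding sector_def by (intro open_Collect_less continuous_intros)

lemma sector_mono: "\<kappa> \<le> \<kappa>' \<Longrightarrow> sector \<rho> \<kappa> \<subseteq> sector \<rho> \<kappa>'"
  unfolding sector_def using mult_right_mono[of \<kappa> \<kappa>'] by (auto intro: less_le_trans)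

lemma halfplane_subset_sector: "0 \<le> \<kappa> \<Longrightarrow> {z. Re z < \<rho>} \<subseteq> sector \<rho> \<kappa>"
proof
  fix z assume "0 \<le> \<kappa>" "z \<in> {z. Re z < \<rho>}"
  moreover have "0 \<le> \<kappa> * norm (z - of_real \<rho>)" using \<open>0 \<le> \<kappa>\<close> by simp
  ultimately show "z \<in> sector \<rho> \<kappa>" unfolding sector_def mem_Collect_eq by (simp del: mult_nonneg_nonneg)
qed

lemma cball_minus_subset_sector:
  assumes "0 < \<kappa>"
  shows "cball 0 \<rho> - {of_real \<rho>} \<subseteq> sector \<rho> \<kappa>"
proof
  fix z :: complex assume z: "z \<in> cball 0 \<rho> - {of_real \<rho>}"
  hence "Re z \<le> \<rho>" using complex_Re_le_cmod[of z] by auto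
  moreover have "0 < \<kappa> * norm (z - of_real \<rho>)" using z assms by simp
  ultimately show "z \<in> sector \<rho> \<kappa>" by (simp add: sector_def)
qed

lemma sector_eq:
  assumes "0 < \<rho>"
  shows "z \<in> sector \<rho> \<kappa> \<longleftrightarrow> - \<kappa> * norm (1 - z / of_real \<rho>) < Re (1 - z / of_real \<rho>)"
proof -
  have e: "z - of_real \<rho> = - of_real \<rho> * (1 - z / of_real \<rho>)" using assms by (simp add: field_simps)
  have a: "Re (z - of_real \<rho>) = - \<rho> * Re (1 - z / of_real \<rho>)" unfolding e by simp
  have b: "norm (z - of_real \<rho>) = \<rho> * norm (1 - z / of_real \<rho>)"
    unfolding e using assms by (simp only: norm_mult norm_minus_cancel norm_of_real abs_of_pos)
  have "z \<in> sector \<rho> \<kappa> \<longleftrightarrow> \<rho> * (- Re (1 - z / of_real \<rho>)) < \<rho> * (\<kappa> * norm (1 - z / of_real \<rho>))"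
    unfolding sector_def mem_Collect_eq a b by (simp only: mult_minus_left mult_minus_right mult_ac)
  also have "\<dots> \<longleftrightarrow> - \<kappa> * norm (1 - z / of_real \<rho>) < Re (1 - z / of_real \<rho>)"
    using assms by (subst mult_less_cancel_left_pos) auto
  finally show ?thesis .
qed

lemma eventually_sector: "\<forall>\<^sub>F z in at x within sector \<rho> \<kappa>. z \<in> sector \<rho> \<kappa> \<and> z \<noteq> x"
  by (simp add: eventually_at_filter)

text \<open>The power \<alpha> < 1 multiplies the argument by \<alpha>. A sector of half-opening
  \<psi> slightly above a right angle is therefore sent into one of half-opening
  \<open>\<alpha> * \<psi>\<close> below a right angle; \<open>\<kappa>\<close> is
  \<open>- cos \<psi>\<close> and \<open>c\<close> is
  \<open>cos (\<alpha> * \<psi>)\<close>.\<close>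

lemma Re_powr_ge_in_sector:
  fixes \<alpha> :: real
  assumes "0 < \<alpha>" "\<alpha> < 1"
  obtains \<kappa> c where "0 < \<kappa>" "0 < c"
    "\<And>u. u \<noteq> 0 \<Longrightarrow> - \<kappa> * norm u < Re u \<Longrightarrow> c * norm u powr \<alpha> \<le> Re (u powr of_real \<alpha>)"
proof -
  \<comment> \<open>The midpoint between \<open>pi / 2\<close> and the smaller of \<open>pi\<close>
    and \<open>pi / (2 * \<alpha>)\<close>; beyond the latter the image would leave the right
    half-plane.\<close>
  define \<psi> where "\<psi> = (pi / 2 + min pi (pi / (2 * \<alpha>))) / 2"
  have "pi / 2 < pi / (2 * \<alpha>)" using assms by (simp add: field_simps)
  hence \<psi>: "pi / 2 < \<psi>" "\<psi> < pi" "\<psi> < pi / (2 * \<alpha>)" using pi_gt_zero by (auto simp: \<psi>_def min_def)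
  hence \<alpha>\<psi>: "\<alpha> * \<psi> < pi / 2" using assms by (simp add: field_simps)
  have "cos \<psi> < cos (pi / 2)" using \<psi> by (intro cos_monotone_0_pi) auto
  hence 1: "0 < - cos \<psi>" by simp
  have "0 < \<alpha> * \<psi>" using assms \<psi> pi_gt_zero by (intro mult_pos_pos) linarith+
  hence 2: "0 < cos (\<alpha> * \<psi>)" using \<alpha>\<psi> by (intro cos_gt_zero_pi) auto
  show ?thesis
  proof (rule that[OF 1 2])
    fix u :: complex assume u: "u \<noteq> 0" "- (- cos \<psi>) * norm u < Re u"
    hence "\<bar>Arg u\<bar> \<le> \<psi>" using abs_Arg_gt_iff[of \<psi> u] \<psi> pi_gt_zero by linarith
    hence A: "\<bar>Im (Ln u)\<bar> \<le> \<psi>" using u by (simp add: Arg_eq_Im_Ln)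
    have "Re (u powr of_real \<alpha>) = exp (\<alpha> * ln (norm u)) * cos (\<alpha> * Im (Ln u))"
      using u by (simp add: powr_def Re_exp)
    also have "exp (\<alpha> * ln (norm u)) = norm u powr \<alpha>" using u by (simp add: powr_def)
    also have "cos (\<alpha> * Im (Ln u)) = cos \<bar>\<alpha> * Im (Ln u)\<bar>" by simp
    also have "\<bar>\<alpha> * Im (Ln u)\<bar> = \<alpha> * \<bar>Im (Ln u)\<bar>" using assms by (simp add: abs_mult)
    also have "cos (\<alpha> * \<psi>) \<le> cos (\<alpha> * \<bar>Im (Ln u)\<bar>)"
    proof (intro cos_monotone_0_pi_le mult_left_mono A)
      show "\<alpha> * \<psi> \<le> pi" using \<alpha>\<psi> pi_gt_zero by linarith
    qed (use assms in auto)
    hence "norm u powr \<alpha> * cos (\<alpha> * \<psi>) \<le> norm u powr \<alpha> * cos (\<alpha> * \<bar>Im (Ln u)\<bar>)"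
      by (intro mult_left_mono) auto
    finally show "cos (\<alpha> * \<psi>) * norm u powr \<alpha> \<le> Re (u powr of_real \<alpha>)" by (simp add: mult.commute)
  qed
qed

section \<open>Principal powers near the singularity\<close>

lemma filterlim_u_at_0:
  assumes "0 < \<rho>"
  shows "((\<lambda>z. 1 - z / of_real \<rho>) \<longlongrightarrow> (0::complex)) (at (of_real \<rho>) within S)"
proof -
  have "((\<lambda>z. 1 - z / of_real \<rho>) \<longlongrightarrow> 1 - of_real \<rho> / of_real \<rho>) (at (of_real \<rho> :: complex) within S)"
    by (intro tendsto_intros) (use assms in auto)
  thus ?thesis using assms by simp
qed

lemma u_powr_tendsto_0:
  assumes "0 < \<rho>" "0 < a"
  shows "((\<lambda>z. (1 - z / of_real \<rho>) powr of_real a) \<longlongrightarrow> (0::complex)) (at (of_real \<rho>) within S)"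
proof (rule tendsto_norm_zero_cancel)
  have "((\<lambda>z. norm (1 - z / of_real \<rho>) powr a) \<longlongrightarrow> 0 powr a) (at (of_real \<rho> :: complex) within S)"
    using tendsto_norm_zero[OF filterlim_u_at_0[OF assms(1)]] assms
    by (intro tendsto_powr') auto
  thus "((\<lambda>z. norm ((1 - z / of_real \<rho>) powr complex_of_real a)) \<longlongrightarrow> 0) (at (of_real \<rho>) within S)"
    using assms by (simp add: norm_powr_real_powr')
qed

text \<open>Both arguments are below a right angle in modulus, so their sum stays within the
  principal branch.\<close>

lemma powr_mult_Re_pos:
  fixes x y :: complex
  assumes "0 < Re x" "0 < Re y"
  shows "(x * y) powr b = x powr b * y powr b"
proof -
  have nz: "x \<noteq> 0" "y \<noteq> 0" using assms by auto
  have "\<bar>Im (Ln x)\<bar> < pi / 2" "\<bar>Im (Ln y)\<bar> < pi / 2" by (rule Re_Ln_pos_lt_imp, rule assms)+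
  hence "Ln (x * y) = Ln x + Ln y" using nz by (intro Ln_times_simple) auto
  thus ?thesis using nz by (simp add: powr_def exp_add[symmetric] algebra_simps)
qed

text \<open>Since \<alpha> < 1, the argument \<open>\<alpha> * Im (Ln u)\<close> stays strictly
  inside the principal strip, even for \<open>u\<close> on the negative real axis.\<close>

lemma powr_powr_complex_real:
  fixes u :: complex and \<alpha> b :: real
  assumes "0 < \<alpha>" "\<alpha> < 1"
  shows "(u powr of_real \<alpha>) powr of_real b = u powr of_real (\<alpha> * b)"
proof (cases "u = 0")
  case False
  have "\<bar>\<alpha> * Im (Ln u)\<bar> < pi"
  proof (cases "Im (Ln u) = 0")
    case False
    have "\<bar>\<alpha> * Im (Ln u)\<bar> < 1 * \<bar>Im (Ln u)\<bar>" using assms False by (simp add: abs_mult)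
    thus ?thesis using mpi_less_Im_Ln[of u] Im_Ln_le_pi[of u] \<open>u \<noteq> 0\<close> by linarith
  qed (use pi_gt_zero in auto)
  hence "Ln (exp (of_real \<alpha> * Ln u)) = of_real \<alpha> * Ln u"
    by (intro Ln_exp) auto
  thus ?thesis using False by (simp add: powr_def mult_ac)
qed auto

text \<open>Write \<open>1 - h z / r\<close> as \<open>u powr \<alpha> * y\<close>, where
  \<open>y\<close> tends to the positive number \<open>- c / r\<close>. The power lies in a sector
  strictly inside the right half-plane, so the product has positive real part near \<rho>, and
  \<open>h\<close> approaches \<open>r\<close> from within the half-plane. Positivity of both real
  parts allows powers of the product to be split.\<close>

lemma inner_function_critical:
  fixes h :: "complex \<Rightarrow> complex" and c \<alpha> :: real
  assumes \<rho>: "0 < \<rho>" and r: "0 < r" and \<alpha>: "0 < \<alpha>" "\<alpha> < 1" and c: "c < 0" and \<kappa>0: "0 < \<kappa>\<^sub>0"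
    and lim: "((\<lambda>z. (h z - of_real r) / (1 - z / of_real \<rho>) powr of_real \<alpha>) \<longlongrightarrow> of_real c)
               (at_sector \<rho> \<kappa>\<^sub>0)"
  obtains \<kappa> where "0 < \<kappa>" "\<kappa> \<le> \<kappa>\<^sub>0"
    "filterlim h (at (of_real r) within {w. Re w < r}) (at_sector \<rho> \<kappa>)"
    "\<And>b. ((\<lambda>z. (1 - h z / of_real r) powr of_real b / (1 - z / of_real \<rho>) powr of_real (\<alpha> * b)) \<longlongrightarrow>
       of_real ((- c / r) powr b)) (at_sector \<rho> \<kappa>)"
proof -
  obtain \<kappa>\<^sub>1 d where \<kappa>1: "0 < \<kappa>\<^sub>1" and d: "0 < d" and
    Re_ge: "\<And>u. u \<noteq> 0 \<Longrightarrow> - \<kappa>\<^sub>1 * norm u < Re u \<Longrightarrow> d * norm u powr \<alpha> \<le> Re (u powr of_real \<alpha>)"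
    using Re_powr_ge_in_sector[OF \<alpha>] by metis
  define \<kappa> where "\<kappa> = min \<kappa>\<^sub>0 \<kappa>\<^sub>1"
  have \<kappa>: "0 < \<kappa>" "\<kappa> \<le> \<kappa>\<^sub>0" "\<kappa> \<le> \<kappa>\<^sub>1" using \<kappa>0 \<kappa>1 by (auto simp: \<kappa>_def)
  let ?F = "at_sector \<rho> \<kappa>"
  define u where "u z = 1 - z / complex_of_real \<rho>" for z
  define q where "q = - c / r"
  have q: "0 < q" using c r by (simp add: q_def divide_neg_pos)
  define y where "y z = (1 - h z / of_real r) / u z powr of_real \<alpha>" for z
  have u0: "u z \<noteq> 0" if "z \<noteq> of_real \<rho>" for z using that \<rho> by (auto simp: u_def)
  have ylim: "(y \<longlongrightarrow> of_real q) ?F"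
  proof -
    have "((\<lambda>z. - (1 / of_real r) * ((h z - of_real r) / u z powr of_real \<alpha>)) \<longlongrightarrow> - (1 / of_real r) * of_real c) ?F"
      using tendsto_mono[OF at_le[OF sector_mono[OF \<kappa>(2)]] lim] unfolding u_def
      by (intro tendsto_mult tendsto_const)
    also have "(\<lambda>z. - (1 / of_real r) * ((h z - of_real r) / u z powr of_real \<alpha>)) = y"
    proof
      fix z
      have "1 - h z / of_real r = - (1 / of_real r) * (h z - of_real r)" using r by (simp add: field_simps)
      thus "- (1 / of_real r) * ((h z - of_real r) / u z powr of_real \<alpha>) = y z" by (simp add: y_def)
    qed
    finally show ?thesis by (simp add: q_def)
  qed
  have h_eq: "1 - h z / of_real r = u z powr of_real \<alpha> * y z" if "z \<noteq> of_real \<rho>" for z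
    using u0[OF that] by (simp add: y_def)
  \<comment> \<open>Half of the factor \<open>d * q\<close> in the lower bound for the main term, so
    that the error in \<open>y\<close> cannot change the sign of the real part.\<close>
  define e where "e = d * q / 2"
  have e: "0 < e" using d q by (simp add: e_def)
  have yclose: "\<forall>\<^sub>F z in ?F. norm (y z - of_real q) < e"
    using tendstoD[OF ylim e] by (simp add: dist_norm)
  have Re_u: "\<forall>\<^sub>F z in ?F. 0 < Re (u z powr of_real \<alpha>) \<and> d * norm (u z) powr \<alpha> \<le> Re (u z powr of_real \<alpha>)"
    using eventually_sector
  proof eventually_elim
    case (elim z)
    have "z \<in> sector \<rho> \<kappa>\<^sub>1" using elim sector_mono[OF \<kappa>(3)] by blast
    hence "d * norm (u z) powr \<alpha> \<le> Re (u z powr of_real \<alpha>)"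
      using sector_eq[OF \<rho>] u0 elim by (intro Re_ge) (auto simp: u_def)
    moreover have "0 < d * norm (u z) powr \<alpha>" using d u0 elim by simp
    ultimately show ?case by linarith
  qed
  have Re_h: "\<forall>\<^sub>F z in ?F. 0 < Re (1 - h z / of_real r)"
    using eventually_sector yclose Re_u
  proof eventually_elim
    case (elim z)
    define n where "n = norm (u z) powr \<alpha>"
    have n: "0 < n" using u0 elim by (simp add: n_def)
    have nn: "norm (u z powr of_real \<alpha>) = n" unfolding n_def by (subst norm_powr_real_powr') auto
    have "1 - h z / of_real r = of_real q * (u z powr of_real \<alpha>) + u z powr of_real \<alpha> * (y z - of_real q)"
      using h_eq elim by (simp add: algebra_simps)
    hence "Re (1 - h z / of_real r) = q * Re (u z powr of_real \<alpha>) + Re (u z powr of_real \<alpha> * (y z - of_real q))"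
    proof -
      have "Re (of_real q * w) = q * Re w" for w by simp
      thus ?thesis using \<open>1 - h z / of_real r = _\<close> by (simp only: plus_complex.sel)
    qed
    moreover have "q * (d * n) \<le> q * Re (u z powr of_real \<alpha>)"
      using elim(3) q by (intro mult_left_mono) (auto simp: n_def)
    moreover have "\<bar>Re (u z powr of_real \<alpha> * (y z - of_real q))\<bar> \<le> n * e"
    proof -
      have "\<bar>Re (u z powr of_real \<alpha> * (y z - of_real q))\<bar> \<le> norm (u z powr of_real \<alpha> * (y z - of_real q))"
        by (rule abs_Re_le_cmod)
      also have "\<dots> \<le> n * e" unfolding norm_mult nn using elim(2) n by (intro mult_left_mono) auto
      finally show ?thesis .
    qed
    moreover have "n * e < q * (d * n)" using n d q by (simp add: e_def)
    ultimately show ?case by linarith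
  qed
  have hlim: "(h \<longlongrightarrow> of_real r) ?F"
  proof -
    have "((\<lambda>z. of_real r * (1 - u z powr of_real \<alpha> * y z)) \<longlongrightarrow> of_real r * (1 - 0 * of_real q)) ?F"
      unfolding u_def by (intro tendsto_intros ylim u_powr_tendsto_0[OF \<rho> \<alpha>(1)])
    hence "((\<lambda>z. of_real r * (1 - u z powr of_real \<alpha> * y z)) \<longlongrightarrow> of_real r) ?F" by simp
    thus ?thesis
    proof (rule Lim_transform_eventually)
      show "\<forall>\<^sub>F z in ?F. of_real r * (1 - u z powr of_real \<alpha> * y z) = h z"
        using eventually_sector
      proof eventually_elim
        case (elim z)
        show ?case unfolding h_eq[symmetric, OF conjunct2[OF elim]] using r by simp
      qed
    qed
  qed
  have Re_h': "Re w < r" if "0 < Re (1 - w / of_real r)" for w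
    using that r by (simp add: field_simps)
  have L1: "filterlim h (at (of_real r) within {w. Re w < r}) ?F"
    unfolding filterlim_at
  proof
    show "\<forall>\<^sub>F z in ?F. h z \<in> {w. Re w < r} \<and> h z \<noteq> of_real r"
      using Re_h
    proof eventually_elim
      case (elim z)
      from Re_h'[OF elim] show ?case by auto
    qed
  qed (rule hlim)
  have L2: "((\<lambda>z. (1 - h z / of_real r) powr of_real b / u z powr of_real (\<alpha> * b)) \<longlongrightarrow>
       of_real (q powr b)) ?F" for b :: real
  proof -
    have "((\<lambda>z. y z powr of_real b) \<longlongrightarrow> of_real q powr of_real b) ?F"
      using q by (intro tendsto_powr_complex ylim tendsto_const) (auto simp: complex_nonpos_Reals_iff)
    also have "complex_of_real q powr of_real b = of_real (q powr b)" using q by (simp add: powr_of_real)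
    finally have *: "((\<lambda>z. y z powr of_real b) \<longlongrightarrow> of_real (q powr b)) ?F" .
    have "\<forall>\<^sub>F z in ?F. 0 < Re (y z)"
      using order_tendstoD(1)[OF tendsto_Re[OF ylim], of 0] q by simp
    hence "\<forall>\<^sub>F z in ?F. y z powr of_real b = (1 - h z / of_real r) powr of_real b / u z powr of_real (\<alpha> * b)"
      using eventually_sector Re_u
    proof eventually_elim
      case (elim z)
      have "(1 - h z / of_real r) powr of_real b = (u z powr of_real \<alpha>) powr of_real b * y z powr of_real b"
        using h_eq elim by (simp add: powr_mult_Re_pos)
      also have "(u z powr of_real \<alpha>) powr of_real b = u z powr of_real (\<alpha> * b)"
        by (rule powr_powr_complex_real[OF \<alpha>])
      finally show ?case using u0 elim by simp
    qed
    with * show ?thesis by (rule Lim_transform_eventually)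
  qed
  show ?thesis using that[OF \<kappa>(1,2) L1] L2 unfolding u_def q_def by simp
qed

section \<open>Singular continuations\<close>

definition fps_complex :: "real fps \<Rightarrow> complex fps" where
  "fps_complex f = Abs_fps (\<lambda>n. complex_of_real (fps_nth f n))"

lemma fps_complex_nth [simp]: "fps_nth (fps_complex f) n = complex_of_real (fps_nth f n)"
  by (simp add: fps_complex_def)

lemma fps_complex_mult: "fps_complex (f * g) = fps_complex f * fps_complex g"
  by (rule fps_ext) (simp add: fps_mult_nth)

lemma fps_complex_power: "fps_complex (f ^ n) = fps_complex f ^ n"
  by (induction n) (auto simp: fps_complex_mult intro!: fps_ext)

lemma fps_complex_compose: "fps_complex (fps_compose f g) = fps_compose (fps_complex f) (fps_complex g)"
  by (rule fps_ext) (simp add: fps_compose_nth fps_complex_power[symmetric])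

lemma fps_complex_higher_deriv: "fps_complex ((fps_deriv ^^ s) f) = (fps_deriv ^^ s) (fps_complex f)"
proof (induction s)
  case (Suc s)
  have "fps_complex (fps_deriv g) = fps_deriv (fps_complex g)" for g by (rule fps_ext) simp
  thus ?case by (simp add: Suc)
qed simp

text \<open>Only what the transfer uses is recorded: analyticity on the punctured closed disc and in
  a sector near \<rho>. The open set \<open>U\<close> is arbitrary because the domain of a
  composition is a preimage and need not be a delta domain.\<close>

definition singular_continuation ::
    "real fps \<Rightarrow> real \<Rightarrow> (complex \<Rightarrow> complex) \<Rightarrow> complex set \<Rightarrow> real \<Rightarrow> bool" where
  "singular_continuation f \<rho> \<phi> U \<kappa> \<longleftrightarrow> 0 < \<rho> \<and> 0 < \<kappa> \<and>
     (\<forall>z. norm z < \<rho> \<longrightarrow> (\<lambda>n. complex_of_real (fps_nth f n) * z ^ n) sums \<phi> z) \<and>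
     open U \<and> \<phi> holomorphic_on U \<and> cball 0 \<rho> - {of_real \<rho>} \<subseteq> U \<and>
     (\<forall>\<^sub>F z in at_sector \<rho> \<kappa>. z \<in> U)"

lemma singular_continuation_fps:
  assumes "singular_continuation f \<rho> \<phi> U \<kappa>"
  shows "\<phi> has_fps_expansion fps_complex f"
  unfolding fps_complex_def
  by (rule has_fps_expansion_of_sums[of \<rho>]) (use assms in \<open>auto simp: singular_continuation_def\<close>)

text \<open>Close to \<rho> the condition on the norm in \<open>delta_domain\<close> is void, so the
  domain is there a sector with \<open>\<kappa> = cos \<theta>\<close>, which is positive because
  \<open>\<theta> < pi / 2\<close>.\<close>

lemma singular_expansion_continuation:
  assumes "singular_expansion f \<rho> lam c"
  obtains \<phi> U \<kappa> P where "singular_continuation f \<rho> \<phi> U \<kappa>"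
    "((\<lambda>z. (\<phi> z - poly (map_poly complex_of_real P) (1 - z / of_real \<rho>)) / (1 - z / of_real \<rho>) powr of_real lam) \<longlongrightarrow> of_real c)
      (at_sector \<rho> \<kappa>)"
    "lam < 0 \<Longrightarrow> P = 0" "0 < lam \<Longrightarrow> lam < 1 \<Longrightarrow> degree P = 0"
proof -
  from assms obtain \<epsilon> \<theta> and \<phi> :: "complex \<Rightarrow> complex" and P :: "real poly" and e :: "complex \<Rightarrow> complex"
    where \<rho>: "0 < \<rho>" and \<epsilon>: "0 < \<epsilon>" and \<theta>: "0 < \<theta>" "\<theta> < pi / 2"
    and sums: "\<forall>z. norm z < \<rho> \<longrightarrow> (\<lambda>n. complex_of_real (fps_nth f n) * z ^ n) sums \<phi> z"
    and ana: "\<phi> analytic_on delta_domain \<rho> \<epsilon> \<theta>"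
    and P: "lam < 0 \<longrightarrow> P = 0" "0 < lam \<and> lam < 1 \<longrightarrow> degree P = 0"
    and e: "(e \<longlongrightarrow> 0) (at (complex_of_real \<rho>) within delta_domain \<rho> \<epsilon> \<theta>)"
    and exp: "\<forall>z \<in> delta_domain \<rho> \<epsilon> \<theta>.
              \<phi> z = poly (map_poly complex_of_real P) (1 - z / complex_of_real \<rho>)
                  + complex_of_real c * (1 - z / complex_of_real \<rho>) powr complex_of_real lam
                    * (1 + e z)"
    unfolding singular_expansion_def by blast
  define \<kappa> where "\<kappa> = cos \<theta>"
  have \<kappa>: "0 < \<kappa>" using \<theta> by (auto simp: \<kappa>_def intro!: cos_gt_zero_pi)
  define U where "U = delta_domain \<rho> \<epsilon> \<theta>"
  have U_eq: "U = ball 0 (\<rho> + \<epsilon>) \<inter> sector \<rho> \<kappa>"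
    unfolding U_def \<kappa>_def by (rule delta_domain_eq) (use \<theta> in auto)
  have mem: "of_real \<rho> \<in> ball (0::complex) (\<rho> + \<epsilon>)" using \<rho> \<epsilon> by simp
  have at_eq: "at (of_real \<rho>) within U = at_sector \<rho> \<kappa>"
    unfolding U_eq by (rule at_within_nhd[of _ "ball 0 (\<rho> + \<epsilon>)"]) (use mem in auto)
  have openU: "open U" unfolding U_eq by (intro open_Int open_ball open_sector)
  have evU: "\<forall>\<^sub>F z in at_sector \<rho> \<kappa>. z \<in> U \<and> z \<noteq> of_real \<rho>"
    unfolding at_eq[symmetric] by (simp add: eventually_at_filter)
  have cb: "cball 0 \<rho> - {of_real \<rho>} \<subseteq> U"
    unfolding U_eq using cball_minus_subset_sector[OF \<kappa>, of \<rho>] \<epsilon> by auto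
  have "singular_continuation f \<rho> \<phi> U \<kappa>"
    unfolding singular_continuation_def using \<rho> \<kappa> sums openU cb ana evU
    by (auto simp: U_def[symmetric] analytic_imp_holomorphic elim: eventually_mono)
  moreover have "((\<lambda>z. (\<phi> z - poly (map_poly complex_of_real P) (1 - z / of_real \<rho>)) / (1 - z / of_real \<rho>) powr of_real lam) \<longlongrightarrow> of_real c)
      (at_sector \<rho> \<kappa>)"
  proof (rule Lim_transform_eventually)
    have "((\<lambda>z. of_real c * (1 + e z)) \<longlongrightarrow> of_real c * (1 + 0)) (at_sector \<rho> \<kappa>)"
      using e unfolding U_def[symmetric] at_eq by (intro tendsto_intros)
    thus "((\<lambda>z. of_real c * (1 + e z)) \<longlongrightarrow> of_real c) (at_sector \<rho> \<kappa>)" by simp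
    show "\<forall>\<^sub>F z in at_sector \<rho> \<kappa>. of_real c * (1 + e z) =
       (\<phi> z - poly (map_poly complex_of_real P) (1 - z / of_real \<rho>)) / (1 - z / of_real \<rho>) powr of_real lam"
      using evU
    proof eventually_elim
      case (elim z)
      have "1 - z / of_real \<rho> \<noteq> 0" using elim \<rho> by (auto simp: field_simps)
      hence nz: "(1 - z / of_real \<rho>) powr complex_of_real lam \<noteq> 0" by simp
      have "\<phi> z - poly (map_poly complex_of_real P) (1 - z / of_real \<rho>) =
         (1 - z / complex_of_real \<rho>) powr complex_of_real lam * (of_real c * (1 + e z))"
        using exp elim by (simp add: U_def[symmetric])
      thus ?case using nz by simp
    qed
  qed
  ultimately show ?thesis using that P by blast
qed

section \<open>Nonnegative coefficients and the boundary circle\<close>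

lemma radial_approach:
  assumes "0 < \<rho>" "0 \<le> \<kappa>"
  defines "x \<equiv> \<lambda>n. \<rho> * (1 - 1 / (real n + 2))"
  shows "filterlim (\<lambda>n. complex_of_real (x n)) (at_sector \<rho> \<kappa>) sequentially"
    and "0 < x n" "x n < \<rho>" "x \<longlonglongrightarrow> \<rho>"
proof -
  show x: "0 < x n" "x n < \<rho>" for n
  proof -
    have "0 < 1 - 1 / (real n + 2)" "1 - 1 / (real n + 2) < 1" by (auto simp: field_simps)
    thus "0 < x n" "x n < \<rho>" using assms(1) by (simp_all add: x_def)
  qed
  show lim: "x \<longlonglongrightarrow> \<rho>" unfolding x_def by real_asymp
  have "\<forall>n. complex_of_real (x n) \<in> sector \<rho> \<kappa> \<and> complex_of_real (x n) \<noteq> of_real \<rho>"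
    using x halfplane_subset_sector[OF assms(2), of \<rho>] by (auto simp: less_imp_neq)
  thus "filterlim (\<lambda>n. complex_of_real (x n)) (at_sector \<rho> \<kappa>) sequentially"
    unfolding filterlim_at using tendsto_of_real[OF lim] by auto
qed

text \<open>Abel's theorem for nonnegative coefficients, by monotonicity along the radius. The
  inequality serves to show that the boundary value of \<open>M\<close> is not 0; the identity
  equates the constant in the expansion of \<open>H\<close> with the sum of \<open>H\<close> at its
  singularity.\<close>

lemma singular_continuation_boundary_limit:
  assumes sc: "singular_continuation f \<rho> \<phi> U \<kappa>" and nn: "nonneg_coeffs f"
    and lim: "(\<phi> \<longlongrightarrow> l) (at_sector \<rho> \<kappa>)"
  shows "(\<Sum>k<K. fps_nth f k * \<rho> ^ k) \<le> Re l"
    and "(\<lambda>n. fps_nth f n * \<rho> ^ n) sums S \<Longrightarrow> l = of_real S"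
proof -
  have \<rho>: "0 < \<rho>" and \<kappa>: "0 < \<kappa>"
    and sums: "\<And>z. norm z < \<rho> \<Longrightarrow> (\<lambda>n. complex_of_real (fps_nth f n) * z ^ n) sums \<phi> z"
    using sc by (auto simp: singular_continuation_def)
  \<comment> \<open>Adding 2 in the denominator keeps every point strictly between 0 and \<rho>,
    including the first.\<close>
  define x where "x n = \<rho> * (1 - 1 / (real n + 2))" for n :: nat
  note rad = radial_approach[OF \<rho> less_imp_le[OF \<kappa>], folded x_def]
  define s where "s n = Re (\<phi> (of_real (x n)))" for n
  have sreal: "(\<lambda>k. fps_nth f k * x n ^ k) sums s n" for n
    using sums_Re[OF sums[of "of_real (x n)"]] rad(2,3)[of n] by (simp add: s_def abs_of_pos)
  have "Im (\<phi> (of_real (x n))) = 0" for n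
    using sums_Im[OF sums[of "of_real (x n)"]] rad(2,3)[of n] by (simp add: abs_of_pos sums_iff flip: of_real_power)
  hence seq: "\<phi> (of_real (x n)) = of_real (s n)" for n by (simp add: s_def complex_eq_iff)
  have lim': "(\<lambda>n. \<phi> (of_real (x n))) \<longlonglongrightarrow> l" by (rule filterlim_compose[OF lim rad(1)])
  have slim: "s \<longlonglongrightarrow> Re l" unfolding s_def[abs_def] by (rule tendsto_Re[OF lim'])
  have Iml: "Im l = 0"
    using LIMSEQ_unique[OF tendsto_Im[OF lim'[unfolded seq]]] by fastforce
  have fnn: "0 \<le> fps_nth f k" for k using nn by (simp add: nonneg_coeffs_def)
  show part: "(\<Sum>k<K. fps_nth f k * \<rho> ^ k) \<le> Re l" for K
  proof (rule LIMSEQ_le)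
    show "(\<lambda>n. \<Sum>k<K. fps_nth f k * x n ^ k) \<longlonglongrightarrow> (\<Sum>k<K. fps_nth f k * \<rho> ^ k)"
      by (intro tendsto_intros rad(4))
    show "s \<longlonglongrightarrow> Re l" by (rule slim)
    have "(\<Sum>k<K. fps_nth f k * x n ^ k) \<le> s n" for n
      using sum_le_suminf[of "\<lambda>k. fps_nth f k * x n ^ k" "{..<K}"] sreal[of n] fnn rad(2)[of n]
      by (simp add: sums_iff)
    thus "\<exists>N. \<forall>n\<ge>N. (\<Sum>k<K. fps_nth f k * x n ^ k) \<le> s n" by blast
  qed
  show "l = of_real S" if S: "(\<lambda>n. fps_nth f n * \<rho> ^ n) sums S"
  proof -
    have "S \<le> Re l"
      using S part unfolding sums_def by (intro LIMSEQ_le_const2) auto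
    moreover have "Re l \<le> S"
    proof (rule LIMSEQ_le_const2[OF slim])
      have "s n \<le> S" for n
        by (rule sums_le[OF _ sreal S]) (use fnn rad(2,3)[of n] in \<open>auto intro!: mult_left_mono power_mono\<close>)
      thus "\<exists>N. \<forall>n\<ge>N. s n \<le> S" by blast
    qed
    ultimately show ?thesis using Iml by (simp add: complex_eq_iff)
  qed
qed

text \<open>Two consecutive positive coefficients make the triangle inequality strict away from
  \<rho>: on the closed disc the modulus of \<open>a + b * z\<close> equals
  \<open>a + b * \<rho>\<close> only at \<open>z = \<rho>\<close>. Applied to \<open>H\<close>, this
  puts its values on the punctured closed disc inside the open disc of radius
  \<open>\<rho>\<^sub>G\<close>, where \<open>G\<close> is analytic.\<close>

lemma singular_continuation_norm_less:
  assumes sc: "singular_continuation f \<rho> \<phi> U \<kappa>" and nn: "nonneg_coeffs f"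
    and S: "(\<lambda>n. fps_nth f n * \<rho> ^ n) sums S"
    and pos: "0 < fps_nth f n" "0 < fps_nth f (Suc n)"
    and z: "z \<in> cball 0 \<rho> - {of_real \<rho>}"
  shows "norm (\<phi> z) < S"
proof -
  have \<rho>: "0 < \<rho>" and sums: "\<And>z. norm z < \<rho> \<Longrightarrow> (\<lambda>n. complex_of_real (fps_nth f n) * z ^ n) sums \<phi> z"
    and U: "open U" "\<phi> holomorphic_on U" "z \<in> U"
    using sc z by (auto simp: singular_continuation_def)
  define a where "a = fps_nth f n"
  define b where "b = fps_nth f (Suc n)"
  have fnn: "0 \<le> fps_nth f k" for k using nn by (simp add: nonneg_coeffs_def)
  \<comment> \<open>All terms are bounded by their values at \<rho> except those of index
    \<open>n\<close> and \<open>n + 1\<close>, which are kept together.\<close>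
  define B where "B w = S - (a + b * \<rho>) * \<rho> ^ n + norm (of_real a + of_real b * w) * norm w ^ n" for w :: complex
  have bound: "norm (\<phi> w) \<le> B w" if w: "norm w < \<rho>" for w
  proof -
    define g where "g k = fps_nth f k - (if k \<in> {n, Suc n} then fps_nth f k else 0)" for k
    have g0: "0 \<le> g k" for k using fnn by (simp add: g_def)
    have "(\<lambda>k. complex_of_real (fps_nth f k) * w ^ k - (if k \<in> {n, Suc n} then complex_of_real (fps_nth f k) * w ^ k else 0))
       sums (\<phi> w - (\<Sum>k\<in>{n, Suc n}. complex_of_real (fps_nth f k) * w ^ k))"
      by (intro sums_diff sums w sums_If_finite_set) auto
    moreover have "(\<lambda>k. complex_of_real (fps_nth f k) * w ^ k - (if k \<in> {n, Suc n} then complex_of_real (fps_nth f k) * w ^ k else 0))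
        = (\<lambda>k. of_real (g k) * w ^ k)" by (auto simp: g_def)
    moreover have "(\<Sum>k\<in>{n, Suc n}. complex_of_real (fps_nth f k) * w ^ k) = (of_real a + of_real b * w) * w ^ n"
      by (simp add: a_def b_def algebra_simps)
    ultimately have 1: "(\<lambda>k. of_real (g k) * w ^ k) sums (\<phi> w - (of_real a + of_real b * w) * w ^ n)"
      by (simp only:)
    have "(\<lambda>k. fps_nth f k * \<rho> ^ k - (if k \<in> {n, Suc n} then fps_nth f k * \<rho> ^ k else 0))
       sums (S - (\<Sum>k\<in>{n, Suc n}. fps_nth f k * \<rho> ^ k))"
      by (intro sums_diff S sums_If_finite_set) auto
    moreover have "(\<lambda>k. fps_nth f k * \<rho> ^ k - (if k \<in> {n, Suc n} then fps_nth f k * \<rho> ^ k else 0)) = (\<lambda>k. g k * \<rho> ^ k)"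
      by (auto simp: g_def)
    moreover have "(\<Sum>k\<in>{n, Suc n}. fps_nth f k * \<rho> ^ k) = (a + b * \<rho>) * \<rho> ^ n"
      by (simp add: a_def b_def algebra_simps)
    ultimately have 2: "(\<lambda>k. g k * \<rho> ^ k) sums (S - (a + b * \<rho>) * \<rho> ^ n)"
      by (simp only:)
    have "norm (\<phi> w - (of_real a + of_real b * w) * w ^ n) \<le> S - (a + b * \<rho>) * \<rho> ^ n"
      by (rule norm_sums_le[OF 1 2])
         (use g0 w in \<open>auto simp: norm_mult norm_power intro!: mult_left_mono power_mono\<close>)
    moreover have "norm (\<phi> w) \<le> norm (\<phi> w - (of_real a + of_real b * w) * w ^ n) + norm ((of_real a + of_real b * w) * w ^ n)"
      using norm_triangle_ineq[of "\<phi> w - (of_real a + of_real b * w) * w ^ n" "(of_real a + of_real b * w) * w ^ n"] by simp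
    ultimately show ?thesis by (simp add: B_def norm_mult norm_power)
  qed
  \<comment> \<open>On the circle \<phi> is known only as a continuation and not as a sum; the bound
    is carried there along the radius by continuity.\<close>
  define t where "t k = 1 - 1 / (real k + 2)" for k :: nat
  have t: "0 < t k" "t k < 1" for k by (auto simp: t_def field_simps)
  have "t \<longlonglongrightarrow> 1" unfolding t_def by real_asymp
  hence tz: "(\<lambda>k. of_real (t k) * z) \<longlonglongrightarrow> z" using tendsto_mult[OF tendsto_of_real, of t 1 sequentially "\<lambda>_. z" z] by simp
  have cont: "isCont \<phi> z" using U by (meson continuous_on_eq_continuous_at holomorphic_on_imp_continuous_on)
  have L1: "(\<lambda>k. norm (\<phi> (of_real (t k) * z))) \<longlonglongrightarrow> norm (\<phi> z)"
    by (rule tendsto_norm[OF isCont_tendsto_compose[OF cont tz]])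
  have L2: "(\<lambda>k. B (of_real (t k) * z)) \<longlonglongrightarrow> B z"
    unfolding B_def by (intro tendsto_intros tz)
  have "norm (\<phi> z) \<le> B z"
  proof (rule LIMSEQ_le[OF L1 L2], intro exI allI impI bound)
    fix k :: nat
    have "norm (of_real (t k) * z) = t k * norm z" using t[of k] by (simp add: norm_mult)
    also have "\<dots> \<le> t k * \<rho>" using z t[of k] by (intro mult_left_mono) auto
    also have "\<dots> < 1 * \<rho>" using t[of k] \<rho> by (intro mult_strict_right_mono) auto
    finally show "norm (of_real (t k) * z) < \<rho>" by simp
  qed
  also have "B z < S"
  proof -
    have ab: "0 < a" "0 < b" using pos by (auto simp: a_def b_def)
    have zr: "norm z \<le> \<rho>" using z by simp
    have "Re z < \<rho>"
    proof (rule ccontr)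
      assume "\<not> Re z < \<rho>"
      hence "Re z = \<rho>" using complex_Re_le_cmod[of z] zr by linarith
      moreover have "Im z = 0"
        using cmod_power2[of z] power_mono[OF zr norm_ge_zero, of 2] \<open>Re z = \<rho>\<close> by simp
      ultimately show False using z by (auto simp: complex_eq_iff)
    qed
    hence "a * b * Re z < a * b * \<rho>" using ab by simp
    moreover have "b\<^sup>2 * (norm z)\<^sup>2 \<le> b\<^sup>2 * \<rho>\<^sup>2" using zr by (intro mult_left_mono power_mono) auto
    moreover have "(norm (of_real a + of_real b * z))\<^sup>2 = a\<^sup>2 + 2 * (a * b * Re z) + b\<^sup>2 * (norm z)\<^sup>2"
      unfolding cmod_power2 by (simp add: power2_eq_square algebra_simps)
    ultimately have "(norm (of_real a + of_real b * z))\<^sup>2 < (a + b * \<rho>)\<^sup>2"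
      by (simp add: power2_eq_square algebra_simps)
    hence lt: "norm (of_real a + of_real b * z) < a + b * \<rho>"
      by (rule power2_less_imp_less) (use ab \<rho> in auto)
    have "norm (of_real a + of_real b * z) * norm z ^ n \<le> norm (of_real a + of_real b * z) * \<rho> ^ n"
      using zr by (intro mult_left_mono power_mono) auto
    also have "\<dots> < (a + b * \<rho>) * \<rho> ^ n" using lt \<rho> by (intro mult_strict_right_mono) auto
    finally show ?thesis by (simp add: B_def)
  qed
  finally show ?thesis .
qed

text \<open>Since \<open>Gamma (1 - lam)\<close> is positive, \<open>Gamma (- lam)\<close> is
  negative; nonnegative coefficients then force \<open>c < 0\<close>. The nonzero limit makes the
  coefficients eventually positive, which rules out periodicity.\<close>

lemma inner_coeff_asymptotics:
  assumes sc: "singular_continuation f \<rho> \<phi> U \<kappa>" and nn: "nonneg_coeffs f"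
    and lam: "0 < lam" "lam < 1" and c: "c \<noteq> 0"
    and lim: "((\<lambda>z. (\<phi> z - p) / (1 - z / of_real \<rho>) powr of_real lam) \<longlongrightarrow> of_real c)
      (at_sector \<rho> \<kappa>)"
  shows "(\<lambda>n. fps_nth f n * \<rho> ^ n * real n powr (lam + 1)) \<longlonglongrightarrow> c / Gamma (- lam)"
    and "c < 0" "Gamma (- lam) < 0" "\<forall>\<^sub>F n in sequentially. 0 < fps_nth f n"
proof -
  have \<rho>: "0 < \<rho>" using sc by (simp add: singular_continuation_def)
  have "(\<lambda>n. fps_nth (fps_complex f) n * of_real (\<rho> ^ n * real n powr (lam + 1))) \<longlonglongrightarrow> of_real c / of_real (Gamma (- lam))"
    by (rule singularity_transfer[OF _ _ _ _ _ _ lim singular_continuation_fps[OF sc]])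
       (use sc in \<open>auto simp: singular_continuation_def\<close>)
  from tendsto_Re[OF this]
  show L: "(\<lambda>n. fps_nth f n * \<rho> ^ n * real n powr (lam + 1)) \<longlonglongrightarrow> c / Gamma (- lam)"
    by (simp add: mult.assoc flip: of_real_divide of_real_mult of_real_power)
  have "- lam \<notin> \<int>\<^sub>\<le>\<^sub>0" using lam by (intro not_nonpos_Int_gt_minus_1) auto
  from Gamma_plus1[OF this] have "Gamma (1 - lam) = - lam * Gamma (- lam)" by simp
  moreover have "0 < Gamma (1 - lam)" using lam by (intro Gamma_real_pos) auto
  ultimately show Gn: "Gamma (- lam) < 0" using lam by (simp add: zero_less_mult_iff mult_less_0_iff)
  have "0 \<le> c / Gamma (- lam)"
    by (rule LIMSEQ_le_const[OF L]) (use nn \<rho> in \<open>auto simp: nonneg_coeffs_def\<close>)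
  thus "c < 0" using Gn c by (simp add: zero_le_divide_iff)
  hence "0 < c / Gamma (- lam)" using Gn by (simp add: divide_neg_neg)
  from order_tendstoD(1)[OF L this] show "\<forall>\<^sub>F n in sequentially. 0 < fps_nth f n"
  proof eventually_elim
    case (elim n)
    show ?case
    proof (rule ccontr)
      assume "\<not> 0 < fps_nth f n"
      hence "fps_nth f n = 0" using nn by (simp add: nonneg_coeffs_def order_antisym_conv not_less)
      thus False using elim by simp
    qed
  qed
qed

text \<open>The differentiation following \<open>k\<close> earlier ones contributes the factor
  \<open>(k - a) / \<rho>\<close>; the product is a rising factorial of \<open>- a\<close>.\<close>

lemma higher_deriv_u_powr:
  assumes \<rho>: "0 < \<rho>" and z: "1 - z / of_real \<rho> \<notin> \<real>\<^sub>\<le>\<^sub>0"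
  shows "(deriv ^^ s) (\<lambda>w. (1 - w / of_real \<rho>) powr complex_of_real a) z =
    of_real (pochhammer (- a) s / \<rho> ^ s) * (1 - z / of_real \<rho>) powr of_real (a - real s)"
  using z
proof (induction s arbitrary: z)
  case (Suc s)
  define W where "W = (\<lambda>z. 1 - z / complex_of_real \<rho>) -` (- \<real>\<^sub>\<le>\<^sub>0)"
  have W: "open W"
    unfolding W_def by (intro open_vimage continuous_intros) (use \<rho> in \<open>auto simp: open_Compl\<close>)
  have ev: "\<forall>\<^sub>F w in nhds z. w \<in> W" using W Suc.prems by (intro eventually_nhds_in_open) (auto simp: W_def)
  define C where "C = complex_of_real (pochhammer (- a) s / \<rho> ^ s)"
  have "(deriv ^^ Suc s) (\<lambda>w. (1 - w / of_real \<rho>) powr complex_of_real a) z =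
     deriv (\<lambda>w. C * (1 - w / of_real \<rho>) powr of_real (a - real s)) z"
    unfolding funpow.simps o_def
    by (intro deriv_cong_ev refl) (use ev in \<open>eventually_elim, auto simp: W_def C_def Suc.IH\<close>)
  also have "\<dots> = C * (of_real (a - real s) * (1 - z / of_real \<rho>) powr (of_real (a - real s) - 1) * (- 1 / of_real \<rho>))"
  proof (rule DERIV_imp_deriv)
    show "((\<lambda>w. C * (1 - w / of_real \<rho>) powr of_real (a - real s)) has_field_derivative
       C * (of_real (a - real s) * (1 - z / of_real \<rho>) powr (of_real (a - real s) - 1) * (- 1 / of_real \<rho>))) (at z)"
    proof -
      have d: "((\<lambda>w. 1 - w / complex_of_real \<rho>) has_field_derivative (- 1 / of_real \<rho>)) (at z)"
        by (rule derivative_eq_intros refl | simp)+ (use \<rho> in auto)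
      show ?thesis
        using DERIV_cmult[OF DERIV_chain2[OF has_field_derivative_powr[OF Suc.prems] d], of C] by simp
    qed
  qed
  also have "of_real (a - real s) - (1::complex) = of_real (a - real (Suc s))" by simp
  also have "C * (of_real (a - real s) * (1 - z / of_real \<rho>) powr of_real (a - real (Suc s)) * (- 1 / of_real \<rho>)) =
     of_real (pochhammer (- a) (Suc s) / \<rho> ^ Suc s) * (1 - z / of_real \<rho>) powr of_real (a - real (Suc s))"
    using \<rho> by (simp add: C_def pochhammer_Suc field_simps)
  finally show ?case .
qed simp

text \<open>Derivatives of the model term are explicit, and those of the remainder are little-o by
  \<open>higher_deriv_smallo_boundary\<close>. That estimate lives on the half-plane, which suffices
  because the inner function approaches its limit there. The constant \<open>p\<close> survives only
  for \<open>s = 0\<close>.\<close>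

lemma higher_deriv_singular_limit:
  assumes sc: "singular_continuation f \<rho> \<phi> U \<kappa>"
    and lim: "((\<lambda>z. (\<phi> z - p) / (1 - z / of_real \<rho>) powr of_real a) \<longlongrightarrow> of_real c)
      (at_sector \<rho> \<kappa>)"
  shows "((\<lambda>z. ((deriv ^^ s) \<phi> z - (if s = 0 then p else 0)) / (1 - z / of_real \<rho>) powr of_real (a - real s))
     \<longlongrightarrow> of_real (c * pochhammer (- a) s / \<rho> ^ s)) (at (of_real \<rho>) within {z. Re z < \<rho>})"
proof -
  have \<rho>: "0 < \<rho>" and \<kappa>: "0 < \<kappa>" and U: "open U" "\<phi> holomorphic_on U"
    and ev: "\<forall>\<^sub>F z in at_sector \<rho> \<kappa>. z \<in> U"
    using sc by (auto simp: singular_continuation_def)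
  define q where "q z = (1 - z / of_real \<rho>) powr complex_of_real a" for z :: complex
  define V where "V = U \<inter> {z. 1 - z / of_real \<rho> \<in> - \<real>\<^sub>\<le>\<^sub>0}"
  obtain \<kappa>' where \<kappa>': "0 < \<kappa>'" and V: "open V" and holq: "q holomorphic_on V"
    and evV: "\<forall>\<^sub>F z in at_sector \<rho> \<kappa>'. z \<in> V"
    and lim0: "((\<lambda>z. (\<phi> z - p - of_real c * q z) / of_real (norm (1 - z / of_real \<rho>) powr a)) \<longlongrightarrow> 0)
               (at_sector \<rho> \<kappa>')"
    by (rule sector_remainder[OF U(1) \<kappa> \<rho> ev lim], rule that)
       (unfold q_def[abs_def] V_def, assumption+)
  let ?F = "at (of_real \<rho>) within {z. Re z < \<rho>}"
  define g where "g z = \<phi> z - p - of_real c * q z" for z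
  have hol\<phi>: "\<phi> holomorphic_on V" using U by (auto simp: V_def intro: holomorphic_on_subset)
  have holg: "g holomorphic_on V" unfolding g_def by (intro holomorphic_intros holq hol\<phi>)
  have glim: "((\<lambda>z. (deriv ^^ s) g z / of_real (norm (1 - z / of_real \<rho>) powr (a - real s))) \<longlongrightarrow> 0) ?F"
    by (rule higher_deriv_smallo_boundary[OF V holg \<kappa>' \<rho> evV]) (use lim0 in \<open>simp add: g_def\<close>)
  have evV': "\<forall>\<^sub>F z in ?F. z \<in> V"
    using filter_leD[OF at_le[OF halfplane_subset_sector] evV] \<kappa>' by simp
  have ne: "\<forall>\<^sub>F z in ?F. z \<noteq> of_real \<rho>" by (simp add: eventually_at_filter)
  have "((\<lambda>z. (deriv ^^ s) g z / (1 - z / of_real \<rho>) powr of_real (a - real s)) \<longlongrightarrow> 0) ?F"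
  proof (rule tendsto_norm_zero_cancel)
    show "((\<lambda>z. norm ((deriv ^^ s) g z / (1 - z / of_real \<rho>) powr of_real (a - real s))) \<longlongrightarrow> 0) ?F"
      using tendsto_norm_zero[OF glim] by (simp add: norm_divide norm_powr_real_powr' del: of_real_diff)
  qed
  from tendsto_add[OF this tendsto_const[of "of_real (c * pochhammer (- a) s / \<rho> ^ s)"]]
  have "((\<lambda>z. (deriv ^^ s) g z / (1 - z / of_real \<rho>) powr of_real (a - real s) + of_real (c * pochhammer (- a) s / \<rho> ^ s))
     \<longlongrightarrow> of_real (c * pochhammer (- a) s / \<rho> ^ s)) ?F" by simp
  thus ?thesis
  proof (rule Lim_transform_eventually)
    show "\<forall>\<^sub>F z in ?F. (deriv ^^ s) g z / (1 - z / of_real \<rho>) powr of_real (a - real s) + of_real (c * pochhammer (- a) s / \<rho> ^ s)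
      = ((deriv ^^ s) \<phi> z - (if s = 0 then p else 0)) / (1 - z / of_real \<rho>) powr of_real (a - real s)"
      using evV' ne
    proof eventually_elim
      case (elim z)
      have slit: "1 - z / of_real \<rho> \<notin> \<real>\<^sub>\<le>\<^sub>0" using elim by (auto simp: V_def)
      define D where "D = (1 - z / of_real \<rho>) powr complex_of_real (a - real s)"
      have D: "D \<noteq> 0" using slit by (auto simp: D_def)
      have "(deriv ^^ s) g z = (deriv ^^ s) (\<lambda>w. (\<phi> w - p) - of_real c * q w) z" by (simp add: g_def[abs_def])
      also have "\<dots> = (deriv ^^ s) (\<lambda>w. \<phi> w - p) z - (deriv ^^ s) (\<lambda>w. of_real c * q w) z"
        by (rule higher_deriv_diff[OF _ _ V]) (use elim in \<open>auto intro!: holomorphic_intros holq hol\<phi>\<close>)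
      also have "(deriv ^^ s) (\<lambda>w. \<phi> w - p) z = (deriv ^^ s) \<phi> z - (deriv ^^ s) (\<lambda>w. p) z"
        by (rule higher_deriv_diff[OF _ _ V]) (use elim in \<open>auto intro!: holomorphic_intros hol\<phi>\<close>)
      also have "(deriv ^^ s) (\<lambda>w. of_real c * q w) z = of_real c * (deriv ^^ s) q z"
        by (rule higher_deriv_cmult[OF holq _ V]) (use elim in auto)
      also have "(deriv ^^ s) q z = of_real (pochhammer (- a) s / \<rho> ^ s) * D"
        unfolding q_def[abs_def] D_def by (rule higher_deriv_u_powr[OF \<rho> slit])
      finally have "(deriv ^^ s) g z + of_real (c * pochhammer (- a) s / \<rho> ^ s) * D = (deriv ^^ s) \<phi> z - (if s = 0 then p else 0)"
        by simp
      thus ?case unfolding D_def[symmetric] using D by (simp add: field_simps)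
    qed
  qed
qed

section \<open>The factor \<open>M\<close> at the singularity of \<open>H\<close>\<close>

lemma singular_continuation_regular:
  assumes \<rho>: "0 < \<rho>" and rad: "ereal \<rho> < fps_conv_radius f"
  obtains \<phi> U where "singular_continuation f \<rho> \<phi> U 1" "\<phi> holomorphic_on U" "of_real \<rho> \<in> U" "open U"
proof -
  define \<phi> where "\<phi> = eval_fps (fps_complex f)"
  define U where "U = eball (0::complex) (fps_conv_radius (fps_complex f))"
  have R: "fps_conv_radius (fps_complex f) = fps_conv_radius f"
    by (simp add: fps_conv_radius_def conv_radius_def fps_complex_def)
  have sub: "cball 0 \<rho> \<subseteq> U"
  proof
    fix z :: complex assume "z \<in> cball 0 \<rho>"
    hence "ereal (norm z) \<le> ereal \<rho>" by simp
    also note rad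
    finally show "z \<in> U" by (simp add: U_def R in_eball_iff)
  qed
  have openU: "open U" by (simp add: U_def)
  have hol: "\<phi> holomorphic_on U" unfolding \<phi>_def U_def by (intro holomorphic_on_eval_fps) auto
  have sums: "(\<lambda>n. complex_of_real (fps_nth f n) * z ^ n) sums \<phi> z" if "norm z < \<rho>" for z
  proof -
    have "ereal (norm z) < fps_conv_radius (fps_complex f)"
      unfolding R using that rad by (metis ereal_less_eq(3) less_imp_le order_le_less_trans)
    from sums_eval_fps[OF this] show ?thesis by (simp add: \<phi>_def)
  qed
  have mem: "of_real \<rho> \<in> U" using sub \<rho> by auto
  have "\<forall>\<^sub>F z in at_sector \<rho> 1. z \<in> U"
    by (rule filter_leD[OF at_le[OF subset_UNIV] eventually_at_in_open'[OF openU mem]])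
  hence "singular_continuation f \<rho> \<phi> U 1"
    using \<rho> sums openU hol sub by (auto simp: singular_continuation_def)
  thus ?thesis using that hol mem openU by blast
qed

lemma u_powr_diff_tendsto_0:
  assumes "0 < \<rho>" "a < 1"
  shows "((\<lambda>z. (1 - z / of_real \<rho>) / (1 - z / of_real \<rho>) powr of_real a) \<longlongrightarrow> (0::complex)) (at (of_real \<rho>) within S)"
proof (rule Lim_transform_eventually)
  show "((\<lambda>z. (1 - z / of_real \<rho>) powr of_real (1 - a)) \<longlongrightarrow> (0::complex)) (at (of_real \<rho>) within S)"
    using assms by (intro u_powr_tendsto_0) auto
  have "\<forall>\<^sub>F z in at (of_real \<rho>) within S. z \<noteq> complex_of_real \<rho>" by (simp add: eventually_at_filter)
  thus "\<forall>\<^sub>F z in at (of_real \<rho>) within S. (1 - z / of_real \<rho>) powr of_real (1 - a) =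
     (1 - z / of_real \<rho>) / (1 - z / complex_of_real \<rho>) powr of_real a"
  proof eventually_elim
    case (elim z)
    hence "1 - z / of_real \<rho> \<noteq> 0" using assms by (auto simp: field_simps)
    thus ?case by (simp add: powr_diff)
  qed
qed

text \<open>\<open>M\<close> behaves like a constant if \<open>lam\<^sub>M\<close> is positive and
  like the power \<open>lam\<^sub>M\<close> if it is negative, whence the exponent
  \<open>min 0 lam\<^sub>M\<close>. The last property is the form in which purity is used: the
  variation of \<open>M\<close> is negligible against a power below \<open>lam\<^sub>M\<close>. For
  negative \<open>lam\<^sub>M\<close> it is vacuous.\<close>

lemma outer_factor_continuation:
  fixes lam\<^sub>M :: ereal
  assumes \<rho>: "0 < \<rho>" and nn: "nonneg_coeffs M" and nz: "M \<noteq> 0"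
    and rad: "ereal \<rho> \<le> fps_conv_radius M"
    and sing: "fps_conv_radius M = ereal \<rho> \<Longrightarrow> \<exists>l c. lam\<^sub>M = ereal l \<and> singular_expansion M \<rho> l c"
    and reg: "ereal \<rho> < fps_conv_radius M \<Longrightarrow> lam\<^sub>M = \<infinity>"
  obtains \<phi> U \<kappa> C where "singular_continuation M \<rho> \<phi> U \<kappa>" "C \<noteq> 0"
    "((\<lambda>z. \<phi> z / (1 - z / of_real \<rho>) powr of_real (real_of_ereal (min 0 lam\<^sub>M))) \<longlongrightarrow> C) (at_sector \<rho> \<kappa>)"
    "\<And>a. 0 < a \<Longrightarrow> a < 1 \<Longrightarrow> ereal a < lam\<^sub>M \<Longrightarrow>
       ((\<lambda>z. (\<phi> z - C) / (1 - z / of_real \<rho>) powr of_real a) \<longlongrightarrow> 0) (at_sector \<rho> \<kappa>)"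
proof -
  have pos_limit: "l \<noteq> 0" if "singular_continuation M \<rho> \<phi> U \<kappa>" "(\<phi> \<longlongrightarrow> l) (at_sector \<rho> \<kappa>)" for \<phi> U \<kappa> l
  proof -
    obtain k where k: "fps_nth M k \<noteq> 0" using nz by (auto simp: fps_eq_iff)
    have M0: "0 \<le> fps_nth M i" for i using nn by (simp add: nonneg_coeffs_def)
    have "0 < fps_nth M k * \<rho> ^ k" using k M0[of k] \<rho> by simp
    also have "\<dots> \<le> (\<Sum>i<Suc k. fps_nth M i * \<rho> ^ i)" using M0 \<rho> by (intro member_le_sum) auto
    also have "\<dots> \<le> Re l" by (rule singular_continuation_boundary_limit(1)[OF that(1) nn that(2)])
    finally show ?thesis by auto
  qed
  have evne: "\<forall>\<^sub>F z in at (of_real \<rho>) within S. 1 - z / complex_of_real \<rho> \<noteq> 0" for S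
    using \<rho> by (auto simp: eventually_at_filter field_simps)
  have pw: "x / u powr complex_of_real 0 = x" if "u \<noteq> 0" for x u using that by simp
  show ?thesis
  proof (cases "fps_conv_radius M = ereal \<rho>")
    case False
    hence rad': "ereal \<rho> < fps_conv_radius M" using rad by auto
    obtain \<phi> U where sc: "singular_continuation M \<rho> \<phi> U 1"
      and hol: "\<phi> holomorphic_on U" "of_real \<rho> \<in> U" "open U"
      using singular_continuation_regular[OF \<rho> rad'] by metis
    let ?F = "at_sector \<rho> 1"
    have "isCont \<phi> (of_real \<rho>)" using hol by (meson continuous_on_eq_continuous_at holomorphic_on_imp_continuous_on)
    hence lim: "(\<phi> \<longlongrightarrow> \<phi> (of_real \<rho>)) ?F"
      unfolding isCont_def by (rule tendsto_within_subset) simp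
    have "(\<phi> has_field_derivative deriv \<phi> (of_real \<rho>)) (at (of_real \<rho>))"
      using hol by (intro holomorphic_derivI)
    hence "((\<lambda>z. (\<phi> z - \<phi> (of_real \<rho>)) / (z - of_real \<rho>)) \<longlongrightarrow> deriv \<phi> (of_real \<rho>)) (at (of_real \<rho>))"
      by (simp add: has_field_derivative_iff)
    hence der: "((\<lambda>z. (\<phi> z - \<phi> (of_real \<rho>)) / (z - of_real \<rho>)) \<longlongrightarrow> deriv \<phi> (of_real \<rho>)) ?F"
      by (rule tendsto_within_subset) simp
    have m0: "real_of_ereal (min 0 lam\<^sub>M) = 0" using reg[OF rad'] by simp
    \<comment> \<open>\<open>M\<close> is differentiable at \<rho>, so the difference is at most of
      order \<open>1 - z / \<rho>\<close>, which is smaller than any power below 1.\<close>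
    have main: "((\<lambda>z. (\<phi> z - \<phi> (of_real \<rho>)) / (1 - z / of_real \<rho>) powr of_real a) \<longlongrightarrow> 0) ?F" if a: "a < 1" for a
    proof -
      have "((\<lambda>z. ((\<phi> z - \<phi> (of_real \<rho>)) / (z - of_real \<rho>)) * (- of_real \<rho> *
          ((1 - z / of_real \<rho>) / (1 - z / of_real \<rho>) powr of_real a))) \<longlongrightarrow> deriv \<phi> (of_real \<rho>) * (- of_real \<rho> * 0)) ?F"
        by (intro tendsto_mult der tendsto_const u_powr_diff_tendsto_0 \<rho> a)
      hence "((\<lambda>z. ((\<phi> z - \<phi> (of_real \<rho>)) / (z - of_real \<rho>)) * (- of_real \<rho> *
          ((1 - z / of_real \<rho>) / (1 - z / of_real \<rho>) powr of_real a))) \<longlongrightarrow> 0) ?F" by simp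
      thus ?thesis
      proof (rule Lim_transform_eventually)
        show "\<forall>\<^sub>F z in ?F. ((\<phi> z - \<phi> (of_real \<rho>)) / (z - of_real \<rho>)) * (- of_real \<rho> *
          ((1 - z / of_real \<rho>) / (1 - z / of_real \<rho>) powr of_real a)) =
          (\<phi> z - \<phi> (of_real \<rho>)) / (1 - z / of_real \<rho>) powr of_real a"
          using eventually_sector
        proof eventually_elim
          case (elim z)
          have "- of_real \<rho> * (1 - z / of_real \<rho>) = z - of_real \<rho>" using \<rho> by (simp add: field_simps)
          moreover have "z - of_real \<rho> \<noteq> 0" using elim by simp
          ultimately show ?case
            by (metis (no_types, opaque_lifting) mult.assoc nonzero_eq_divide_eq times_divide_eq_right)
        qed
      qed
    qed
    show ?thesis
    proof (rule that[OF sc pos_limit[OF sc lim]])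
      show "((\<lambda>z. \<phi> z / (1 - z / of_real \<rho>) powr of_real (real_of_ereal (min 0 lam\<^sub>M))) \<longlongrightarrow> \<phi> (of_real \<rho>)) ?F"
      proof (rule Lim_transform_eventually[OF lim])
        show "\<forall>\<^sub>F z in ?F. \<phi> z = \<phi> z / (1 - z / of_real \<rho>) powr of_real (real_of_ereal (min 0 lam\<^sub>M))"
          unfolding m0 using evne by eventually_elim (erule pw[symmetric])
      qed
    qed (use main in auto)
  next
    case True
    then obtain l c where l: "lam\<^sub>M = ereal l" and se: "singular_expansion M \<rho> l c" using sing by blast
    have c: "c \<noteq> 0" "l \<noteq> 0" using se by (auto simp: singular_expansion_def)
    obtain \<phi> U \<kappa> P where sc: "singular_continuation M \<rho> \<phi> U \<kappa>"
      and lim: "((\<lambda>z. (\<phi> z - poly (map_poly complex_of_real P) (1 - z / of_real \<rho>)) / (1 - z / of_real \<rho>) powr of_real l) \<longlongrightarrow> of_real c)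
        (at_sector \<rho> \<kappa>)"
      and P: "l < 0 \<Longrightarrow> P = 0"
      by (rule singular_expansion_continuation[OF se], rule that) (assumption | blast)+
    let ?F = "at_sector \<rho> \<kappa>"
    show ?thesis
    proof (cases "l < 0")
      case True
      have "min 0 lam\<^sub>M = ereal l" using True by (simp add: l min_def)
      thus ?thesis using lim P[OF True] c True by (intro that[OF sc, of "of_real c"]) (auto simp: l)
    next
      case False
      hence l0: "0 < l" using c by simp
      \<comment> \<open>Without its constant term the polynomial is divisible by its argument, so it
        contributes at most the order \<open>1 - z / \<rho>\<close>, negligible against powers
        \<open>a < 1\<close>.\<close>
      define Q where "Q = map_poly complex_of_real P"
      define C where "C = poly Q 0"
      obtain R where R: "Q = pCons C R"
        by (metis C_def pCons_cases poly_pCons mult_zero_left add.right_neutral)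
      have Qu: "poly Q w - C = w * poly R w" for w by (simp add: R)
      have mindiff: "((\<lambda>z. (\<phi> z - C) / (1 - z / of_real \<rho>) powr of_real a) \<longlongrightarrow> 0) ?F" if a: "a < 1" "a < l" for a
      proof -
        have "((\<lambda>z. poly R (1 - z / of_real \<rho>)) \<longlongrightarrow> poly R 0) ?F"
          by (intro tendsto_poly filterlim_u_at_0 \<rho>)
        hence "((\<lambda>z. (\<phi> z - poly Q (1 - z / of_real \<rho>)) / (1 - z / of_real \<rho>) powr of_real l * (1 - z / of_real \<rho>) powr of_real (l - a)
           + poly R (1 - z / of_real \<rho>) * ((1 - z / of_real \<rho>) / (1 - z / of_real \<rho>) powr of_real a)) \<longlongrightarrow>
           of_real c * 0 + poly R 0 * 0) ?F"
          using a unfolding Q_def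
          by (intro tendsto_add tendsto_mult lim u_powr_tendsto_0 u_powr_diff_tendsto_0 \<rho>) auto
        hence "((\<lambda>z. (\<phi> z - poly Q (1 - z / of_real \<rho>)) / (1 - z / of_real \<rho>) powr of_real l * (1 - z / of_real \<rho>) powr of_real (l - a)
           + poly R (1 - z / of_real \<rho>) * ((1 - z / of_real \<rho>) / (1 - z / of_real \<rho>) powr of_real a)) \<longlongrightarrow> 0) ?F" by simp
        thus ?thesis
        proof (rule Lim_transform_eventually)
          show "\<forall>\<^sub>F z in ?F. (\<phi> z - poly Q (1 - z / of_real \<rho>)) / (1 - z / of_real \<rho>) powr of_real l * (1 - z / of_real \<rho>) powr of_real (l - a)
           + poly R (1 - z / of_real \<rho>) * ((1 - z / of_real \<rho>) / (1 - z / of_real \<rho>) powr of_real a) =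
             (\<phi> z - C) / (1 - z / of_real \<rho>) powr of_real a"
            using evne
          proof eventually_elim
            case (elim z)
            define u where "u = 1 - z / of_real \<rho>"
            have u: "u \<noteq> 0" using elim by (simp add: u_def)
            have e1: "u powr of_real (l - a) = u powr of_real l / u powr of_real a"
              using u by (simp add: powr_diff)
            have nz: "u powr complex_of_real l \<noteq> 0" "u powr complex_of_real a \<noteq> 0" using u by auto
            have "(\<phi> z - poly Q u) / u powr of_real l * u powr of_real (l - a) + poly R u * (u / u powr of_real a)
              = ((\<phi> z - poly Q u) + u * poly R u) / u powr of_real a"
              unfolding e1 using nz by (simp add: add_divide_distrib mult.commute)
            also have "(\<phi> z - poly Q u) + u * poly R u = \<phi> z - C" using Qu[of u] by (simp add: algebra_simps)
            finally show ?case unfolding u_def .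
          qed
        qed
      qed
      have lim0: "((\<lambda>z. (\<phi> z - C) / (1 - z / of_real \<rho>) powr of_real 0) \<longlongrightarrow> 0) ?F"
        by (rule mindiff) (use l0 in auto)
      have "\<forall>\<^sub>F z in ?F. (\<phi> z - C) / (1 - z / of_real \<rho>) powr of_real 0 = \<phi> z - C"
        using evne by eventually_elim (erule pw)
      with lim0 have "((\<lambda>z. \<phi> z - C) \<longlongrightarrow> 0) ?F" by (rule Lim_transform_eventually)
      hence limC: "(\<phi> \<longlongrightarrow> C) ?F" by (simp add: LIM_zero_iff)
      show ?thesis
      proof (rule that[OF sc pos_limit[OF sc limC]])
        have m0: "real_of_ereal (min 0 lam\<^sub>M) = 0" using l0 by (simp add: l min_def)
        show "((\<lambda>z. \<phi> z / (1 - z / of_real \<rho>) powr of_real (real_of_ereal (min 0 lam\<^sub>M))) \<longlongrightarrow> C) ?F"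
          unfolding m0
        proof (rule Lim_transform_eventually[OF limC])
          show "\<forall>\<^sub>F z in ?F. \<phi> z = \<phi> z / (1 - z / of_real \<rho>) powr of_real 0"
            using evne by eventually_elim (erule pw[symmetric])
        qed
      qed (use mindiff l in auto)
    qed
  qed
qed

section \<open>Coefficients of the composition scheme\<close>

text \<open>The exponent of \<open>G\<^sup>(\<^sup>s\<^sup>)(H) M\<close> is
  \<open>- (lam\<^sub>H * s + b)\<close>: the outer exponent \<open>lam\<^sub>G - s\<close> is
  multiplied by \<open>lam\<^sub>H\<close>, and \<open>M\<close> adds its own. The constant
  \<open>A\<close> is quantified before \<open>s\<close> because it has to cancel when coefficients
  for \<open>s\<close> are divided by those for 0. That \<open>b\<close> is no pole makes
  \<open>Gamma b\<close> nonzero, so the denominators are eventually nonzero.\<close>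

lemma composition_coeff_asymptotics:
  fixes G H M :: "real fps" and lam\<^sub>M :: ereal
  assumes scheme: "composition_scheme G H M \<rho>\<^sub>G lam\<^sub>G c\<^sub>G \<rho>\<^sub>H lam\<^sub>H c\<^sub>H lam\<^sub>M"
    and crit: "critical H M \<rho>\<^sub>G \<rho>\<^sub>H"
    and lamH: "0 < lam\<^sub>H" "lam\<^sub>H < 1"
    and pur: "pure lam\<^sub>G lam\<^sub>H lam\<^sub>M"
  defines "b \<equiv> - lam\<^sub>G * lam\<^sub>H + real_of_ereal (- min 0 lam\<^sub>M)"
  shows "(\<lambda>n. fps_nth H n * \<rho>\<^sub>H ^ n * real n powr (lam\<^sub>H + 1)) \<longlonglongrightarrow> c\<^sub>H / Gamma (- lam\<^sub>H)"
    and "c\<^sub>H < 0" and "Gamma (- lam\<^sub>H) < 0" and "0 < \<rho>\<^sub>H" and "- lam\<^sub>H < b" and "b \<notin> \<int>\<^sub>\<le>\<^sub>0"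
    and "\<exists>A. A \<noteq> 0 \<and> (\<forall>s. (\<lambda>n. fps_nth (fps_compose ((fps_deriv ^^ s) G) H * M) n * \<rho>\<^sub>H ^ n * real n powr (1 - (lam\<^sub>H * real s + b)))
           \<longlonglongrightarrow> A * pochhammer (- lam\<^sub>G) s / (- c\<^sub>H) ^ s / Gamma (lam\<^sub>H * real s + b))"
proof -
  interpret composition_scheme G H M \<rho>\<^sub>G lam\<^sub>G c\<^sub>G \<rho>\<^sub>H lam\<^sub>H c\<^sub>H lam\<^sub>M by fact
  have cG: "c\<^sub>G \<noteq> 0" and cH: "c\<^sub>H \<noteq> 0" and \<rho>G: "0 < \<rho>\<^sub>G" and \<rho>H: "0 < \<rho>\<^sub>H" and lG0: "lam\<^sub>G \<noteq> 0"
    using G_singular H_singular by (auto simp: singular_expansion_def)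
  show "0 < \<rho>\<^sub>H" by (rule \<rho>H)
  have lG1: "lam\<^sub>G < 1" using pur by (auto simp: pure_def)
  define \<mu> where "\<mu> = real_of_ereal (min 0 lam\<^sub>M)"
  have bb: "b = - lam\<^sub>G * lam\<^sub>H - \<mu>" unfolding b_def \<mu>_def by simp
  have \<mu>0: "\<mu> \<le> 0" unfolding \<mu>_def by (cases lam\<^sub>M) (auto simp: min_def)
  \<comment> \<open>For positive \<open>lam\<^sub>G\<close> the minimum in \<open>pure\<close> is
    \<open>lam\<^sub>G * lam\<^sub>H\<close>, since \<open>lam\<^sub>G < 1\<close>. It follows that
    \<open>lam\<^sub>M\<close> is positive and \<open>M\<close> contributes no power.\<close>
  have pur': "ereal (lam\<^sub>G * lam\<^sub>H) < lam\<^sub>M" "\<mu> = 0" "0 < lam\<^sub>G * lam\<^sub>H" "lam\<^sub>G * lam\<^sub>H < 1" if "\<not> lam\<^sub>G < 0"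
  proof -
    have lG: "0 < lam\<^sub>G" "lam\<^sub>G < 1" "ereal (min (lam\<^sub>G * lam\<^sub>H) lam\<^sub>H) < lam\<^sub>M" using pur that by (auto simp: pure_def)
    have l1: "lam\<^sub>G * lam\<^sub>H < 1 * lam\<^sub>H" using lG lamH by (intro mult_strict_right_mono)
    thus lt: "ereal (lam\<^sub>G * lam\<^sub>H) < lam\<^sub>M" using lG by (simp add: min_def)
    show p: "0 < lam\<^sub>G * lam\<^sub>H" using lG lamH by simp
    show "lam\<^sub>G * lam\<^sub>H < 1" using l1 lamH by linarith
    have "0 < ereal (lam\<^sub>G * lam\<^sub>H)" using p by simp
    hence "0 < lam\<^sub>M" using lt by (rule less_trans)
    thus "\<mu> = 0" by (simp add: \<mu>_def min_def)
  qed
  show bgt: "- lam\<^sub>H < b"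
  proof (cases "lam\<^sub>G < 0")
    case True
    hence "0 < - lam\<^sub>G * lam\<^sub>H" using lamH by (simp add: mult_neg_pos)
    thus ?thesis using lamH \<mu>0 bb by linarith
  next
    case False
    have "lam\<^sub>G * lam\<^sub>H < 1 * lam\<^sub>H" using lG1 lamH by (intro mult_strict_right_mono)
    thus ?thesis using pur'(2)[OF False] bb by linarith
  qed
  have "b \<noteq> 0"
  proof (cases "lam\<^sub>G < 0")
    case True
    hence "0 < - lam\<^sub>G * lam\<^sub>H" using lamH by (simp add: mult_neg_pos)
    thus ?thesis using \<mu>0 bb by linarith
  qed (use pur' bb in auto)

  with bgt show bs: "b \<notin> \<int>\<^sub>\<le>\<^sub>0" using lamH by (intro not_nonpos_Int_gt_minus_1) auto

  obtain \<phi>\<^sub>G U\<^sub>G \<kappa>\<^sub>G P\<^sub>G where scG: "singular_continuation G \<rho>\<^sub>G \<phi>\<^sub>G U\<^sub>G \<kappa>\<^sub>G"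
    and limG': "((\<lambda>z. (\<phi>\<^sub>G z - poly (map_poly complex_of_real P\<^sub>G) (1 - z / of_real \<rho>\<^sub>G)) / (1 - z / of_real \<rho>\<^sub>G) powr of_real lam\<^sub>G) \<longlongrightarrow> of_real c\<^sub>G)
      (at_sector \<rho>\<^sub>G \<kappa>\<^sub>G)"
    and PG: "lam\<^sub>G < 0 \<Longrightarrow> P\<^sub>G = 0" "0 < lam\<^sub>G \<Longrightarrow> lam\<^sub>G < 1 \<Longrightarrow> degree P\<^sub>G = 0"
    by (rule singular_expansion_continuation[OF G_singular], rule that) (assumption | blast)+
  have "degree P\<^sub>G = 0" using PG lG0 lG1 by (cases "lam\<^sub>G < 0") auto
  then obtain p\<^sub>G where pG: "P\<^sub>G = [:p\<^sub>G:]" by (rule degree_eq_zeroE)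
  define p where "p = complex_of_real p\<^sub>G"
  have p0: "lam\<^sub>G < 0 \<Longrightarrow> p = 0" using PG(1) pG by (simp add: p_def)
  have limG: "((\<lambda>z. (\<phi>\<^sub>G z - p) / (1 - z / of_real \<rho>\<^sub>G) powr of_real lam\<^sub>G) \<longlongrightarrow> of_real c\<^sub>G)
      (at_sector \<rho>\<^sub>G \<kappa>\<^sub>G)"
    using limG' by (simp add: pG p_def map_poly_pCons)

  obtain \<phi>\<^sub>H U\<^sub>H \<kappa>\<^sub>H P\<^sub>H where scH: "singular_continuation H \<rho>\<^sub>H \<phi>\<^sub>H U\<^sub>H \<kappa>\<^sub>H"
    and limH': "((\<lambda>z. (\<phi>\<^sub>H z - poly (map_poly complex_of_real P\<^sub>H) (1 - z / of_real \<rho>\<^sub>H)) / (1 - z / of_real \<rho>\<^sub>H) powr of_real lam\<^sub>H) \<longlongrightarrow> of_real c\<^sub>H)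
      (at_sector \<rho>\<^sub>H \<kappa>\<^sub>H)"
    and PH: "0 < lam\<^sub>H \<Longrightarrow> lam\<^sub>H < 1 \<Longrightarrow> degree P\<^sub>H = 0"
    by (rule singular_expansion_continuation[OF H_singular], rule that) (assumption | blast)+
  obtain p\<^sub>H where pH: "P\<^sub>H = [:p\<^sub>H:]" using PH lamH by (auto elim: degree_eq_zeroE)
  have limH0: "((\<lambda>z. (\<phi>\<^sub>H z - of_real p\<^sub>H) / (1 - z / of_real \<rho>\<^sub>H) powr of_real lam\<^sub>H) \<longlongrightarrow> of_real c\<^sub>H)
      (at_sector \<rho>\<^sub>H \<kappa>\<^sub>H)"
    using limH' by (simp add: pH map_poly_pCons)
  have "((\<lambda>z. (\<phi>\<^sub>H z - of_real p\<^sub>H) / (1 - z / of_real \<rho>\<^sub>H) powr of_real lam\<^sub>H * (1 - z / of_real \<rho>\<^sub>H) powr of_real lam\<^sub>H + of_real p\<^sub>H)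
      \<longlongrightarrow> of_real c\<^sub>H * 0 + of_real p\<^sub>H) (at_sector \<rho>\<^sub>H \<kappa>\<^sub>H)"
    by (intro tendsto_add tendsto_mult limH0 u_powr_tendsto_0 \<rho>H lamH tendsto_const)
  hence "(\<phi>\<^sub>H \<longlongrightarrow> of_real c\<^sub>H * 0 + of_real p\<^sub>H) (at_sector \<rho>\<^sub>H \<kappa>\<^sub>H)"
  proof (rule Lim_transform_eventually)
    show "\<forall>\<^sub>F z in at_sector \<rho>\<^sub>H \<kappa>\<^sub>H.
      (\<phi>\<^sub>H z - of_real p\<^sub>H) / (1 - z / of_real \<rho>\<^sub>H) powr of_real lam\<^sub>H * (1 - z / of_real \<rho>\<^sub>H) powr of_real lam\<^sub>H + of_real p\<^sub>H = \<phi>\<^sub>H z"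
      using eventually_sector
    proof eventually_elim
      case (elim z)
      hence "1 - z / of_real \<rho>\<^sub>H \<noteq> 0" using \<rho>H by (auto simp: field_simps)
      hence "(1 - z / of_real \<rho>\<^sub>H) powr complex_of_real lam\<^sub>H \<noteq> 0" by (metis powr_eq_0_iff)
      thus ?case by (metis diff_add_cancel nonzero_divide_eq_eq)
    qed
  qed
  hence "(\<phi>\<^sub>H \<longlongrightarrow> of_real p\<^sub>H) (at_sector \<rho>\<^sub>H \<kappa>\<^sub>H)" by simp
  \<comment> \<open>Criticality: the boundary value of \<open>H\<close> is exactly the singularity
    of \<open>G\<close>.\<close>
  from singular_continuation_boundary_limit(2)[OF scH nonneg(2) this] crit
  have "complex_of_real p\<^sub>H = of_real \<rho>\<^sub>G" by (simp add: critical_def)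
  hence limH: "((\<lambda>z. (\<phi>\<^sub>H z - of_real \<rho>\<^sub>G) / (1 - z / of_real \<rho>\<^sub>H) powr of_real lam\<^sub>H) \<longlongrightarrow> of_real c\<^sub>H)
      (at_sector \<rho>\<^sub>H \<kappa>\<^sub>H)"
    using limH0 by simp
  note Has = inner_coeff_asymptotics[OF scH nonneg(2) lamH cH limH]
  show "(\<lambda>n. fps_nth H n * \<rho>\<^sub>H ^ n * real n powr (lam\<^sub>H + 1)) \<longlonglongrightarrow> c\<^sub>H / Gamma (- lam\<^sub>H)" by (rule Has(1))
  show cHneg: "c\<^sub>H < 0" by (rule Has(2))
  show "Gamma (- lam\<^sub>H) < 0" by (rule Has(3))
  obtain N where N: "\<And>n. n \<ge> N \<Longrightarrow> 0 < fps_nth H n"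
    using Has(4) by (auto simp: eventually_sequentially)
  have inside: "norm (\<phi>\<^sub>H z) < \<rho>\<^sub>G" if "z \<in> cball 0 \<rho>\<^sub>H - {of_real \<rho>\<^sub>H}" for z
    by (rule singular_continuation_norm_less[OF scH nonneg(2) _ N[of N] N[of "Suc N"] that])
       (use crit in \<open>auto simp: critical_def\<close>)
  define q where "q = - c\<^sub>H / \<rho>\<^sub>G"
  have q: "0 < q" using cHneg \<rho>G by (simp add: q_def divide_neg_pos)
  have \<kappa>H: "0 < \<kappa>\<^sub>H" using scH by (simp add: singular_continuation_def)
  obtain \<kappa>\<^sub>1 where \<kappa>1: "0 < \<kappa>\<^sub>1" "\<kappa>\<^sub>1 \<le> \<kappa>\<^sub>H"
    and H1: "filterlim \<phi>\<^sub>H (at (of_real \<rho>\<^sub>G) within {w. Re w < \<rho>\<^sub>G}) (at_sector \<rho>\<^sub>H \<kappa>\<^sub>1)"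
    and H2': "\<And>t. ((\<lambda>z. (1 - \<phi>\<^sub>H z / of_real \<rho>\<^sub>G) powr of_real t / (1 - z / of_real \<rho>\<^sub>H) powr of_real (lam\<^sub>H * t)) \<longlongrightarrow>
       of_real ((- c\<^sub>H / \<rho>\<^sub>G) powr t)) (at_sector \<rho>\<^sub>H \<kappa>\<^sub>1)"
    by (rule inner_function_critical[OF \<rho>H \<rho>G lamH cHneg \<kappa>H limH], rule that) (assumption | blast)+
  note H2 = H2'[folded q_def]
  obtain \<phi>\<^sub>M U\<^sub>M \<kappa>\<^sub>M C where scM: "singular_continuation M \<rho>\<^sub>H \<phi>\<^sub>M U\<^sub>M \<kappa>\<^sub>M" and C: "C \<noteq> 0"
    and M1': "((\<lambda>z. \<phi>\<^sub>M z / (1 - z / of_real \<rho>\<^sub>H) powr of_real (real_of_ereal (min 0 lam\<^sub>M))) \<longlongrightarrow> C) (at_sector \<rho>\<^sub>H \<kappa>\<^sub>M)"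
    and M2: "\<And>a. 0 < a \<Longrightarrow> a < 1 \<Longrightarrow> ereal a < lam\<^sub>M \<Longrightarrow>
       ((\<lambda>z. (\<phi>\<^sub>M z - C) / (1 - z / of_real \<rho>\<^sub>H) powr of_real a) \<longlongrightarrow> 0) (at_sector \<rho>\<^sub>H \<kappa>\<^sub>M)"
  proof -
    have "ereal \<rho>\<^sub>H \<le> fps_conv_radius M" using crit by (simp add: critical_def)
    from outer_factor_continuation[OF \<rho>H nonneg(3) M_nonzero this M_singular M_regular] that
    show ?thesis by blast
  qed
  note M1 = M1'[folded \<mu>_def]
  define \<kappa> where "\<kappa> = min \<kappa>\<^sub>1 \<kappa>\<^sub>M"
  have \<kappa>: "0 < \<kappa>" "\<kappa> \<le> \<kappa>\<^sub>1" "\<kappa> \<le> \<kappa>\<^sub>M" "\<kappa> \<le> \<kappa>\<^sub>H"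
    using \<kappa>1 scM by (auto simp: \<kappa>_def singular_continuation_def)
  let ?F = "at_sector \<rho>\<^sub>H \<kappa>"
  have F1: "?F \<le> at_sector \<rho>\<^sub>H \<kappa>\<^sub>1" and FM: "?F \<le> at_sector \<rho>\<^sub>H \<kappa>\<^sub>M"
    and FH: "?F \<le> at_sector \<rho>\<^sub>H \<kappa>\<^sub>H"
    by (intro at_le sector_mono \<kappa>)+
  have H1': "filterlim \<phi>\<^sub>H (at (of_real \<rho>\<^sub>G) within {w. Re w < \<rho>\<^sub>G}) ?F"
    using H1 F1 by (rule filterlim_mono[OF _ order_refl])
  \<comment> \<open>The preimage under the inner function of the domain of \<open>G\<close>. It
    contains the punctured closed disc by \<open>inside\<close>, and the points of the sector close
    to \<open>\<rho>\<^sub>H\<close> because \<open>H\<close> approaches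
    \<open>\<rho>\<^sub>G\<close> from the half-plane.\<close>
  define U where "U = (U\<^sub>H \<inter> U\<^sub>M) \<inter> \<phi>\<^sub>H -` U\<^sub>G"
  have UG: "open U\<^sub>G" "\<phi>\<^sub>G holomorphic_on U\<^sub>G" "cball 0 \<rho>\<^sub>G - {of_real \<rho>\<^sub>G} \<subseteq> U\<^sub>G" "0 < \<kappa>\<^sub>G"
      "\<forall>\<^sub>F z in at_sector \<rho>\<^sub>G \<kappa>\<^sub>G. z \<in> U\<^sub>G"
    and UH: "open U\<^sub>H" "\<phi>\<^sub>H holomorphic_on U\<^sub>H" "cball 0 \<rho>\<^sub>H - {of_real \<rho>\<^sub>H} \<subseteq> U\<^sub>H"
      "\<forall>\<^sub>F z in at_sector \<rho>\<^sub>H \<kappa>\<^sub>H. z \<in> U\<^sub>H"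
    and UM: "open U\<^sub>M" "\<phi>\<^sub>M holomorphic_on U\<^sub>M" "cball 0 \<rho>\<^sub>H - {of_real \<rho>\<^sub>H} \<subseteq> U\<^sub>M"
      "\<forall>\<^sub>F z in at_sector \<rho>\<^sub>H \<kappa>\<^sub>M. z \<in> U\<^sub>M"
    using scG scH scM by (auto simp: singular_continuation_def)
  have U: "open U"
    unfolding U_def
  proof (rule continuous_open_preimage)
    show "continuous_on (U\<^sub>H \<inter> U\<^sub>M) \<phi>\<^sub>H"
      using UH by (meson continuous_on_subset holomorphic_on_imp_continuous_on inf_le1)
  qed (use UH UM UG in auto)
  have subU: "cball 0 \<rho>\<^sub>H - {of_real \<rho>\<^sub>H} \<subseteq> U"
  proof
    fix z assume z: "z \<in> cball 0 \<rho>\<^sub>H - {complex_of_real \<rho>\<^sub>H}"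
    have "\<phi>\<^sub>H z \<in> cball 0 \<rho>\<^sub>G - {of_real \<rho>\<^sub>G}" using inside[OF z] \<rho>G by auto
    thus "z \<in> U" using z UG(3) UH(3) UM(3) by (auto simp: U_def)
  qed
  have "\<forall>\<^sub>F w in at (of_real \<rho>\<^sub>G) within {w. Re w < \<rho>\<^sub>G}. w \<in> U\<^sub>G"
    using UG(4,5) by (intro filter_leD[OF at_le[OF halfplane_subset_sector] UG(5)]) auto
  hence "\<forall>\<^sub>F z in ?F. \<phi>\<^sub>H z \<in> U\<^sub>G" using H1' by (auto simp: filterlim_iff)
  with filter_leD[OF FH UH(4)] filter_leD[OF FM UM(4)] have evU: "\<forall>\<^sub>F z in ?F. z \<in> U"
    by eventually_elim (simp add: U_def)
  define K where "K s z = (deriv ^^ s) \<phi>\<^sub>G (\<phi>\<^sub>H z) * \<phi>\<^sub>M z" for s z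
  have holK: "K s holomorphic_on U" for s
  proof -
    have "(deriv ^^ s) \<phi>\<^sub>G \<circ> \<phi>\<^sub>H holomorphic_on U"
      by (rule holomorphic_on_compose_gen[of _ _ _ U\<^sub>G])
         (use UG UH in \<open>auto simp: U_def intro: holomorphic_on_subset holomorphic_higher_deriv\<close>)
    moreover have "\<phi>\<^sub>M holomorphic_on U" using UM by (auto simp: U_def intro: holomorphic_on_subset)
    ultimately show ?thesis unfolding K_def o_def by (intro holomorphic_intros)
  qed
  have fpsK: "K s has_fps_expansion fps_complex (fps_compose ((fps_deriv ^^ s) G) H * M)" for s
  proof -
    have "(deriv ^^ s) \<phi>\<^sub>G has_fps_expansion (fps_deriv ^^ s) (fps_complex G)"
      by (induction s) (auto intro: has_fps_expansion_deriv singular_continuation_fps[OF scG])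
    hence "((deriv ^^ s) \<phi>\<^sub>G \<circ> \<phi>\<^sub>H) has_fps_expansion fps_compose ((fps_deriv ^^ s) (fps_complex G)) (fps_complex H)"
      by (rule has_fps_expansion_compose) (auto intro: singular_continuation_fps[OF scH] simp: H_0)
    from has_fps_expansion_mult[OF this singular_continuation_fps[OF scM]]
    show ?thesis by (simp add: K_def[abs_def] o_def fps_complex_mult fps_complex_compose fps_complex_higher_deriv)
  qed
  define a where "a s = lam\<^sub>H * (lam\<^sub>G - real s) + \<mu>" for s :: nat
  have a_b: "a s = - (lam\<^sub>H * real s + b)" for s by (simp add: a_def bb algebra_simps)
  \<comment> \<open>The product of the leading constants of \<open>G\<close>, of
    \<open>1 - H / \<rho>\<^sub>G\<close> raised to \<open>lam\<^sub>G\<close>, and of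
    \<open>M\<close>.\<close>
  define A\<^sub>0 where "A\<^sub>0 = of_real (c\<^sub>G * q powr lam\<^sub>G) * C"
  have A0: "A\<^sub>0 \<noteq> 0" using cG q C by (simp add: A\<^sub>0_def)
  have limK: "((\<lambda>z. (K s z - (if s = 0 then p * C else 0)) / (1 - z / of_real \<rho>\<^sub>H) powr of_real (a s)) \<longlongrightarrow>
      A\<^sub>0 * of_real (pochhammer (- lam\<^sub>G) s / (- c\<^sub>H) ^ s)) ?F" for s
  proof -
    define ps where "ps = (if s = 0 then p else 0)"
    define u where "u z = 1 - z / complex_of_real \<rho>\<^sub>H" for z
    define w where "w z = 1 - \<phi>\<^sub>H z / complex_of_real \<rho>\<^sub>G" for z
    have L1: "((\<lambda>z. ((deriv ^^ s) \<phi>\<^sub>G (\<phi>\<^sub>H z) - ps) / w z powr of_real (lam\<^sub>G - real s)) \<longlongrightarrow>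
        of_real (c\<^sub>G * pochhammer (- lam\<^sub>G) s / \<rho>\<^sub>G ^ s)) ?F"
      unfolding ps_def w_def by (rule filterlim_compose[OF higher_deriv_singular_limit[OF scG limG] H1'])
    have L2: "((\<lambda>z. w z powr of_real (lam\<^sub>G - real s) / u z powr of_real (lam\<^sub>H * (lam\<^sub>G - real s))) \<longlongrightarrow>
       of_real (q powr (lam\<^sub>G - real s))) ?F"
      unfolding w_def u_def by (rule tendsto_mono[OF F1 H2])
    have L3: "((\<lambda>z. \<phi>\<^sub>M z / u z powr of_real \<mu>) \<longlongrightarrow> C) ?F"
      unfolding u_def by (rule tendsto_mono[OF FM M1])
    \<comment> \<open>The constant of \<open>G\<close> times the variation of \<open>M\<close>. It
      is present only for \<open>s = 0\<close> and positive \<open>lam\<^sub>G\<close>; then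
      \<open>a 0 = lam\<^sub>G * lam\<^sub>H\<close> lies below \<open>lam\<^sub>M\<close> by
      purity.\<close>
    have L4: "((\<lambda>z. ps * ((\<phi>\<^sub>M z - C) / u z powr of_real (a s))) \<longlongrightarrow> 0) ?F"
    proof (cases "ps = 0")
      case False
      hence s: "s = 0" and lG: "\<not> lam\<^sub>G < 0" using p0 by (auto simp: ps_def split: if_splits)
      have "a s = lam\<^sub>G * lam\<^sub>H" using pur'(2)[OF lG] s by (simp add: a_def)
      hence "((\<lambda>z. ps * ((\<phi>\<^sub>M z - C) / u z powr of_real (a s))) \<longlongrightarrow> ps * 0) ?F"
        unfolding u_def using pur'[OF lG] by (intro tendsto_mult tendsto_const tendsto_mono[OF FM] M2) auto
      thus ?thesis by simp
    qed simp
    have "((\<lambda>z. ((deriv ^^ s) \<phi>\<^sub>G (\<phi>\<^sub>H z) - ps) / w z powr of_real (lam\<^sub>G - real s) *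
        (w z powr of_real (lam\<^sub>G - real s) / u z powr of_real (lam\<^sub>H * (lam\<^sub>G - real s))) *
        (\<phi>\<^sub>M z / u z powr of_real \<mu>) + ps * ((\<phi>\<^sub>M z - C) / u z powr of_real (a s))) \<longlongrightarrow>
        of_real (c\<^sub>G * pochhammer (- lam\<^sub>G) s / \<rho>\<^sub>G ^ s) * of_real (q powr (lam\<^sub>G - real s)) * C + 0) ?F"
      by (intro tendsto_add tendsto_mult L1 L2 L3 L4)
    also have "of_real (c\<^sub>G * pochhammer (- lam\<^sub>G) s / \<rho>\<^sub>G ^ s) * of_real (q powr (lam\<^sub>G - real s)) * C + 0 =
        A\<^sub>0 * of_real (pochhammer (- lam\<^sub>G) s / (- c\<^sub>H) ^ s)"
    proof -
      \<comment> \<open>The powers of \<open>\<rho>\<^sub>G\<close> from differentiating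
        \<open>G\<close> merge with those of \<open>q\<close> into powers of
        \<open>- c\<^sub>H\<close>, which is the origin of \<open>- c\<^sub>H\<close> in
        \<xi>.\<close>
      have "q powr (lam\<^sub>G - real s) / \<rho>\<^sub>G ^ s = q powr lam\<^sub>G / (q * \<rho>\<^sub>G) ^ s"
        using q by (simp add: powr_diff powr_realpow power_mult_distrib)
      also have "q * \<rho>\<^sub>G = - c\<^sub>H" using \<rho>G by (simp add: q_def)
      finally have "(c\<^sub>G * pochhammer (- lam\<^sub>G) s / \<rho>\<^sub>G ^ s) * q powr (lam\<^sub>G - real s) =
         (c\<^sub>G * q powr lam\<^sub>G) * (pochhammer (- lam\<^sub>G) s / (- c\<^sub>H) ^ s)"
        by (metis (no_types, opaque_lifting) mult.assoc mult.commute times_divide_eq_right)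
      hence "of_real (c\<^sub>G * pochhammer (- lam\<^sub>G) s / \<rho>\<^sub>G ^ s) * of_real (q powr (lam\<^sub>G - real s)) =
         complex_of_real (c\<^sub>G * q powr lam\<^sub>G) * of_real (pochhammer (- lam\<^sub>G) s / (- c\<^sub>H) ^ s)"
        by (metis of_real_mult)
      thus ?thesis by (simp only: A\<^sub>0_def add_0_right mult_ac)
    qed
    finally show ?thesis
    proof (rule Lim_transform_eventually)
      have "\<forall>\<^sub>F z in ?F. \<phi>\<^sub>H z \<noteq> of_real \<rho>\<^sub>G"
        using H1' unfolding filterlim_at by (auto elim: eventually_mono)
      thus "\<forall>\<^sub>F z in ?F. ((deriv ^^ s) \<phi>\<^sub>G (\<phi>\<^sub>H z) - ps) / w z powr of_real (lam\<^sub>G - real s) *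
        (w z powr of_real (lam\<^sub>G - real s) / u z powr of_real (lam\<^sub>H * (lam\<^sub>G - real s))) *
        (\<phi>\<^sub>M z / u z powr of_real \<mu>) + ps * ((\<phi>\<^sub>M z - C) / u z powr of_real (a s)) =
        (K s z - (if s = 0 then p * C else 0)) / (1 - z / of_real \<rho>\<^sub>H) powr of_real (a s)"
        using eventually_sector
      proof eventually_elim
        case (elim z)
        have u: "u z \<noteq> 0" using elim \<rho>H by (auto simp: u_def field_simps)
        have w: "w z \<noteq> 0" using elim \<rho>G by (auto simp: w_def field_simps)
        define W where "W = w z powr complex_of_real (lam\<^sub>G - real s)"
        define V1 where "V1 = u z powr complex_of_real (lam\<^sub>H * (lam\<^sub>G - real s))"
        define V2 where "V2 = u z powr complex_of_real \<mu>"
        define V where "V = u z powr complex_of_real (a s)"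
        have V: "V = V1 * V2" by (simp add: V_def V1_def V2_def a_def powr_add)
        have nz: "W \<noteq> 0" "V1 \<noteq> 0" "V2 \<noteq> 0" using u w by (auto simp: W_def V1_def V2_def)
        have "(if s = 0 then p * C else 0) = ps * C" by (simp add: ps_def)
        hence "(K s z - (if s = 0 then p * C else 0)) / V =
           (((deriv ^^ s) \<phi>\<^sub>G (\<phi>\<^sub>H z) - ps) * \<phi>\<^sub>M z + ps * (\<phi>\<^sub>M z - C)) / V"
          by (simp add: K_def algebra_simps)
        also have "\<dots> = ((deriv ^^ s) \<phi>\<^sub>G (\<phi>\<^sub>H z) - ps) / W * (W / V1) * (\<phi>\<^sub>M z / V2) + ps * ((\<phi>\<^sub>M z - C) / V)"
          using nz by (simp add: V add_divide_distrib)
        finally show ?case unfolding W_def V1_def V2_def V_def u_def by simp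
      qed
    qed
  qed
  have coeffC: "(\<lambda>n. of_real (fps_nth (fps_compose ((fps_deriv ^^ s) G) H * M) n * \<rho>\<^sub>H ^ n * real n powr (1 - (lam\<^sub>H * real s + b)))) \<longlonglongrightarrow>
     A\<^sub>0 * of_real (pochhammer (- lam\<^sub>G) s / (- c\<^sub>H) ^ s / Gamma (lam\<^sub>H * real s + b))" for s
  proof -
    have "(\<lambda>n. fps_nth (fps_complex (fps_compose ((fps_deriv ^^ s) G) H * M)) n * of_real (\<rho>\<^sub>H ^ n * real n powr (a s + 1))) \<longlonglongrightarrow>
       A\<^sub>0 * of_real (pochhammer (- lam\<^sub>G) s / (- c\<^sub>H) ^ s) / of_real (Gamma (- a s))"
      by (rule singularity_transfer[OF U holK subU \<kappa>(1) \<rho>H evU limK fpsK])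
    moreover have "a s + 1 = 1 - (lam\<^sub>H * real s + b)" "- a s = lam\<^sub>H * real s + b" by (simp_all add: a_b)
    ultimately show ?thesis by (simp add: mult.assoc)
  qed
  have real_lim: "(\<lambda>n. fps_nth (fps_compose ((fps_deriv ^^ s) G) H * M) n * \<rho>\<^sub>H ^ n * real n powr (1 - (lam\<^sub>H * real s + b))) \<longlonglongrightarrow>
     Re A\<^sub>0 * (pochhammer (- lam\<^sub>G) s / (- c\<^sub>H) ^ s / Gamma (lam\<^sub>H * real s + b))" for s
    using tendsto_Re[OF coeffC[of s]] by (simp only: Re_complex_of_real times_complex.sel Im_complex_of_real mult_zero_right diff_zero)
  \<comment> \<open>\<open>C\<close> was obtained as a complex limit; that the constant is real is
    read off from the real coefficients for \<open>s = 0\<close>.\<close>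
  have "Im A\<^sub>0 * (1 / Gamma b) = 0"
  proof -
    have "(\<lambda>n. 0) \<longlonglongrightarrow> Im (A\<^sub>0 * of_real (1 / Gamma b))"
      using tendsto_Im[OF coeffC[of 0]] by (simp only: Im_complex_of_real) (simp add: add.commute)
    hence "Im (A\<^sub>0 * of_real (1 / Gamma b)) = 0" by (simp only: LIMSEQ_const_iff)
    thus ?thesis by (simp only: times_complex.sel Re_complex_of_real Im_complex_of_real mult_zero_right add_0)
  qed
  moreover have "Gamma b \<noteq> 0" using bs by (simp add: Gamma_eq_zero_iff)
  ultimately have "Im A\<^sub>0 = 0" by simp
  hence "Re A\<^sub>0 \<noteq> 0" using A0 by (auto simp: complex_eq_iff)
  with real_lim show "\<exists>A. A \<noteq> 0 \<and> (\<forall>s. (\<lambda>n. fps_nth (fps_compose ((fps_deriv ^^ s) G) H * M) n * \<rho>\<^sub>H ^ n * real n powr (1 - (lam\<^sub>H * real s + b)))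
           \<longlonglongrightarrow> A * pochhammer (- lam\<^sub>G) s / (- c\<^sub>H) ^ s / Gamma (lam\<^sub>H * real s + b))"
    by (intro exI[of _ "Re A\<^sub>0"]) simp
qed

section \<open>Factorial moments of the component count\<close>

text \<open>A truncation that does not depend on the index of the coefficient lets sums over several
  indices be interchanged.\<close>

lemma fps_compose_nth_extend:
  fixes G B :: "'a::comm_ring_1 fps"
  assumes "fps_nth B 0 = 0" "n \<le> N"
  shows "fps_nth (fps_compose G B) n = (\<Sum>i\<le>N. fps_nth G i * fps_nth (B ^ i) n)"
proof -
  have "(\<Sum>i\<le>N. fps_nth G i * fps_nth (B ^ i) n) = (\<Sum>i\<in>{0..n}. fps_nth G i * fps_nth (B ^ i) n)"
    by (rule sum.mono_neutral_right) (use assms startsby_zero_power_prefix[of B] in auto)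
  thus ?thesis by (simp add: fps_compose_nth)
qed

lemma fps_nth_higher_deriv_fact:
  fixes f :: "'a::field_char_0 fps"
  shows "fps_nth ((fps_deriv ^^ s) f) k = fact (k + s) / fact k * fps_nth f (k + s)"
proof (induction s arbitrary: k)
  case (Suc s)
  have "fact (Suc k + s) / fact (Suc k) * of_nat (Suc k) = (fact (k + Suc s) / fact k :: 'a)"
    by (simp del: of_nat_Suc)
  moreover have "fps_nth ((fps_deriv ^^ Suc s) f) k =
      (fact (Suc k + s) / fact (Suc k) * of_nat (Suc k)) * fps_nth f (Suc k + s)"
    using Suc[of "Suc k"] by (simp del: of_nat_Suc fact_Suc add: mult_ac)
  ultimately show ?case by (simp only: add_Suc add_Suc_right)
qed simp

text \<open>Taylor's formula for \<open>G\<close> at \<open>H\<close>, as a rearrangement of finite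
  sums: each power of the inner series is expanded by the binomial theorem, and terms are collected
  by the number \<open>s\<close> of factors \<open>c * X ^ j\<close>.\<close>

lemma fps_compose_add_X_power:
  fixes G H :: "real fps"
  assumes H0: "fps_nth H 0 = 0" and j: "1 \<le> j" and nN: "n \<le> N"
  shows "fps_nth (fps_compose G (H + fps_const c * fps_X ^ j)) n =
    (\<Sum>s\<le>N. c ^ s / fact s * fps_nth (fps_compose ((fps_deriv ^^ s) G) H * fps_X ^ (j * s)) n)"
proof -
  \<comment> \<open>The contribution with \<open>s\<close> factors \<open>c * X ^ j\<close> and
    \<open>k\<close> factors \<open>H\<close>. Its order in \<open>X\<close> is at least
    \<open>s + k\<close>, so it vanishes for \<open>s + k > N\<close>, and the triangle of indices
    can be completed to a square.\<close>
  define T where "T s k = c ^ s / fact s * (fact (k + s) / fact k * fps_nth G (k + s))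
     * fps_nth (H ^ k * fps_X ^ (j * s)) n" for s k
  have T0: "T s k = 0" if "N < s + k" for s k
  proof -
    have "fps_nth (H ^ k * fps_X ^ (j * s)) n = 0"
    proof (cases "n < j * s")
      case False
      have "s \<le> j * s" using j by simp
      hence "n - j * s < k" using False that nN by linarith
      thus ?thesis using False H0 startsby_zero_power_prefix[of H k] by (simp add: fps_X_power_mult_right_nth)
    qed (simp add: fps_X_power_mult_right_nth)
    thus ?thesis by (simp add: T_def)
  qed
  have "fps_nth (fps_compose G (H + fps_const c * fps_X ^ j)) n =
     (\<Sum>i\<le>N. fps_nth G i * fps_nth ((H + fps_const c * fps_X ^ j) ^ i) n)"
    by (rule fps_compose_nth_extend) (use assms in auto)
  also have "\<dots> = (\<Sum>i\<le>N. \<Sum>s\<le>i. T s (i - s))"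
  proof (rule sum.cong[OF refl])
    fix i
    have "(H + fps_const c * fps_X ^ j) ^ i =
        (\<Sum>s\<le>i. of_nat (i choose s) * (fps_const c * fps_X ^ j) ^ s * H ^ (i - s))"
      by (subst add.commute) (rule binomial_ring)
    also have "\<dots> = (\<Sum>s\<le>i. fps_const (real (i choose s) * c ^ s) * (H ^ (i - s) * fps_X ^ (j * s)))"
    proof (rule sum.cong[OF refl])
      fix s
      have "(fps_const c * fps_X ^ j) ^ s = fps_const (c ^ s) * fps_X ^ (j * s)"
        by (simp add: power_mult_distrib fps_const_power power_mult)
      thus "of_nat (i choose s) * (fps_const c * fps_X ^ j) ^ s * H ^ (i - s) =
          fps_const (real (i choose s) * c ^ s) * (H ^ (i - s) * fps_X ^ (j * s))"
        by (simp only: fps_of_nat[symmetric] fps_const_mult[symmetric] mult_ac)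
    qed
    finally have "fps_nth ((H + fps_const c * fps_X ^ j) ^ i) n =
       (\<Sum>s\<le>i. real (i choose s) * c ^ s * fps_nth (H ^ (i - s) * fps_X ^ (j * s)) n)"
      by (simp add: fps_sum_nth)
    thus "fps_nth G i * fps_nth ((H + fps_const c * fps_X ^ j) ^ i) n = (\<Sum>s\<le>i. T s (i - s))"
      by (simp add: sum_distrib_left) (rule sum.cong, auto simp: T_def binomial_fact)
  qed
  also have "\<dots> = (\<Sum>(s, k) | s + k \<le> N. T s k)"
    by (subst sum.triangle_reindex_eq) simp
  also have "\<dots> = (\<Sum>(s, k) \<in> {..N} \<times> {..N}. T s k)"
    by (rule sum.mono_neutral_left) (use T0 not_le in auto)
  also have "\<dots> = (\<Sum>s\<le>N. \<Sum>k\<le>N. T s k)"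
    by (simp add: sum.cartesian_product)
  also have "\<dots> = (\<Sum>s\<le>N. c ^ s / fact s * fps_nth (fps_compose ((fps_deriv ^^ s) G) H * fps_X ^ (j * s)) n)"
  proof (rule sum.cong[OF refl])
    fix s
    show "(\<Sum>k\<le>N. T s k) = c ^ s / fact s * fps_nth (fps_compose ((fps_deriv ^^ s) G) H * fps_X ^ (j * s)) n"
    proof (cases "n < j * s")
      case False
      hence "fps_nth (fps_compose ((fps_deriv ^^ s) G) H * fps_X ^ (j * s)) n =
         (\<Sum>k\<le>N. fps_nth ((fps_deriv ^^ s) G) k * fps_nth (H ^ k) (n - j * s))"
        using fps_compose_nth_extend[OF H0, of "n - j * s" N "(fps_deriv ^^ s) G"] nN
        by (simp add: fps_X_power_mult_right_nth)
      thus ?thesis using False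
        by (simp add: T_def fps_X_power_mult_right_nth sum_distrib_left fps_nth_higher_deriv_fact mult_ac)
    qed (simp add: T_def fps_X_power_mult_right_nth)
  qed
  finally show ?thesis .
qed

text \<open>Substituting a number for \<open>v\<close> is multiplicative and commutes with
  composition, which reduces the bivariate series to ordinary ones.\<close>

definition eval_poly_fps :: "real \<Rightarrow> real poly fps \<Rightarrow> real fps" where
  "eval_poly_fps x A = Abs_fps (\<lambda>n. poly (fps_nth A n) x)"

lemma eval_poly_fps_nth [simp]: "fps_nth (eval_poly_fps x A) n = poly (fps_nth A n) x"
  by (simp add: eval_poly_fps_def)

lemma eval_poly_fps_mult: "eval_poly_fps x (A * B) = eval_poly_fps x A * eval_poly_fps x B"
  by (rule fps_ext) (simp add: fps_mult_nth poly_sum)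

lemma eval_poly_fps_power: "eval_poly_fps x (A ^ i) = eval_poly_fps x A ^ i"
  by (induction i) (auto simp: eval_poly_fps_mult intro!: fps_ext)

lemma eval_poly_fps_compose:
  "eval_poly_fps x (fps_compose A B) = fps_compose (eval_poly_fps x A) (eval_poly_fps x B)"
  by (rule fps_ext) (simp add: fps_compose_nth poly_sum eval_poly_fps_power[symmetric])

text \<open>At \<open>v = 1 + y\<close> the inner series is \<open>H + y h_j z^j\<close>, so powers
  of \<open>y\<close> count marked components of size \<open>j\<close>.\<close>

lemma poly_size_refined_scheme:
  fixes G H M :: "real fps"
  assumes H0: "fps_nth H 0 = 0" and j: "1 \<le> j"
  shows "poly (fps_nth (size_refined_scheme G H M j) n) (1 + y) =
    (\<Sum>s\<le>n. y ^ s * (fps_nth H j ^ s / fact s *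
       fps_nth (fps_compose ((fps_deriv ^^ s) G) H * M * fps_X ^ (j * s)) n))"
proof -
  define B where "B = H + fps_const (y * fps_nth H j) * fps_X ^ j"
  have lift: "eval_poly_fps x (lift_fps f) = f" for x f
    by (rule fps_ext) (simp add: lift_fps_def)
  have "eval_poly_fps (1 + y) (lift_fps H - fps_const ((1 - [:0, 1:]) * [:fps_nth H j:]) * fps_X ^ j) = B"
    by (rule fps_ext) (simp add: lift_fps_def B_def fps_X_power_mult_right_nth algebra_simps)
  hence "eval_poly_fps (1 + y) (size_refined_scheme G H M j) = fps_compose G B * M"
    by (simp add: size_refined_scheme_def eval_poly_fps_mult eval_poly_fps_compose lift)
  hence "poly (fps_nth (size_refined_scheme G H M j) n) (1 + y) = fps_nth (fps_compose G B * M) n"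
    by (metis eval_poly_fps_nth)
  also have "\<dots> = (\<Sum>i=0..n. fps_nth (fps_compose G B) i * fps_nth M (n - i))"
    by (simp add: fps_mult_nth)
  also have "\<dots> = (\<Sum>i=0..n. (\<Sum>s\<le>n. (y * fps_nth H j) ^ s / fact s *
      fps_nth (fps_compose ((fps_deriv ^^ s) G) H * fps_X ^ (j * s)) i) * fps_nth M (n - i))"
    unfolding B_def by (intro sum.cong refl arg_cong2[of _ _ _ _ "(*)"] fps_compose_add_X_power H0 j) auto
  also have "\<dots> = (\<Sum>s\<le>n. (y * fps_nth H j) ^ s / fact s *
      (\<Sum>i=0..n. fps_nth (fps_compose ((fps_deriv ^^ s) G) H * fps_X ^ (j * s)) i * fps_nth M (n - i)))"
    unfolding sum_distrib_right sum_distrib_left by (subst sum.swap) (simp add: mult_ac)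
  also have "\<dots> = (\<Sum>s\<le>n. y ^ s * (fps_nth H j ^ s / fact s *
       fps_nth (fps_compose ((fps_deriv ^^ s) G) H * M * fps_X ^ (j * s)) n))"
  proof (rule sum.cong[OF refl])
    fix s
    have "fps_compose ((fps_deriv ^^ s) G) H * M * fps_X ^ (j * s) =
        (fps_compose ((fps_deriv ^^ s) G) H * fps_X ^ (j * s)) * M" by (simp add: mult_ac)
    thus "(y * fps_nth H j) ^ s / fact s *
      (\<Sum>i=0..n. fps_nth (fps_compose ((fps_deriv ^^ s) G) H * fps_X ^ (j * s)) i * fps_nth M (n - i)) =
      y ^ s * (fps_nth H j ^ s / fact s *
       fps_nth (fps_compose ((fps_deriv ^^ s) G) H * M * fps_X ^ (j * s)) n)"
      by (simp only: fps_mult_nth[of _ M n]) (simp add: power_mult_distrib)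
  qed
  finally show ?thesis .
qed

text \<open>Shifting \<open>v\<close> to \<open>1 + y\<close> turns coefficients into binomial
  moments: the moment of order \<open>s\<close> is the coefficient of \<open>y ^ s\<close>. The two
  expansions agree for every real \<open>y\<close>, hence as polynomials.\<close>

lemma size_refined_scheme_binomial_moment:
  fixes G H M :: "real fps"
  assumes H0: "fps_nth H 0 = 0" and j: "1 \<le> j"
  defines "p \<equiv> \<lambda>n. fps_nth (size_refined_scheme G H M j) n"
  shows "(\<Sum>k\<le>degree (p n). coeff (p n) k * real (k choose s)) =
     fps_nth H j ^ s / fact s * fps_nth (fps_compose ((fps_deriv ^^ s) G) H * M * fps_X ^ (j * s)) n"
proof -
  define a where "a s = fps_nth H j ^ s / fact s *
       fps_nth (fps_compose ((fps_deriv ^^ s) G) H * M * fps_X ^ (j * s)) n" for s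
  define q1 where "q1 = (\<Sum>k\<le>degree (p n). smult (coeff (p n) k) ([:1, 1:] ^ k))"
  define q2 where "q2 = (\<Sum>s\<le>n. monom (a s) s)"
  have "poly q1 y = poly q2 y" for y
  proof -
    have "poly q1 y = poly (p n) (1 + y)"
      by (simp add: q1_def poly_sum poly_altdef[of "p n"])
    also have "\<dots> = poly q2 y"
      using poly_size_refined_scheme[OF H0 j, of G M n y]
      by (simp add: q2_def a_def p_def poly_sum poly_monom mult.commute)
    finally show ?thesis .
  qed
  hence "q1 = q2" by (simp add: poly_eq_poly_eq_iff[symmetric] ext)
  hence "coeff q1 s = coeff q2 s" by simp
  moreover have "coeff q1 s = (\<Sum>k\<le>degree (p n). coeff (p n) k * real (k choose s))"
  proof -
    have "coeff ([:1, 1:] ^ k) s = real (k choose s)" for k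
    proof (cases "s \<le> k")
      case False
      moreover have "degree ([:1, 1 :: real:] ^ k) = k" by (simp add: degree_linear_power)
      ultimately show ?thesis by (simp add: coeff_eq_0)
    qed (simp add: coeff_linear_poly_power)
    thus ?thesis by (simp add: q1_def coeff_sum)
  qed
  moreover have "coeff q2 s = (if s \<le> n then a s else 0)"
    by (simp add: q2_def coeff_sum)
  \<comment> \<open>More than \<open>n\<close> marked components, each of size at least 1, do not
    fit into total size \<open>n\<close>.\<close>
  moreover have "a s = 0" if "n < s"
  proof -
    have "s \<le> j * s" using j by simp
    hence "n < j * s" using that by linarith
    thus ?thesis by (simp add: a_def fps_X_power_mult_right_nth)
  qed
  ultimately show ?thesis by (auto simp: a_def not_le)
qed

section \<open>The law of the component count as a probability mass function\<close>

lemma nonneg_coeff_mult: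
  fixes p q :: "real poly"
  assumes "\<And>k. 0 \<le> coeff p k" "\<And>k. 0 \<le> coeff q k"
  shows "0 \<le> coeff (p * q) k"
  using assms by (auto simp: coeff_mult intro!: sum_nonneg)

lemma nonneg_coeff_fps_mult:
  fixes A B :: "real poly fps"
  assumes "\<And>n k. 0 \<le> coeff (fps_nth A n) k" "\<And>n k. 0 \<le> coeff (fps_nth B n) k"
  shows "0 \<le> coeff (fps_nth (A * B) n) k"
  using assms by (auto simp: fps_mult_nth coeff_sum intro!: sum_nonneg nonneg_coeff_mult)

lemma nonneg_coeff_fps_power:
  fixes A :: "real poly fps"
  assumes "\<And>n k. 0 \<le> coeff (fps_nth A n) k"
  shows "0 \<le> coeff (fps_nth (A ^ i) n) k"
proof (induction i arbitrary: n k)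
  case (Suc i)
  thus ?case using assms by (auto intro!: nonneg_coeff_fps_mult)
qed (auto simp: coeff_1)

text \<open>The minus sign is harmless: the only altered coefficient of the inner series is
  \<open>h_j - (1 - v) h_j = v h_j\<close>.\<close>

lemma nonneg_coeff_size_refined_scheme:
  assumes "nonneg_coeffs G" "nonneg_coeffs H" "nonneg_coeffs M"
  shows "0 \<le> coeff (fps_nth (size_refined_scheme G H M j) n) k"
proof -
  have lift: "0 \<le> coeff (fps_nth (lift_fps f) n) k" if "nonneg_coeffs f" for f n k
    using that by (auto simp: lift_fps_def nonneg_coeffs_def coeff_pCons split: nat.splits)
  have "0 \<le> coeff (fps_nth (lift_fps H - fps_const ((1 - [:0, 1:]) * [:fps_nth H j:]) * fps_X ^ j) n) k" for n k
    using assms(2) by (auto simp: lift_fps_def nonneg_coeffs_def fps_X_power_mult_right_nth coeff_pCons split: nat.splits)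
  hence "0 \<le> coeff (fps_nth (fps_compose (lift_fps G)
     (lift_fps H - fps_const ((1 - [:0, 1:]) * [:fps_nth H j:]) * fps_X ^ j)) n) k" for n k
    unfolding fps_compose_nth coeff_sum
    by (intro sum_nonneg nonneg_coeff_mult lift assms nonneg_coeff_fps_power)
  thus ?thesis unfolding size_refined_scheme_def by (intro nonneg_coeff_fps_mult lift assms)
qed

text \<open>\<open>embed_pmf\<close> has the intended values only if these are nonnegative with sum
  1. The sum of the coefficients is the value at \<open>v = 1\<close>, by which they are
  divided.\<close>

lemma component_count_pmf_binomial_moment:
  fixes G H M :: "real fps"
  assumes nn: "nonneg_coeffs G" "nonneg_coeffs H" "nonneg_coeffs M"
    and H0: "fps_nth H 0 = 0" and j: "1 \<le> j"
    and nz: "fps_nth (fps_compose G H * M) n \<noteq> 0"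
  shows "finite (set_pmf (component_count_pmf G H M n j))"
    and "measure_pmf.expectation (component_count_pmf G H M n j) (\<lambda>k. real (k choose s)) =
      fps_nth H j ^ s / fact s * fps_nth (fps_compose ((fps_deriv ^^ s) G) H * M * fps_X ^ (j * s)) n
        / fps_nth (fps_compose G H * M) n"
proof -
  define p where "p = fps_nth (size_refined_scheme G H M j) n"
  have p1: "poly p 1 = fps_nth (fps_compose G H * M) n"
    using poly_size_refined_scheme[OF H0 j, of G M n 0] by (simp add: p_def sum.atMost_shift)
  have pk: "0 \<le> coeff p k" for k unfolding p_def by (rule nonneg_coeff_size_refined_scheme[OF nn])
  have sum1: "(\<Sum>k\<le>degree p. coeff p k) = poly p 1" by (simp add: poly_altdef)
  have "0 \<le> poly p 1" unfolding sum1[symmetric] by (intro sum_nonneg pk)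
  hence pos: "0 < poly p 1" using nz p1 by simp
  define f where "f k = coeff p k / poly p 1" for k
  have f0: "0 \<le> f k" for k using pk pos by (simp add: f_def)
  have "(\<integral>\<^sup>+k. ennreal (f k) \<partial>count_space UNIV) = (\<integral>\<^sup>+k. ennreal (f k) \<partial>count_space {..degree p})"
    by (rule nn_integral_count_space_eq) (auto simp: f_def not_le coeff_eq_0)
  also have "\<dots> = (\<Sum>k\<le>degree p. ennreal (f k))" by (rule nn_integral_count_space_finite) auto
  also have "\<dots> = ennreal (\<Sum>k\<le>degree p. f k)" using f0 by (simp add: sum_ennreal)
  also have "(\<Sum>k\<le>degree p. f k) = 1" using pos sum1 by (simp add: f_def sum_divide_distrib[symmetric])
  finally have int1: "(\<integral>\<^sup>+k. ennreal (f k) \<partial>count_space UNIV) = 1" by simp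
  have pmf: "pmf (component_count_pmf G H M n j) k = f k" for k
    unfolding component_count_pmf_def p_def[symmetric] f_def[symmetric]
    by (rule pmf_embed_pmf[OF f0 int1])
  have sub: "set_pmf (component_count_pmf G H M n j) \<subseteq> {..degree p}"
    unfolding set_pmf_iff subset_iff pmf f_def by (auto intro: le_degree)
  thus "finite (set_pmf (component_count_pmf G H M n j))" by (rule finite_subset) simp
  have "measure_pmf.expectation (component_count_pmf G H M n j) (\<lambda>k. real (k choose s)) =
     (\<Sum>k\<le>degree p. real (k choose s) * f k)"
    by (subst integral_measure_pmf_real[of "{..degree p}"]) (use sub pmf in auto)
  also have "\<dots> = (\<Sum>k\<le>degree p. coeff p k * real (k choose s)) / poly p 1"
    by (simp add: f_def sum_divide_distrib mult.commute)
  finally show "measure_pmf.expectation (component_count_pmf G H M n j) (\<lambda>k. real (k choose s)) =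
      fps_nth H j ^ s / fact s * fps_nth (fps_compose ((fps_deriv ^^ s) G) H * M * fps_X ^ (j * s)) n
        / fps_nth (fps_compose G H * M) n"
    unfolding p1 unfolding p_def size_refined_scheme_binomial_moment[OF H0 j] .
qed

section \<open>The method of moments and mixed Poisson laws\<close>

text \<open>Characteristic functions are compared with their Taylor polynomials, whose coefficients
  converge. The remainder at order \<open>N\<close> is controlled by the \<open>N\<close>-th moment:
  the growth condition makes it small for \<open>L\<close>, and convergence of that one moment
  carries the bound over to \<open>\<mu> n\<close>.\<close>

lemma weak_conv_of_moments:
  fixes \<mu> :: "nat \<Rightarrow> real measure"
  assumes rd: "\<And>n. real_distribution (\<mu> n)" and rdL: "real_distribution L"
    and mom: "moments_converge \<mu> L"
    and growth: "\<And>t. (\<lambda>N. t ^ N * (\<integral>x. x ^ N \<partial>L) / fact N) \<longlonglongrightarrow> 0"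
  shows "weak_conv_m \<mu> L"
proof (rule levy_continuity[OF rd rdL])
  fix t :: real
  \<comment> \<open>\<open>moments_converge\<close> speaks of orders from 1 on; order 0 is supplied
    by total mass 1.\<close>
  have intL: "integrable L (\<lambda>x. x ^ k)" for k
  proof (cases k)
    case 0
    interpret L: real_distribution L by fact
    show ?thesis using 0 by simp
  next
    case (Suc m)
    thus ?thesis using mom unfolding moments_converge_def by auto
  qed
  have int\<mu>: "\<forall>\<^sub>F n in sequentially. integrable (\<mu> n) (\<lambda>x. x ^ k)" for k
  proof (cases k)
    case 0
    have "integrable (\<mu> n) (\<lambda>x. x ^ 0)" for n
    proof -
      interpret real_distribution "\<mu> n" by (rule rd)
      show ?thesis by simp
    qed
    thus ?thesis using 0 by simp
  next
    case (Suc m)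
    thus ?thesis using mom unfolding moments_converge_def by auto
  qed
  have conv: "(\<lambda>n. \<integral>x. x ^ k \<partial>\<mu> n) \<longlonglongrightarrow> (\<integral>x. x ^ k \<partial>L)" for k
  proof (cases k)
    case 0
    have "(\<integral>x. x ^ 0 \<partial>\<mu> n) = 1" for n
    proof -
      interpret real_distribution "\<mu> n" by (rule rd)
      show ?thesis using prob_space by simp
    qed
    moreover have "(\<integral>x. x ^ 0 \<partial>L) = 1"
    proof -
      interpret real_distribution L by (rule rdL)
      show ?thesis using prob_space by simp
    qed
    ultimately show ?thesis using 0 by simp
  next
    case (Suc m)
    thus ?thesis using mom unfolding moments_converge_def by auto
  qed
  show "(\<lambda>n. char (\<mu> n) t) \<longlonglongrightarrow> char L t"
  proof (rule tendstoI)
    fix e :: real assume e: "0 < e"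
    from order_tendstoD(2)[OF growth[of "\<bar>t\<bar>"], of "e / 8"] e
    obtain N0 where N0: "\<And>N. N \<ge> N0 \<Longrightarrow> \<bar>t\<bar> ^ N * (\<integral>x. x ^ N \<partial>L) / fact N < e / 8"
      by (auto simp: eventually_sequentially)
    \<comment> \<open>An even order, so that the absolute moment in the remainder is an ordinary
      moment.\<close>
    define N where "N = 2 * N0"
    have N: "even N" "\<bar>t\<bar> ^ N * (\<integral>x. x ^ N \<partial>L) / fact N < e / 8" using N0[of N] by (auto simp: N_def)
    define S where "S m = (\<Sum>k\<le>N. ((\<i> * t) ^ k / fact k) * complex_of_real (\<integral>x. x ^ k \<partial>m))" for m
    define R where "R m = (2 * \<bar>t\<bar> ^ N / fact N) * (\<integral>x. x ^ N \<partial>m)" for m :: "real measure"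
    have bnd: "cmod (char m t - S m) \<le> R m" if "real_distribution m" "\<And>k. k \<le> N \<Longrightarrow> integrable m (\<lambda>x. x ^ k)" for m
    proof -
      interpret real_distribution m by fact
      show ?thesis using char_approx1[of N t] that N(1) unfolding S_def R_def
        by (simp add: power_even_abs)
    qed
    have RL: "R L < e / 4" using N(2) by (simp add: R_def mult_ac)
    have "(\<lambda>n. S (\<mu> n)) \<longlonglongrightarrow> S L"
      unfolding S_def by (intro tendsto_sum tendsto_mult tendsto_const tendsto_of_real conv)
    hence "\<forall>\<^sub>F n in sequentially. dist (S (\<mu> n)) (S L) < e / 4" using e by (intro tendstoD) auto
    moreover have "(\<lambda>n. R (\<mu> n)) \<longlonglongrightarrow> R L"
      unfolding R_def by (intro tendsto_mult tendsto_const conv)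
    hence "\<forall>\<^sub>F n in sequentially. R (\<mu> n) < e / 4" using RL by (rule order_tendstoD)
    moreover have "\<forall>\<^sub>F n in sequentially. \<forall>k\<in>{..N}. integrable (\<mu> n) (\<lambda>x. x ^ k)"
      using int\<mu> by (intro eventually_ball_finite) auto
    ultimately show "\<forall>\<^sub>F n in sequentially. dist (char (\<mu> n) t) (char L t) < e"
    proof eventually_elim
      case (elim n)
      have "cmod (char (\<mu> n) t - S (\<mu> n)) \<le> R (\<mu> n)" using elim by (intro bnd rd) auto
      moreover have "cmod (char L t - S L) \<le> R L" using intL by (intro bnd rdL)
      moreover have "cmod (char (\<mu> n) t - char L t) \<le> cmod (char (\<mu> n) t - S (\<mu> n)) + cmod (S (\<mu> n) - char L t)"
        using norm_triangle_ineq[of "char (\<mu> n) t - S (\<mu> n)" "S (\<mu> n) - char L t"] by simp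
      moreover have "cmod (S (\<mu> n) - char L t) \<le> cmod (S (\<mu> n) - S L) + cmod (char L t - S L)"
        using norm_triangle_ineq4[of "S (\<mu> n) - S L" "char L t - S L"] by simp
      ultimately show ?case using elim RL e by (simp add: dist_norm)
    qed
  qed
qed

text \<open>A single term of the exponential series is bounded by the whole. Using this at
  \<open>2 * \<bar>t\<bar>\<close> gains the factor \<open>(1 / 2) ^ N\<close>.\<close>

lemma exp_integrable_moments:
  assumes "prob_space L" and sL: "sets L = sets borel" and nn: "AE x in L. 0 \<le> x"
    and ex: "\<And>t. integrable L (\<lambda>x. exp (t * x))"
  shows "integrable L (\<lambda>x :: real. x ^ N)"
    and "(\<lambda>N. t ^ N * (\<integral>x. x ^ N \<partial>L) / fact N) \<longlonglongrightarrow> 0"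
proof -
  interpret prob_space L by fact
  note [measurable_cong] = sL
  have le: "(s * x) ^ N / fact N \<le> exp (s * x)" if "0 \<le> s" "0 \<le> x" for s x :: real and N
  proof -
    have "(s * x) ^ N / fact N = (\<Sum>n\<in>{N}. inverse (fact n) * (s * x) ^ n)" by (simp add: field_simps)
    also have "\<dots> \<le> (\<Sum>n. inverse (fact n) * (s * x) ^ n)"
      by (rule sum_le_suminf) (use that summable_exp in \<open>auto intro!: mult_nonneg_nonneg\<close>)
    also have "\<dots> = exp (s * x)" by (simp add: exp_def)
    finally show ?thesis .
  qed
  show int: "integrable L (\<lambda>x :: real. x ^ N)" for N
  proof (rule Bochner_Integration.integrable_bound)
    show "integrable L (\<lambda>x. fact N * exp (1 * x))" using ex by (intro integrable_mult_right)
    show "AE x in L. norm (x ^ N) \<le> norm (fact N * exp (1 * x))"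
      using nn by eventually_elim (use le[of 1 _ N] in \<open>auto simp: field_simps\<close>)
  qed measurable
  show "(\<lambda>N. t ^ N * (\<integral>x. x ^ N \<partial>L) / fact N) \<longlonglongrightarrow> 0"
  proof (rule Lim_null_comparison)
    define E where "E = (\<integral>x. exp ((2 * \<bar>t\<bar>) * x) \<partial>L)"
    show "\<forall>\<^sub>F N in sequentially. norm (t ^ N * (\<integral>x. x ^ N \<partial>L) / fact N) \<le> (1 / 2) ^ N * E"
    proof (intro always_eventually allI)
      fix N
      have "0 \<le> (\<integral>x. x ^ N \<partial>L)" using nn by (intro integral_nonneg_AE) (auto elim: eventually_mono)
      hence "norm (t ^ N * (\<integral>x. x ^ N \<partial>L) / fact N) = (1 / 2) ^ N * (\<integral>x. (2 * \<bar>t\<bar>) ^ N / fact N * x ^ N \<partial>L)"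
        using int[of N] by (simp add: abs_mult power_abs power_mult_distrib power_one_over field_simps)
      also have "(\<integral>x. (2 * \<bar>t\<bar>) ^ N / fact N * x ^ N \<partial>L) \<le> E"
        unfolding E_def
      proof (rule integral_mono_AE)
        show "AE x in L. (2 * \<bar>t\<bar>) ^ N / fact N * x ^ N \<le> exp ((2 * \<bar>t\<bar>) * x)"
          using nn by eventually_elim (use le[of "2 * \<bar>t\<bar>" _ N] in \<open>auto simp: power_mult_distrib\<close>)
      qed (use int ex in auto)
      finally show "norm (t ^ N * (\<integral>x. x ^ N \<partial>L) / fact N) \<le> (1 / 2) ^ N * E" by simp
    qed
    show "(\<lambda>N. (1 / 2) ^ N * E) \<longlonglongrightarrow> 0" by real_asymp
  qed
qed

text \<open>Monotone convergence sums the moments to the integral of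
  \<open>exp (\<bar>t\<bar> * x)\<close>, which dominates both signs of \<open>t\<close>.\<close>

lemma exp_integrable_of_summable_moments:
  fixes m :: "nat \<Rightarrow> real"
  assumes "prob_space L" and sL: "sets L = sets borel" and nn: "AE x in L. 0 \<le> x"
    and m: "\<And>s. has_bochner_integral L (\<lambda>x :: real. x ^ s) (m s)"
    and sm: "\<And>t. 0 \<le> t \<Longrightarrow> summable (\<lambda>s. t ^ s * m s / fact s)"
  shows "integrable L (\<lambda>x. exp (t * x))"
proof (rule Bochner_Integration.integrable_bound)
  interpret prob_space L by fact
  note [measurable_cong] = sL
  let ?t = "\<bar>t\<bar>"
  have m0: "0 \<le> m s" for s
  proof -
    have "m s = (\<integral>x. x ^ s \<partial>L)" using m[of s] by (simp add: has_bochner_integral_iff)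
    also have "\<dots> \<ge> 0" using nn by (intro integral_nonneg_AE) (auto elim: eventually_mono)
    finally show ?thesis .
  qed
  have "(\<integral>\<^sup>+x. ennreal (exp (?t * x)) \<partial>L) = (\<integral>\<^sup>+x. (\<Sum>s. ennreal (?t ^ s / fact s * x ^ s)) \<partial>L)"
  proof (rule nn_integral_cong_AE)
    show "AE x in L. ennreal (exp (?t * x)) = (\<Sum>s. ennreal (?t ^ s / fact s * x ^ s))"
      using nn
    proof eventually_elim
      case (elim x)
      have "(\<lambda>s. ?t ^ s / fact s * x ^ s) sums exp (?t * x)"
        using exp_converges[of "?t * x"] by (simp add: power_mult_distrib divide_inverse mult_ac)
      thus ?case using elim by (intro suminf_ennreal_eq[symmetric]) auto
    qed
  qed
  also have "\<dots> = (\<Sum>s. \<integral>\<^sup>+x. ennreal (?t ^ s / fact s * x ^ s) \<partial>L)"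
    by (rule nn_integral_suminf) measurable
  also have "\<dots> = (\<Sum>s. ennreal (?t ^ s * m s / fact s))"
  proof (rule suminf_cong)
    fix s
    have "has_bochner_integral L (\<lambda>x. ?t ^ s / fact s * x ^ s) (?t ^ s / fact s * m s)"
      by (rule has_bochner_integral_mult_right) (use m in auto)
    hence *: "integrable L (\<lambda>x. ?t ^ s / fact s * x ^ s)"
        "(\<integral>x. ?t ^ s / fact s * x ^ s \<partial>L) = ?t ^ s / fact s * m s"
      unfolding has_bochner_integral_iff by blast+
    have "(\<integral>\<^sup>+x. ennreal (?t ^ s / fact s * x ^ s) \<partial>L) = ennreal (?t ^ s / fact s * m s)"
      unfolding *(2)[symmetric] using nn
      by (intro nn_integral_eq_integral *(1)) (auto elim!: eventually_mono)
    thus "(\<integral>\<^sup>+x. ennreal (?t ^ s / fact s * x ^ s) \<partial>L) = ennreal (?t ^ s * m s / fact s)" by simp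
  qed
  also have "\<dots> < \<infinity>"
    using sm[of ?t] m0 by (subst suminf_ennreal2) auto
  finally show "integrable L (\<lambda>x. exp (?t * x))"
    by (intro integrableI_bounded) auto
  show "AE x in L. norm (exp (t * x)) \<le> norm (exp (?t * x))"
    using nn by eventually_elim (auto intro!: mult_right_mono)
  show "(\<lambda>x. exp (t * x)) \<in> borel_measurable L" by measurable
qed

text \<open>Tonelli's theorem: \<open>\<Phi> y\<close> is the mean of \<open>g\<close> under a
  Poisson law with mean \<open>y\<close>, and mixing integrates it over
  \<open>y = \<xi> * x\<close>.\<close>

lemma nn_integral_mixed_poisson:
  assumes "prob_space L" and sL: "sets L = sets borel" and nn: "AE x in L. 0 \<le> x"
    and int: "\<And>l. integrable L (\<lambda>x :: real. x ^ l)" and \<xi>: "0 \<le> \<xi>"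
    and g: "\<And>l. 0 \<le> g l" and sums: "\<And>y. 0 \<le> y \<Longrightarrow> (\<lambda>l. y ^ l / fact l * exp (-y) * g l) sums \<Phi> y"
  shows "(\<integral>\<^sup>+l. ennreal (g l) \<partial>measure_pmf (mixed_poisson_pmf \<xi> L)) = (\<integral>\<^sup>+x. ennreal (\<Phi> (\<xi> * x)) \<partial>L)"
proof -
  interpret prob_space L by fact
  note [measurable_cong] = sL
  define f where "f l = \<xi> ^ l / fact l * (\<integral>x. x ^ l * exp (- \<xi> * x) \<partial>L)" for l
  have int': "integrable L (\<lambda>x. x ^ l * exp (- \<xi> * x))" for l
  proof (rule Bochner_Integration.integrable_bound[OF int[of l]])
    show "AE x in L. norm (x ^ l * exp (- \<xi> * x)) \<le> norm (x ^ l)"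
      using nn by eventually_elim (use \<xi> in \<open>auto intro!: mult_left_le simp: norm_mult\<close>)
  qed measurable
  have f0: "0 \<le> f l" for l
    unfolding f_def using nn \<xi> by (intro mult_nonneg_nonneg integral_nonneg_AE) (auto elim: eventually_mono)
  have fnn: "ennreal (f l) = (\<integral>\<^sup>+x. ennreal ((\<xi> * x) ^ l / fact l * exp (- (\<xi> * x))) \<partial>L)" for l
  proof -
    have "f l = (\<integral>x. \<xi> ^ l / fact l * (x ^ l * exp (- \<xi> * x)) \<partial>L)"
      unfolding f_def using int'[of l] by simp
    also have "ennreal \<dots> = (\<integral>\<^sup>+x. ennreal (\<xi> ^ l / fact l * (x ^ l * exp (- \<xi> * x))) \<partial>L)"
      by (rule nn_integral_eq_integral[symmetric])
         (use int' nn \<xi> in \<open>auto elim!: eventually_mono intro!: integrable_mult_right simp del: times_divide_eq_left\<close>)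
    finally show ?thesis by (simp add: power_mult_distrib mult_ac)
  qed
  \<comment> \<open>Proved for all \<open>g\<close> and \<Phi>, since it is needed first with
    \<open>g = 1\<close>: total mass 1 is what identifies the values of
    \<open>embed_pmf\<close>.\<close>
  have main: "(\<integral>\<^sup>+l. ennreal (f l) * ennreal (g l) \<partial>count_space UNIV) = (\<integral>\<^sup>+x. ennreal (\<Phi> (\<xi> * x)) \<partial>L)"
    if g: "\<And>l. 0 \<le> g l" and sums: "\<And>y. 0 \<le> y \<Longrightarrow> (\<lambda>l. y ^ l / fact l * exp (-y) * g l) sums \<Phi> y" for g \<Phi>
  proof -
    have "(\<integral>\<^sup>+l. ennreal (f l) * ennreal (g l) \<partial>count_space UNIV) = (\<Sum>l. ennreal (f l) * ennreal (g l))"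
      by (rule nn_integral_count_space_nat)
    also have "\<dots> = (\<Sum>l. \<integral>\<^sup>+x. ennreal ((\<xi> * x) ^ l / fact l * exp (- (\<xi> * x))) * ennreal (g l) \<partial>L)"
      unfolding fnn by (intro suminf_cong nn_integral_multc[symmetric]) measurable
    also have "\<dots> = (\<integral>\<^sup>+x. (\<Sum>l. ennreal ((\<xi> * x) ^ l / fact l * exp (- (\<xi> * x))) * ennreal (g l)) \<partial>L)"
      by (rule nn_integral_suminf[symmetric]) measurable
    also have "\<dots> = (\<integral>\<^sup>+x. ennreal (\<Phi> (\<xi> * x)) \<partial>L)"
    proof (rule nn_integral_cong_AE)
      show "AE x in L. (\<Sum>l. ennreal ((\<xi> * x) ^ l / fact l * exp (- (\<xi> * x))) * ennreal (g l)) = ennreal (\<Phi> (\<xi> * x))"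
        using nn
      proof eventually_elim
        case (elim x)
        have "0 \<le> \<xi> * x" using elim \<xi> by simp
        from suminf_ennreal_eq[OF _ sums[OF this]] this g show ?case
          by (simp add: ennreal_mult'' del: times_divide_eq_left)
      qed
    qed
    finally show ?thesis .
  qed
  have "(\<integral>\<^sup>+l. ennreal (f l) \<partial>count_space UNIV) = (\<integral>\<^sup>+x. ennreal 1 \<partial>L)"
  proof -
    have "(\<lambda>l. y ^ l / fact l * exp (-y) * 1) sums 1" for y :: real
      using sums_mult2[OF exp_converges[of y], of "exp (-y)"]
      by (simp add: divide_inverse mult_ac exp_minus)
    thus ?thesis using main[of "\<lambda>_. 1" "\<lambda>_. 1"] by simp
  qed
  also have "\<dots> = 1" using emeasure_space_1 by simp
  finally have "pmf (mixed_poisson_pmf \<xi> L) l = f l" for l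
    unfolding mixed_poisson_pmf_def f_def[symmetric] by (intro pmf_embed_pmf f0)
  thus ?thesis using main[OF g sums] by (simp add: nn_integral_measure_pmf)
qed

text \<open>The exponential moment of a Poisson law with mean \<open>y\<close> is
  \<open>exp (y * (exp t - 1))\<close>, so exponential integrability is inherited from the mixing
  law.\<close>

lemma mixed_poisson_exp_integrable:
  assumes "prob_space L" and sL: "sets L = sets borel" and nn: "AE x in L. 0 \<le> x"
    and ex: "\<And>t. integrable L (\<lambda>x :: real. exp (t * x))" and \<xi>: "0 \<le> \<xi>"
  shows "integrable (measure_pmf (mixed_poisson_pmf \<xi> L)) (\<lambda>l. exp (t * real l))"
proof (rule integrableI_bounded)
  interpret prob_space L by fact
  have "(\<integral>\<^sup>+l. ennreal (exp (t * real l)) \<partial>measure_pmf (mixed_poisson_pmf \<xi> L)) =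
     (\<integral>\<^sup>+x. ennreal (exp (\<xi> * x * (exp t - 1))) \<partial>L)"
  proof (rule nn_integral_mixed_poisson)
    fix y :: real
    have "(\<lambda>l. exp (-y) * (inverse (fact l) * (y * exp t) ^ l)) sums (exp (-y) * exp (y * exp t))"
      using exp_converges[of "y * exp t"] by (intro sums_mult) (simp add: divide_inverse)
    thus "(\<lambda>l. y ^ l / fact l * exp (- y) * exp (t * real l)) sums exp (y * (exp t - 1))"
      by (simp add: power_mult_distrib exp_of_nat_mult[symmetric] divide_inverse mult_ac
          exp_add[symmetric] algebra_simps)
  qed (use assms exp_integrable_moments in auto)
  also have "\<dots> < \<infinity>"
    using ex[of "\<xi> * (exp t - 1)"] by (simp add: integrable_iff_bounded mult_ac)
  finally show "(\<integral>\<^sup>+l. ennreal (norm (exp (t * real l))) \<partial>measure_pmf (mixed_poisson_pmf \<xi> L)) < \<infinity>"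
    by simp
qed simp

text \<open>The factorial moment of order \<open>s\<close> of a Poisson law with mean
  \<open>y\<close> is \<open>y ^ s\<close>.\<close>

lemma mixed_poisson_binomial_moment:
  assumes "prob_space L" and sL: "sets L = sets borel" and nn: "AE x in L. 0 \<le> x"
    and ex: "\<And>t. integrable L (\<lambda>x :: real. exp (t * x))" and \<xi>: "0 \<le> \<xi>"
  shows "has_bochner_integral (measure_pmf (mixed_poisson_pmf \<xi> L)) (\<lambda>l. real (l choose s))
     (\<xi> ^ s / fact s * (\<integral>x. x ^ s \<partial>L))"
proof (rule has_bochner_integral_nn_integral)
  interpret prob_space L by fact
  note int = exp_integrable_moments(1)[OF assms(1-4)]
  have "(\<integral>\<^sup>+l. ennreal (real (l choose s)) \<partial>measure_pmf (mixed_poisson_pmf \<xi> L)) =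
     (\<integral>\<^sup>+x. ennreal ((\<xi> * x) ^ s / fact s) \<partial>L)"
  proof (rule nn_integral_mixed_poisson)
    fix y :: real
    have "(\<lambda>k. y ^ s / fact s * exp (-y) * (inverse (fact k) * y ^ k)) sums (y ^ s / fact s * exp (-y) * exp y)"
      using exp_converges[of y] by (intro sums_mult) (simp add: divide_inverse)
    also have "y ^ s / fact s * exp (-y) * exp y = y ^ s / fact s" by (simp add: exp_minus)
    also have "(\<lambda>k. y ^ s / fact s * exp (-y) * (inverse (fact k) * y ^ k)) =
       (\<lambda>k. y ^ (k + s) / fact (k + s) * exp (- y) * real ((k + s) choose s))"
      by (rule ext) (simp add: binomial_fact power_add field_simps)
    finally show "(\<lambda>l. y ^ l / fact l * exp (- y) * real (l choose s)) sums (y ^ s / fact s)"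
      by (subst (asm) sums_iff_shift) (auto simp: binomial_eq_0)
  qed (use assms int in auto)
  also have "\<dots> = (\<integral>\<^sup>+x. ennreal (\<xi> ^ s / fact s * x ^ s) \<partial>L)" by (simp add: power_mult_distrib)
  also have "\<dots> = ennreal (\<integral>x. \<xi> ^ s / fact s * x ^ s \<partial>L)"
    by (rule nn_integral_eq_integral)
       (use int nn \<xi> in \<open>auto elim!: eventually_mono intro!: integrable_mult_right simp del: times_divide_eq_left\<close>)
  also have "(\<integral>x. \<xi> ^ s / fact s * x ^ s \<partial>L) = \<xi> ^ s / fact s * (\<integral>x. x ^ s \<partial>L)" using int by simp
  finally show "(\<integral>\<^sup>+l. ennreal (real (l choose s)) \<partial>measure_pmf (mixed_poisson_pmf \<xi> L)) =
     ennreal (\<xi> ^ s / fact s * (\<integral>x. x ^ s \<partial>L))" .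
  have "0 \<le> (\<integral>x. x ^ s \<partial>L)" using nn by (intro integral_nonneg_AE) (auto elim: eventually_mono)
  thus "0 \<le> \<xi> ^ s / fact s * (\<integral>x. x ^ s \<partial>L)" using \<xi> by simp
qed auto

text \<open>\<open>fact k\<close> times the Stirling number of the second kind, that is, the number
  of surjections from an \<open>s\<close>-element set onto a \<open>k\<close>-element set.\<close>

primrec power_choose_coeff :: "nat \<Rightarrow> nat \<Rightarrow> real" where
  "power_choose_coeff 0 k = (if k = 0 then 1 else 0)"
| "power_choose_coeff (Suc s) k = real k * (power_choose_coeff s k + (if k = 0 then 0 else power_choose_coeff s (k - 1)))"

lemma power_choose_coeff_eq_0: "s < k \<Longrightarrow> power_choose_coeff s k = 0"
  by (induction s arbitrary: k) auto

lemma power_choose_coeff_diag: "power_choose_coeff s s = fact s"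
  by (induction s) (auto simp: power_choose_coeff_eq_0)

lemma power_eq_sum_choose: "real x ^ s = (\<Sum>k\<le>s. power_choose_coeff s k * real (x choose k))"
proof (induction s)
  case (Suc s)
  let ?c = "power_choose_coeff"
  have ab: "real x * real (x choose k) = real (Suc k) * real (x choose Suc k) + real k * real (x choose k)" for k
  proof (cases "k \<le> x")
    case True
    have "Suc k * (x choose Suc k) = (x - k) * (x choose k)"
      using binomial_absorb_comp[of x k] binomial_absorption[of k x]
      by simp
    hence "real (Suc k) * real (x choose Suc k) = (real x - real k) * real (x choose k)"
      using True by (metis of_nat_mult of_nat_diff)
    thus ?thesis by (simp add: algebra_simps)
  qed (simp add: binomial_eq_0)
  have "real x ^ Suc s = (\<Sum>k\<le>s. ?c s k * (real x * real (x choose k)))"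
    by (simp add: Suc sum_distrib_left mult_ac)
  also have "\<dots> = (\<Sum>k\<le>s. ?c s k * (real (Suc k) * real (x choose Suc k))) + (\<Sum>k\<le>s. ?c s k * (real k * real (x choose k)))"
    unfolding ab by (simp add: algebra_simps sum.distrib)
  also have "(\<Sum>k\<le>s. ?c s k * (real (Suc k) * real (x choose Suc k))) =
      (\<Sum>k\<le>Suc s. (if k = 0 then 0 else ?c s (k - 1)) * (real k * real (x choose k)))"
    by (subst sum.atMost_Suc_shift) simp
  also have "(\<Sum>k\<le>s. ?c s k * (real k * real (x choose k))) = (\<Sum>k\<le>Suc s. ?c s k * (real k * real (x choose k)))"
    by (simp add: power_choose_coeff_eq_0)
  finally have "real x ^ Suc s = (\<Sum>k\<le>Suc s. (if k = 0 then 0 else ?c s (k - 1)) * (real k * real (x choose k)) +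
      ?c s k * (real k * real (x choose k)))"
    unfolding sum.distrib .
  also have "\<dots> = (\<Sum>k\<le>Suc s. ?c (Suc s) k * real (x choose k))"
    by (rule sum.cong[OF refl]) (simp add: distrib_left distrib_right mult_ac)
  finally show ?case .
qed simp

section \<open>Moments of the Mittag-Leffler law\<close>

text \<open>Log-convexity of Gamma at \<open>x + 1 = \<alpha> * (x + \<alpha>) + (1 - \<alpha>) * (x
  + \<alpha> + 1)\<close> gives a Gautschi-type bound: the quotient is at most of order
  \<open>x powr (- \<alpha>)\<close>.\<close>

lemma Gamma_ratio_tendsto_0:
  fixes \<alpha> :: real
  assumes "0 < \<alpha>" "\<alpha> < 1"
  shows "((\<lambda>x. Gamma x / Gamma (x + \<alpha>)) \<longlongrightarrow> 0) at_top"
proof (rule Lim_null_comparison)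
  show "\<forall>\<^sub>F x in at_top. norm (Gamma x / Gamma (x + \<alpha>)) \<le> (x + \<alpha>) powr (1 - \<alpha>) / x"
    using eventually_gt_at_top[of 0]
  proof eventually_elim
    case (elim x)
    have pos: "0 < Gamma x" "0 < Gamma (x + \<alpha>)" "0 < Gamma (x + 1)" "0 < Gamma (x + \<alpha> + 1)"
      using elim assms by (auto intro!: Gamma_real_pos)
    have "\<alpha> * (x + \<alpha>) + (1 - \<alpha>) * (x + \<alpha> + 1) = x + 1" by (simp add: algebra_simps)
    hence "ln (Gamma (x + 1)) \<le> \<alpha> * ln (Gamma (x + \<alpha>)) + (1 - \<alpha>) * ln (Gamma (x + \<alpha> + 1))"
      using convex_onD[OF log_convex_Gamma_real, of "1 - \<alpha>" "x + \<alpha>" "x + \<alpha> + 1"] elim assms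
      by simp
    also have "Gamma (x + \<alpha> + 1) = (x + \<alpha>) * Gamma (x + \<alpha>)"
    proof -
      have "x + \<alpha> \<notin> \<int>\<^sub>\<le>\<^sub>0" using elim assms by (auto elim!: nonpos_Ints_cases)
      thus ?thesis by (rule Gamma_plus1)
    qed
    also have "ln ((x + \<alpha>) * Gamma (x + \<alpha>)) = ln (x + \<alpha>) + ln (Gamma (x + \<alpha>))"
      using elim assms pos by (intro ln_mult_pos) auto
    finally have "ln (Gamma (x + 1)) \<le> ln (Gamma (x + \<alpha>)) + (1 - \<alpha>) * ln (x + \<alpha>)"
      by (simp add: algebra_simps)
    also have "\<dots> = ln (Gamma (x + \<alpha>) * (x + \<alpha>) powr (1 - \<alpha>))"
      using elim assms pos by (subst ln_mult_pos) (auto simp: ln_powr)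
    finally have "Gamma (x + 1) \<le> Gamma (x + \<alpha>) * (x + \<alpha>) powr (1 - \<alpha>)"
      using elim assms pos by (subst (asm) ln_le_cancel_iff) auto
    also have "Gamma (x + 1) = x * Gamma x"
      using elim by (intro Gamma_plus1) (auto elim!: nonpos_Ints_cases)
    finally show ?case using elim pos by (simp add: field_simps)
  qed
  show "((\<lambda>x. (x + \<alpha>) powr (1 - \<alpha>) / x) \<longlongrightarrow> 0) at_top"
    using assms by real_asymp
qed

text \<open>The moment of \<open>Y * B powr \<alpha>\<close> after cancellation of
  \<open>Gamma (\<alpha> * s + \<beta>)\<close> between the two factors. The first quotient is a
  rising factorial of \<open>\<beta> / \<alpha>\<close>, which for the scheme is
  \<open>- lam\<^sub>G\<close>; in this form it appears in the coefficient asymptotics.\<close>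

definition mittag_leffler_moment :: "real \<Rightarrow> real \<Rightarrow> real \<Rightarrow> nat \<Rightarrow> real" where
  "mittag_leffler_moment \<alpha> \<beta> \<gamma> s =
     Gamma (real s + \<beta> / \<alpha>) / Gamma (\<beta> / \<alpha>) * (Gamma (\<beta> + \<gamma>) / Gamma (\<alpha> * real s + \<beta> + \<gamma>))"

text \<open>Ratio test: consecutive terms have the quotient \<open>q s\<close>, which tends to 0
  because the quotient of Gamma values at distance \<alpha> does and the other factors stay
  bounded.\<close>

lemma summable_mittag_leffler_moment:
  assumes \<alpha>: "0 < \<alpha>" "\<alpha> < 1" and t: "0 \<le> t"
  shows "summable (\<lambda>s. t ^ s * mittag_leffler_moment \<alpha> \<beta> \<gamma> s / fact s)"
proof -
  define m where "m = mittag_leffler_moment \<alpha> \<beta> \<gamma>"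
  define q where "q s = t * ((real s + \<beta> / \<alpha>) / (real s + 1)) *
     (Gamma (\<alpha> * real s + \<beta> + \<gamma>) / Gamma (\<alpha> * real s + \<beta> + \<gamma> + \<alpha>))" for s
  have rec: "\<forall>\<^sub>F s in sequentially. m (Suc s) = m s * ((real s + \<beta> / \<alpha>) *
     (Gamma (\<alpha> * real s + \<beta> + \<gamma>) / Gamma (\<alpha> * real s + \<beta> + \<gamma> + \<alpha>)))"
  proof -
    have "\<forall>\<^sub>F s in sequentially. 0 < real s + \<beta> / \<alpha>" by real_asymp
    moreover have "\<forall>\<^sub>F s in sequentially. 0 < \<alpha> * real s + \<beta> + \<gamma>" using \<alpha> by real_asymp
    ultimately show ?thesis
    proof eventually_elim
      case (elim s)
      have "Gamma (real s + \<beta> / \<alpha> + 1) = (real s + \<beta> / \<alpha>) * Gamma (real s + \<beta> / \<alpha>)"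
        using elim by (intro Gamma_plus1) (auto elim!: nonpos_Ints_cases)
      moreover have "0 < Gamma (\<alpha> * real s + \<beta> + \<gamma>)" using elim by (intro Gamma_real_pos)
      moreover have "\<alpha> * real (Suc s) + \<beta> + \<gamma> = \<alpha> * real s + \<beta> + \<gamma> + \<alpha>"
        "real (Suc s) + \<beta> / \<alpha> = real s + \<beta> / \<alpha> + 1"
        by (auto simp: algebra_simps)
      ultimately show ?case unfolding m_def mittag_leffler_moment_def by (simp only:) (simp add: divide_simps)
    qed
  qed
  have lim: "q \<longlonglongrightarrow> t * 1 * 0"
  proof -
    have "(\<lambda>s. Gamma (\<alpha> * real s + \<beta> + \<gamma>) / Gamma (\<alpha> * real s + \<beta> + \<gamma> + \<alpha>)) \<longlonglongrightarrow> 0"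
      by (rule filterlim_compose[OF Gamma_ratio_tendsto_0[OF \<alpha>]]) (use \<alpha> in real_asymp)
    moreover have "(\<lambda>s. (real s + \<beta> / \<alpha>) / (real s + 1)) \<longlonglongrightarrow> 1" by real_asymp
    ultimately show ?thesis unfolding q_def by (intro tendsto_mult tendsto_const)
  qed
  have "\<forall>\<^sub>F s in sequentially. norm (q s) < 1 / 2"
    using tendstoD[OF lim, of "1/2"] by simp
  with rec have "\<forall>\<^sub>F s in sequentially. norm (t ^ Suc s * m (Suc s) / fact (Suc s)) \<le> 1 / 2 * norm (t ^ s * m s / fact s)"
  proof eventually_elim
    case (elim s)
    have "t ^ Suc s * m (Suc s) / fact (Suc s) = q s * (t ^ s * m s / fact s)"
      unfolding elim(1) q_def by (simp add: field_simps)
    hence "norm (t ^ Suc s * m (Suc s) / fact (Suc s)) = norm (q s) * norm (t ^ s * m s / fact s)"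
      by (simp only: norm_mult)
    also have "\<dots> \<le> 1 / 2 * norm (t ^ s * m s / fact s)"
      using elim(2) by (intro mult_right_mono) auto
    finally show ?case .
  qed
  then obtain N where "\<And>s. s \<ge> N \<Longrightarrow> norm (t ^ Suc s * m (Suc s) / fact (Suc s)) \<le> 1 / 2 * norm (t ^ s * m s / fact s)"
    by (auto simp: eventually_sequentially)
  hence "summable (\<lambda>s. t ^ s * m s / fact s)" by (intro summable_ratio_test[of "1/2" N]) auto
  thus ?thesis by (simp add: m_def)
qed

section \<open>Beta factors and the three-parameter law\<close>

lemma sets_beta_distribution [simp]: "sets (beta_distribution a b) = sets borel"
  by (simp add: beta_distribution_def)

text \<open>The degenerate case \<open>b = 0\<close> is included with possibly negative
  \<open>a\<close>, as required by the two-parameter law for negative \<beta>; the Gamma quotient is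
  then 1 off the poles.\<close>

lemma beta_distribution_moment:
  assumes ab: "b = 0 \<or> (0 < a \<and> 0 < b)" and t: "0 \<le> t" and nz: "a + t \<notin> \<int>\<^sub>\<le>\<^sub>0" "a \<notin> \<int>\<^sub>\<le>\<^sub>0"
  shows "(\<integral>\<^sup>+x. ennreal (x powr t) \<partial>beta_distribution a b) =
      ennreal (Gamma (a + t) * Gamma (a + b) / (Gamma a * Gamma (a + t + b)))"
    and "AE x in beta_distribution a b. 0 < x"
proof -
  have "(\<integral>\<^sup>+x. ennreal (x powr t) \<partial>beta_distribution a b) =
      ennreal (Gamma (a + t) * Gamma (a + b) / (Gamma a * Gamma (a + t + b)))
     \<and> (AE x in beta_distribution a b. 0 < x)"
  proof (cases "b = 0")
    case True
    have "AE x in return borel (1::real). 0 < x" by (subst AE_return) auto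
    moreover have "(\<integral>\<^sup>+x. ennreal (x powr t) \<partial>return borel (1::real)) = ennreal 1"
      by (subst nn_integral_return) auto
    moreover have eq: "beta_distribution a b = return borel 1" using True by (simp add: beta_distribution_def)
    moreover have "Gamma (a + t) * Gamma (a + b) / (Gamma a * Gamma (a + t + b)) = 1"
      using True nz by (simp add: Gamma_eq_zero_iff)
    ultimately show ?thesis unfolding eq by metis
  next
    case False
    hence pos: "0 < a" "0 < b" using ab by auto
    have B: "0 < Beta a b" using pos by (simp add: Beta_def Gamma_real_pos)
    define d where "d x = indicator {0<..<1} x * (x powr (a - 1) * (1 - x) powr (b - 1) / Beta a b)" for x :: real
    have [measurable]: "d \<in> borel_measurable borel" unfolding d_def by measurable
    have dist: "beta_distribution a b = density lborel (\<lambda>x. ennreal (d x))"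
      using False by (simp add: beta_distribution_def d_def)
    have "(\<integral>\<^sup>+x. ennreal (x powr t) \<partial>beta_distribution a b) = (\<integral>\<^sup>+x. ennreal (d x) * ennreal (x powr t) \<partial>lborel)"
      unfolding dist by (rule nn_integral_density) measurable
    also have "\<dots> = (\<integral>\<^sup>+x. ennreal (d x * x powr t) \<partial>lborel)"
      by (simp add: ennreal_mult'')
    also have "\<dots> = ennreal (Beta (a + t) b / Beta a b)"
    proof (rule nn_integral_has_integral_lborel)
      show "0 \<le> d x * x powr t" for x using B by (auto simp: d_def indicator_def)
      have "((\<lambda>x. x powr (a + t - 1) * (1 - x) powr (b - 1) / Beta a b) has_integral (Beta (a + t) b / Beta a b)) {0<..<1}"
        using has_integral_Beta_real[of "a + t" b] pos t
        by (intro has_integral_divide) (simp add: has_integral_Icc_iff_Ioo)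
      also have "?this \<longleftrightarrow> ((\<lambda>x. d x * x powr t) has_integral (Beta (a + t) b / Beta a b)) {0<..<1}"
      proof (rule has_integral_cong)
        fix x :: real assume x: "x \<in> {0<..<1}"
        have "x powr (a + t - 1) = x powr (a - 1) * x powr t"
          by (simp add: powr_add[symmetric] algebra_simps)
        thus "x powr (a + t - 1) * (1 - x) powr (b - 1) / Beta a b = d x * x powr t"
          using x by (simp add: d_def mult_ac)
      qed
      also have "\<dots> \<longleftrightarrow> ((\<lambda>x. if x \<in> {0<..<1} then d x * x powr t else 0) has_integral (Beta (a + t) b / Beta a b)) UNIV"
        by (rule has_integral_restrict_UNIV[symmetric])
      also have "(\<lambda>x. if x \<in> {0<..<1} then d x * x powr t else 0) = (\<lambda>x. d x * x powr t)"
        by (auto simp: d_def)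
      finally show "((\<lambda>x. d x * x powr t) has_integral (Beta (a + t) b / Beta a b)) UNIV" .
    qed measurable
    also have "Beta (a + t) b / Beta a b = Gamma (a + t) * Gamma (a + b) / (Gamma a * Gamma (a + t + b))"
    proof -
      have "Gamma b \<noteq> 0" using Gamma_real_pos[OF pos(2)] by linarith
      thus ?thesis by (simp add: Beta_def add_ac)
    qed
    finally have I: "(\<integral>\<^sup>+x. ennreal (x powr t) \<partial>beta_distribution a b) =
      ennreal (Gamma (a + t) * Gamma (a + b) / (Gamma a * Gamma (a + t + b)))" .
    have "AE x in lborel. 0 < ennreal (d x) \<longrightarrow> 0 < x"
      by (rule AE_I2) (auto simp: d_def indicator_def split: if_splits)
    hence "AE x in beta_distribution a b. 0 < x" unfolding dist by (subst AE_density) auto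
    with I show ?thesis by blast
  qed
  thus "(\<integral>\<^sup>+x. ennreal (x powr t) \<partial>beta_distribution a b) =
      ennreal (Gamma (a + t) * Gamma (a + b) / (Gamma a * Gamma (a + t + b)))"
    "AE x in beta_distribution a b. 0 < x" by auto
qed

lemma prob_space_beta_distribution:
  assumes "b = 0 \<or> (0 < a \<and> 0 < b)" "a \<notin> \<int>\<^sub>\<le>\<^sub>0"
  shows "prob_space (beta_distribution a b)"
proof (cases "b = 0")
  case True
  thus ?thesis by (simp add: beta_distribution_def prob_space_return)
next
  case False
  hence pos: "0 < a" "0 < b" using assms by auto
  have "emeasure (beta_distribution a b) (space (beta_distribution a b)) = (\<integral>\<^sup>+x. 1 \<partial>beta_distribution a b)"
    by simp
  \<comment> \<open>\<open>x powr 0\<close> is 1 only for nonzero \<open>x\<close>, so the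
    integrands agree almost everywhere.\<close>
  also have "\<dots> = (\<integral>\<^sup>+x. ennreal (x powr 0) \<partial>beta_distribution a b)"
    using beta_distribution_moment(2)[of b a 0] assms
    by (intro nn_integral_cong_AE) (auto elim: eventually_mono)
  also have "\<dots> = 1"
    using beta_distribution_moment(1)[of b a 0] assms pos
      Gamma_real_pos[of a, THEN less_imp_neq] Gamma_real_pos[of "a + b", THEN less_imp_neq] by simp
  finally show ?thesis by (rule prob_spaceI)
qed

text \<open>By independence the moments of \<open>Y\<close> and of \<open>B powr \<alpha>\<close>
  multiply. The hypothesis lists the two parameter ranges that purity produces: negative \<beta>
  comes with \<gamma> = 0, where the beta factor is constant.\<close>

lemma mittag_leffler3_moments:
  assumes \<alpha>: "0 < \<alpha>" "\<alpha> < 1" and bg: "(0 < \<beta> \<and> 0 \<le> \<gamma>) \<or> (-\<alpha> < \<beta> \<and> \<beta> < 0 \<and> \<gamma> = 0)"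
    and L: "mittag_leffler3 \<alpha> \<beta> \<gamma> L"
  shows "real_distribution L" and "AE x in L. 0 < x"
    and "has_bochner_integral L (\<lambda>x. x ^ s) (mittag_leffler_moment \<alpha> \<beta> \<gamma> s)"
proof -
  from L obtain L' where L': "mittag_leffler \<alpha> \<beta> L'"
    and Ldef: "L = distr (L' \<Otimes>\<^sub>M beta_distribution \<beta> \<gamma>) borel (\<lambda>(y, b). y * b powr \<alpha>)"
    unfolding mittag_leffler3_def by blast
  let ?B = "beta_distribution \<beta> \<gamma>"
  have notint: "\<beta> \<notin> \<int>\<^sub>\<le>\<^sub>0" using bg \<alpha> by (intro not_nonpos_Int_gt_minus_1) auto
  have \<beta>s: "\<beta> + \<alpha> * real s \<notin> \<int>\<^sub>\<le>\<^sub>0" for s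
  proof (cases s)
    case (Suc k)
    have "\<alpha> \<le> \<alpha> * real s" using \<alpha> Suc by simp
    hence "0 < \<beta> + \<alpha> * real s" using bg \<alpha> by linarith
    thus ?thesis by (auto elim!: nonpos_Ints_cases)
  qed (use notint in auto)
  have ab: "\<gamma> = 0 \<or> (0 < \<beta> \<and> 0 < \<gamma>)" using bg by auto
  interpret L': real_distribution L' using L' by (simp add: mittag_leffler_def)
  interpret B: prob_space ?B by (rule prob_space_beta_distribution[OF ab notint])
  interpret P: pair_prob_space L' ?B ..
  note [measurable_cong] = sets_beta_distribution
  have meas [measurable]: "(\<lambda>(y, b). y * b powr \<alpha>) \<in> borel_measurable (L' \<Otimes>\<^sub>M ?B)" by measurable
  show rdL: "real_distribution L" unfolding Ldef by (rule P.real_distribution_distr) (rule meas)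
  have L'pos: "AE y in L'. 0 < y" using L' by (simp add: mittag_leffler_def)
  have Bpos: "AE b in ?B. 0 < b" by (rule beta_distribution_moment(2)[OF ab, of 0]) (use notint in auto)
  have "AE x in L' \<Otimes>\<^sub>M ?B. 0 < fst x \<and> 0 < snd x"
  proof (rule P.AE_pair_measure)
    show "AE x in L'. AE y in ?B. 0 < fst (x, y) \<and> 0 < snd (x, y)"
      using L'pos by eventually_elim (use Bpos in auto)
  qed measurable
  hence "AE x in L' \<Otimes>\<^sub>M ?B. 0 < (\<lambda>(y, b). y * b powr \<alpha>) x"
    by eventually_elim (auto simp: split_beta)
  thus AEL: "AE x in L. 0 < x" unfolding Ldef by (subst AE_distr_iff) auto
  define mY where "mY s = (Gamma (real s + \<beta> / \<alpha> + 1) * Gamma (\<beta> + 1))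
         / (Gamma (\<alpha> * real s + \<beta> + 1) * Gamma (\<beta> / \<alpha> + 1))" for s :: nat
  define mB where "mB s = Gamma (\<beta> + \<alpha> * real s) * Gamma (\<beta> + \<gamma>) / (Gamma \<beta> * Gamma (\<beta> + \<alpha> * real s + \<gamma>))" for s :: nat
  have mY: "has_bochner_integral L' (\<lambda>y. y ^ s) (mY s)"
    using L' by (simp add: mittag_leffler_def mY_def)
  have mY0: "0 \<le> mY s"
  proof -
    have "mY s = (\<integral>x. x ^ s \<partial>L')" using mY by (simp add: has_bochner_integral_iff)
    also have "\<dots> \<ge> 0" using L'pos by (intro integral_nonneg_AE) (auto elim: eventually_mono)
    finally show ?thesis .
  qed
  have mYnn: "(\<integral>\<^sup>+y. ennreal (y ^ s) \<partial>L') = ennreal (mY s)"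
    using mY L'pos by (subst nn_integral_eq_integral) (auto simp: has_bochner_integral_iff elim!: eventually_mono)
  have mBnn: "(\<integral>\<^sup>+b. ennreal ((b powr \<alpha>) ^ s) \<partial>?B) = ennreal (mB s)"
  proof -
    have "(\<integral>\<^sup>+b. ennreal ((b powr \<alpha>) ^ s) \<partial>?B) = (\<integral>\<^sup>+b. ennreal (b powr (\<alpha> * real s)) \<partial>?B)"
      by (rule nn_integral_cong_AE) (use Bpos in eventually_elim, simp add: powr_power mult.commute)
    also have "\<dots> = ennreal (mB s)"
      unfolding mB_def by (rule beta_distribution_moment(1)[OF ab]) (use \<alpha> \<beta>s notint in auto)
    finally show ?thesis .
  qed
  have mB0: "0 \<le> mB s"
  proof (cases "\<gamma> = 0")
    case True
    thus ?thesis using \<beta>s[of s] notint by (simp add: mB_def Gamma_eq_zero_iff)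
  next
    case False
    hence "0 < \<beta>" "0 < \<gamma>" using ab by auto
    moreover have "0 \<le> \<alpha> * real s" using \<alpha> by simp
    ultimately show ?thesis unfolding mB_def
      by (intro divide_nonneg_nonneg mult_nonneg_nonneg less_imp_le Gamma_real_pos) auto
  qed
  have "(\<integral>\<^sup>+x. ennreal (x ^ s) \<partial>L) = (\<integral>\<^sup>+x. ennreal (((\<lambda>(y, b). y * b powr \<alpha>) x) ^ s) \<partial>(L' \<Otimes>\<^sub>M ?B))"
    unfolding Ldef by (rule nn_integral_distr) auto
  also have "\<dots> = (\<integral>\<^sup>+y. \<integral>\<^sup>+b. ennreal ((y * b powr \<alpha>) ^ s) \<partial>?B \<partial>L')"
    by (subst B.nn_integral_fst[symmetric]) (auto simp: split_beta)
  also have "\<dots> = (\<integral>\<^sup>+y. ennreal (y ^ s) * ennreal (mB s) \<partial>L')"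
    by (simp add: power_mult_distrib ennreal_mult'' nn_integral_cmult mBnn)
  also have "\<dots> = ennreal (mY s) * ennreal (mB s)"
    by (subst nn_integral_multc) (auto simp: mYnn)
  also have "\<dots> = ennreal (mY s * mB s)" using mY0 mB0 by (simp add: ennreal_mult)
  also have "mY s * mB s = mittag_leffler_moment \<alpha> \<beta> \<gamma> s"
  proof -
    have r: "-1 < \<beta> / \<alpha>" "\<beta> / \<alpha> \<noteq> 0" using bg \<alpha> by (auto simp: field_simps)
    have nn1: "real s + \<beta> / \<alpha> \<notin> \<int>\<^sub>\<le>\<^sub>0" for s
    proof (rule not_nonpos_Int_gt_minus_1)
      show "-1 < real s + \<beta> / \<alpha>" using r by linarith
      show "real s + \<beta> / \<alpha> \<noteq> 0"
      proof
        assume "real s + \<beta> / \<alpha> = 0"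
        hence "real s < 1" using r(1) by linarith
        hence "s = 0" by simp
        thus False using r(2) \<open>real s + \<beta> / \<alpha> = 0\<close> by simp
      qed
    qed
    have e1: "Gamma (real s + \<beta> / \<alpha> + 1) = (real s + \<beta> / \<alpha>) * Gamma (real s + \<beta> / \<alpha>)"
      by (rule Gamma_plus1[OF nn1])
    have e2: "Gamma (\<beta> / \<alpha> + 1) = (\<beta> / \<alpha>) * Gamma (\<beta> / \<alpha>)"
      using Gamma_plus1[OF nn1[of 0]] by simp
    have e3: "Gamma (\<beta> + 1) = \<beta> * Gamma \<beta>" by (rule Gamma_plus1[OF notint])
    have e4: "Gamma (\<alpha> * real s + \<beta> + 1) = (\<alpha> * real s + \<beta>) * Gamma (\<alpha> * real s + \<beta>)"
      using Gamma_plus1[OF \<beta>s[of s]] by (simp add: add_ac)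
    have nz: "\<alpha> * real s + \<beta> \<noteq> 0" "\<beta> \<noteq> 0" using \<beta>s[of s] notint by (auto simp: add_ac)
    have nzG: "Gamma (\<alpha> * real s + \<beta>) \<noteq> 0" "Gamma \<beta> \<noteq> 0"
      using \<beta>s[of s] notint by (auto simp: Gamma_eq_zero_iff add_ac)
    \<comment> \<open>Removing the shifts by 1 in the four Gamma arguments leaves exactly this
      factor.\<close>
    have frac: "(real s + \<beta> / \<alpha>) * \<beta> / ((\<alpha> * real s + \<beta>) * (\<beta> / \<alpha>)) = 1"
    proof -
      have "real s + \<beta> / \<alpha> = (\<alpha> * real s + \<beta>) / \<alpha>" using \<alpha> by (simp add: field_simps)
      thus ?thesis using nz \<alpha> by simp
    qed
    have "mY s * mB s = ((real s + \<beta> / \<alpha>) * \<beta> / ((\<alpha> * real s + \<beta>) * (\<beta> / \<alpha>))) *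
       (Gamma (real s + \<beta> / \<alpha>) / Gamma (\<beta> / \<alpha>) * (Gamma \<beta> / Gamma (\<alpha> * real s + \<beta>))) *
       (Gamma (\<beta> + \<alpha> * real s) / Gamma \<beta> * (Gamma (\<beta> + \<gamma>) / Gamma (\<beta> + \<alpha> * real s + \<gamma>)))"
      unfolding mY_def mB_def e1 e2 e3 e4 by (simp only: times_divide_times_eq mult_ac)
    also have "\<dots> = mittag_leffler_moment \<alpha> \<beta> \<gamma> s"
      unfolding frac mittag_leffler_moment_def using nzG by (simp add: add_ac)
    finally show ?thesis .
  qed
  finally have "(\<integral>\<^sup>+x. ennreal (x ^ s) \<partial>L) = ennreal (mittag_leffler_moment \<alpha> \<beta> \<gamma> s)" .
  moreover have "mittag_leffler_moment \<alpha> \<beta> \<gamma> s \<ge> 0"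
    using mY0 mB0 \<open>mY s * mB s = mittag_leffler_moment \<alpha> \<beta> \<gamma> s\<close> by (metis mult_nonneg_nonneg)
  moreover have "(\<lambda>x. x ^ s) \<in> borel_measurable L"
    by (rule borel_measurable_power) (simp add: Ldef)
  moreover have "AE x in L. 0 \<le> x ^ s" using AEL by eventually_elim simp
  ultimately show "has_bochner_integral L (\<lambda>x. x ^ s) (mittag_leffler_moment \<alpha> \<beta> \<gamma> s)"
    by (intro has_bochner_integral_nn_integral)
qed

section \<open>Limit laws from factorial moments\<close>

lemma real_distribution_real_law: "real_distribution (real_law p)"
  unfolding real_law_def by (rule prob_space.real_distribution_distr[OF measure_pmf.prob_space_axioms]) simp

lemma real_distribution_scaled_law: "real_distribution (scaled_law p a)"
  unfolding scaled_law_def by (rule prob_space.real_distribution_distr[OF measure_pmf.prob_space_axioms]) simp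

lemma finite_pmf_power_moment:
  assumes "finite (set_pmf p)"
  shows "measure_pmf.expectation p (\<lambda>k. real k ^ s) =
     (\<Sum>k\<le>s. power_choose_coeff s k * measure_pmf.expectation p (\<lambda>x. real (x choose k)))"
  unfolding power_eq_sum_choose using assms
  by (subst Bochner_Integration.integral_sum) (auto intro!: integrable_measure_pmf_finite)

text \<open>A power moment is a combination of factorial moments of orders up to \<open>s\<close>.
  After division by \<open>\<xi> ^ s\<close> those of lower order vanish, because \<xi> tends to
  infinity, and order \<open>s\<close> alone remains.\<close>

lemma weak_conv_scaled_law:
  fixes p :: "nat \<Rightarrow> nat pmf" and \<xi> :: "nat \<Rightarrow> real"
  assumes fin: "\<forall>\<^sub>F n in sequentially. finite (set_pmf (p n))"
    and \<xi>: "filterlim \<xi> at_top sequentially"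
    and mom: "\<And>s. (\<lambda>n. fact s * measure_pmf.expectation (p n) (\<lambda>k. real (k choose s)) / \<xi> n ^ s) \<longlonglongrightarrow> (\<integral>x. x ^ s \<partial>L)"
    and L: "real_distribution L" "AE x in L. 0 \<le> x" "\<And>t. integrable L (\<lambda>x. exp (t * x))"
  shows "weak_conv_m (\<lambda>n. scaled_law (p n) (\<xi> n)) L \<and> moments_converge (\<lambda>n. scaled_law (p n) (\<xi> n)) L"
proof -
  interpret L: real_distribution L by fact
  note ex = exp_integrable_moments[OF L.prob_space_axioms L.events_eq_borel L(2,3)]
  have mc: "moments_converge (\<lambda>n. scaled_law (p n) (\<xi> n)) L"
    unfolding moments_converge_def
  proof (intro allI impI conjI)
    fix s :: nat
    show "\<forall>\<^sub>F n in sequentially. integrable (scaled_law (p n) (\<xi> n)) (\<lambda>x. x ^ s)"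
      using fin by eventually_elim (auto simp: scaled_law_def integrable_distr_eq intro!: integrable_measure_pmf_finite)
    show "integrable L (\<lambda>x. x ^ s)" by (rule ex(1))
    define c where "c k n = measure_pmf.expectation (p n) (\<lambda>x. real (x choose k))" for k n
    have pos: "\<forall>\<^sub>F n in sequentially. 0 < \<xi> n" using \<xi> by (simp add: filterlim_at_top_dense)
    have inv: "(\<lambda>n. inverse (\<xi> n)) \<longlonglongrightarrow> 0" using \<xi> by (rule tendsto_inverse_0_at_top)
    have "(\<lambda>n. \<Sum>k\<le>s. power_choose_coeff s k / fact k * ((fact k * c k n / \<xi> n ^ k) * inverse (\<xi> n) ^ (s - k)))
       \<longlonglongrightarrow> (\<Sum>k\<le>s. power_choose_coeff s k / fact k * ((\<integral>x. x ^ k \<partial>L) * 0 ^ (s - k)))"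
      unfolding c_def by (intro tendsto_sum tendsto_mult tendsto_const mom tendsto_power inv)
    also have "(\<Sum>k\<le>s. power_choose_coeff s k / fact k * ((\<integral>x. x ^ k \<partial>L) * 0 ^ (s - k))) = (\<integral>x. x ^ s \<partial>L)"
    proof -
      have "(\<Sum>k\<le>s. power_choose_coeff s k / fact k * ((\<integral>x. x ^ k \<partial>L) * 0 ^ (s - k))) =
         (\<Sum>k\<in>{s}. power_choose_coeff s k / fact k * ((\<integral>x. x ^ k \<partial>L) * 0 ^ (s - k)))"
        by (rule sum.mono_neutral_right) auto
      thus ?thesis by (simp add: power_choose_coeff_diag)
    qed
    finally show "(\<lambda>n. \<integral>x. x ^ s \<partial>scaled_law (p n) (\<xi> n)) \<longlonglongrightarrow> (\<integral>x. x ^ s \<partial>L)"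
    proof (rule Lim_transform_eventually)
      show "\<forall>\<^sub>F n in sequentially. (\<Sum>k\<le>s. power_choose_coeff s k / fact k * ((fact k * c k n / \<xi> n ^ k) * inverse (\<xi> n) ^ (s - k))) =
         (\<integral>x. x ^ s \<partial>scaled_law (p n) (\<xi> n))"
        using fin pos
      proof eventually_elim
        case (elim n)
        have "(\<integral>x. x ^ s \<partial>scaled_law (p n) (\<xi> n)) = measure_pmf.expectation (p n) (\<lambda>k. real k ^ s) / \<xi> n ^ s"
          by (simp add: scaled_law_def integral_distr power_divide)
        also have "\<dots> = (\<Sum>k\<le>s. power_choose_coeff s k * c k n / \<xi> n ^ s)"
          unfolding finite_pmf_power_moment[OF elim(1)] c_def by (simp add: sum_divide_distrib)
        also have "\<dots> = (\<Sum>k\<le>s. power_choose_coeff s k / fact k * ((fact k * c k n / \<xi> n ^ k) * inverse (\<xi> n) ^ (s - k)))"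
        proof (rule sum.cong[OF refl])
          fix k assume "k \<in> {..s}"
          hence "\<xi> n ^ s = \<xi> n ^ k * \<xi> n ^ (s - k)" by (simp add: power_add[symmetric])
          thus "power_choose_coeff s k * c k n / \<xi> n ^ s =
             power_choose_coeff s k / fact k * ((fact k * c k n / \<xi> n ^ k) * inverse (\<xi> n) ^ (s - k))"
            by (simp add: divide_inverse power_inverse mult_ac)
        qed
        finally show ?case by simp
      qed
    qed
  qed
  moreover have "weak_conv_m (\<lambda>n. scaled_law (p n) (\<xi> n)) L"
    using real_distribution_scaled_law L(1) mc ex(2) by (rule weak_conv_of_moments)
  ultimately show ?thesis by simp
qed

text \<open>The factorial moments of the mixed Poisson law are \<open>\<xi> ^ s\<close> times the
  moments of \<open>L\<close>, and power moments are the same combinations of factorial moments on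
  both sides.\<close>

lemma weak_conv_real_law_mixed_poisson:
  fixes p :: "nat \<Rightarrow> nat pmf"
  assumes fin: "\<forall>\<^sub>F n in sequentially. finite (set_pmf (p n))"
    and \<xi>: "0 \<le> \<xi>"
    and mom: "\<And>s. (\<lambda>n. fact s * measure_pmf.expectation (p n) (\<lambda>k. real (k choose s))) \<longlonglongrightarrow> \<xi> ^ s * (\<integral>x. x ^ s \<partial>L)"
    and L: "real_distribution L" "AE x in L. 0 \<le> x" "\<And>t. integrable L (\<lambda>x. exp (t * x))"
  shows "weak_conv_m (\<lambda>n. real_law (p n)) (real_law (mixed_poisson_pmf \<xi> L))
     \<and> moments_converge (\<lambda>n. real_law (p n)) (real_law (mixed_poisson_pmf \<xi> L))"
proof -
  interpret L: real_distribution L by fact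
  let ?q = "mixed_poisson_pmf \<xi> L"
  interpret Q: real_distribution "real_law ?q" by (rule real_distribution_real_law)
  note bm = mixed_poisson_binomial_moment[OF L.prob_space_axioms L.events_eq_borel L(2,3) \<xi>]
  have exQ: "integrable (real_law ?q) (\<lambda>x. exp (t * x))" for t
    using mixed_poisson_exp_integrable[OF L.prob_space_axioms L.events_eq_borel L(2,3) \<xi>]
    by (simp add: real_law_def integrable_distr_eq)
  have nnQ: "AE x in real_law ?q. 0 \<le> x" unfolding real_law_def by (subst AE_distr_iff) auto
  note ex = exp_integrable_moments[OF Q.prob_space_axioms Q.events_eq_borel nnQ exQ]
  have mc: "moments_converge (\<lambda>n. real_law (p n)) (real_law ?q)"
    unfolding moments_converge_def
  proof (intro allI impI conjI)
    fix s :: nat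
    show "\<forall>\<^sub>F n in sequentially. integrable (real_law (p n)) (\<lambda>x. x ^ s)"
      using fin by eventually_elim (auto simp: real_law_def integrable_distr_eq intro!: integrable_measure_pmf_finite)
    show "integrable (real_law ?q) (\<lambda>x. x ^ s)" by (rule ex(1))
    define c where "c k n = measure_pmf.expectation (p n) (\<lambda>x. real (x choose k))" for k n
    have "(\<lambda>n. \<Sum>k\<le>s. power_choose_coeff s k / fact k * (fact k * c k n))
       \<longlonglongrightarrow> (\<Sum>k\<le>s. power_choose_coeff s k / fact k * (\<xi> ^ k * (\<integral>x. x ^ k \<partial>L)))"
      unfolding c_def by (intro tendsto_sum tendsto_mult tendsto_const mom)
    also have "(\<Sum>k\<le>s. power_choose_coeff s k / fact k * (\<xi> ^ k * (\<integral>x. x ^ k \<partial>L))) =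
        (\<Sum>k\<le>s. power_choose_coeff s k * measure_pmf.expectation ?q (\<lambda>x. real (x choose k)))"
      using bm by (simp add: has_bochner_integral_iff)
    also have "\<dots> = measure_pmf.expectation ?q (\<lambda>k. real k ^ s)"
      unfolding power_eq_sum_choose using bm by (subst Bochner_Integration.integral_sum) (auto simp: has_bochner_integral_iff)
    also have "\<dots> = (\<integral>x. x ^ s \<partial>real_law ?q)"
      by (simp add: real_law_def integral_distr)
    finally show "(\<lambda>n. \<integral>x. x ^ s \<partial>real_law (p n)) \<longlonglongrightarrow> (\<integral>x. x ^ s \<partial>real_law ?q)"
    proof (rule Lim_transform_eventually)
      show "\<forall>\<^sub>F n in sequentially. (\<Sum>k\<le>s. power_choose_coeff s k / fact k * (fact k * c k n)) =
         (\<integral>x. x ^ s \<partial>real_law (p n))"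
        using fin by eventually_elim (simp add: real_law_def integral_distr finite_pmf_power_moment c_def)
    qed
  qed
  moreover have "weak_conv_m (\<lambda>n. real_law (p n)) (real_law ?q)"
    using real_distribution_real_law real_distribution_real_law mc ex(2) by (rule weak_conv_of_moments)
  ultimately show ?thesis by simp
qed

text \<open>For laws on the nonnegative integers a vanishing mean suffices: it bounds the distance
  of the characteristic function from 1 at each \<open>t\<close>.\<close>

lemma weak_conv_real_law_0:
  fixes p :: "nat \<Rightarrow> nat pmf"
  assumes fin: "\<forall>\<^sub>F n in sequentially. finite (set_pmf (p n))"
    and mom: "(\<lambda>n. measure_pmf.expectation (p n) real) \<longlonglongrightarrow> 0"
  shows "weak_conv_m (\<lambda>n. real_law (p n)) (return borel 0)"
proof (rule levy_continuity[OF real_distribution_real_law])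
  show "real_distribution (return borel (0::real))"
    by (auto simp: real_distribution_def real_distribution_axioms_def prob_space_return)
  fix t :: real
  have c0: "char (return borel 0) t = 1" by (simp add: char_def integral_return)
  have "(\<lambda>n. char (real_law (p n)) t - 1) \<longlonglongrightarrow> 0"
  proof (rule Lim_null_comparison)
    show "\<forall>\<^sub>F n in sequentially. norm (char (real_law (p n)) t - 1) \<le> 3 * \<bar>t\<bar> * measure_pmf.expectation (p n) real"
      using fin
    proof eventually_elim
      case (elim n)
      interpret real_distribution "real_law (p n)" by (rule real_distribution_real_law)
      let ?m = "measure_pmf.expectation (p n) real"
      have int: "integrable (real_law (p n)) (\<lambda>x. x ^ k)" for k
        using elim by (auto simp: real_law_def integrable_distr_eq intro!: integrable_measure_pmf_finite)
      have m: "expectation (\<lambda>x. x) = ?m" "expectation (\<lambda>x. \<bar>x\<bar>) = ?m"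
        by (simp_all add: real_law_def integral_distr)
      \<comment> \<open>The remainder at order 1 gives the factor 2, and the linear term adds 1 to
        make the constant 3.\<close>
      have "cmod (char (real_law (p n)) t - (\<Sum>k\<le>1. (\<i> * t) ^ k / fact k * expectation (\<lambda>x. x ^ k)))
          \<le> 2 * \<bar>t\<bar> ^ 1 / fact 1 * expectation (\<lambda>x. \<bar>x\<bar> ^ 1)"
        by (rule char_approx1) (rule int)
      hence "cmod (char (real_law (p n)) t - (1 + \<i> * t * ?m)) \<le> 2 * \<bar>t\<bar> * ?m"
        using prob_space by (simp add: m)
      moreover have "cmod (\<i> * t * ?m) = \<bar>t\<bar> * ?m"
        by (simp add: norm_mult)
      moreover have "char (real_law (p n)) t - 1 = (char (real_law (p n)) t - (1 + \<i> * t * ?m)) + \<i> * t * ?m"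
        by simp
      hence "cmod (char (real_law (p n)) t - 1) \<le> cmod (char (real_law (p n)) t - (1 + \<i> * t * ?m)) + cmod (\<i> * t * ?m)"
        using norm_triangle_ineq by metis
      ultimately show ?case by linarith
    qed
    show "(\<lambda>n. 3 * \<bar>t\<bar> * measure_pmf.expectation (p n) real) \<longlonglongrightarrow> 0"
      using tendsto_mult_left[OF mom, of "3 * \<bar>t\<bar>"] by simp
  qed
  thus "(\<lambda>n. char (real_law (p n)) t) \<longlonglongrightarrow> char (return borel 0) t"
    unfolding c0 by (simp add: LIM_zero_iff)
qed

section \<open>Limit laws of the component count\<close>

text \<open>The factorial moment is, up to a power of \<open>h_j\<close>, the quotient of the
  coefficient of \<open>k s\<close> at \<open>n - j * s\<close> by that of \<open>k 0\<close> at
  \<open>n\<close>. Both have known asymptotics, \<open>A\<close> cancels, and the two indices are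
  asymptotically equal because \<open>j\<close> is small against \<open>n\<close>. The remaining
  powers of \<open>\<rho>\<^sub>H\<close>, \<open>n\<close> and \<open>- c\<^sub>H\<close> are those
  in \<open>\<xi> ^ s\<close>.\<close>

lemma composition_scheme_moments_converge:
  fixes G H M :: "real fps" and lam\<^sub>M :: ereal and j :: "nat \<Rightarrow> nat" and \<xi> :: "nat \<Rightarrow> real"
  assumes scheme: "composition_scheme G H M \<rho>\<^sub>G lam\<^sub>G c\<^sub>G \<rho>\<^sub>H lam\<^sub>H c\<^sub>H lam\<^sub>M"
    and crit: "critical H M \<rho>\<^sub>G \<rho>\<^sub>H"
    and lamH: "0 < lam\<^sub>H" "lam\<^sub>H < 1"
    and pur: "pure lam\<^sub>G lam\<^sub>H lam\<^sub>M"
    and j_pos: "\<And>n. 1 \<le> j n"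
    and h_pos: "\<And>n. 0 < fps_nth H (j n)"
    and xi: "\<And>n. \<xi> n = \<rho>\<^sub>H ^ j n / (- c\<^sub>H) * fps_nth H (j n) * real n powr lam\<^sub>H"
    and small: "(\<lambda>n. real (j n) / real n) \<longlonglongrightarrow> 0"
  shows "(\<lambda>n. fact s * measure_pmf.expectation (component_count_pmf G H M n (j n)) (\<lambda>k. real (k choose s)) / \<xi> n ^ s)
     \<longlonglongrightarrow> mittag_leffler_moment lam\<^sub>H (- lam\<^sub>G * lam\<^sub>H) (real_of_ereal (- min 0 lam\<^sub>M)) s"
proof -
  interpret composition_scheme G H M \<rho>\<^sub>G lam\<^sub>G c\<^sub>G \<rho>\<^sub>H lam\<^sub>H c\<^sub>H lam\<^sub>M by fact
  define b where "b = - lam\<^sub>G * lam\<^sub>H + real_of_ereal (- min 0 lam\<^sub>M)"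
  note asy = composition_coeff_asymptotics[OF scheme crit lamH pur, folded b_def]
  note cH = asy(2) and \<rho> = asy(4)
  define k where "k s = fps_compose ((fps_deriv ^^ s) G) H * M" for s
  define T where "T s n = fps_nth (k s) n * \<rho>\<^sub>H ^ n * real n powr (1 - (lam\<^sub>H * real s + b))" for s n
  obtain A where A: "A \<noteq> 0" and T: "\<And>s. T s \<longlonglongrightarrow> A * pochhammer (- lam\<^sub>G) s / (- c\<^sub>H) ^ s / Gamma (lam\<^sub>H * real s + b)"
    using asy(7) unfolding T_def[abs_def] k_def by blast
  define L where "L s = A * pochhammer (- lam\<^sub>G) s / (- c\<^sub>H) ^ s / Gamma (lam\<^sub>H * real s + b)" for s :: nat
  have nlG: "- lam\<^sub>G \<notin> \<int>\<^sub>\<le>\<^sub>0"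
    using pur by (intro not_nonpos_Int_gt_minus_1) (auto simp: pure_def)
  have Gb: "Gamma b \<noteq> 0" using asy(6) by (simp add: Gamma_eq_zero_iff)
  have L0: "L 0 \<noteq> 0" using A Gb by (simp add: L_def)
  have k0: "\<forall>\<^sub>F n in sequentially. T 0 n \<noteq> 0"
    using T[of 0] L0 unfolding L_def by (rule tendsto_imp_eventually_ne)
  \<comment> \<open>The quotient of limits is already the moment formula, with
    \<open>\<beta> / \<alpha> = - lam\<^sub>G\<close> and
    \<open>\<beta> + \<gamma> = b\<close>.\<close>
  have ml: "L s / L 0 * (- c\<^sub>H) ^ s = mittag_leffler_moment lam\<^sub>H (- lam\<^sub>G * lam\<^sub>H) (real_of_ereal (- min 0 lam\<^sub>M)) s"
  proof -
    have p1: "Gamma (real s + (- lam\<^sub>G)) / Gamma (- lam\<^sub>G) = pochhammer (- lam\<^sub>G) s"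
      using pochhammer_Gamma[OF nlG, of s] by (simp add: add.commute)
    have p2: "- lam\<^sub>G * lam\<^sub>H / lam\<^sub>H = - lam\<^sub>G" using lamH by simp
    have p3: "lam\<^sub>H * real s + (- lam\<^sub>G * lam\<^sub>H) + real_of_ereal (- min 0 lam\<^sub>M) = lam\<^sub>H * real s + b"
      by (simp add: b_def)
    have "mittag_leffler_moment lam\<^sub>H (- lam\<^sub>G * lam\<^sub>H) (real_of_ereal (- min 0 lam\<^sub>M)) s =
        pochhammer (- lam\<^sub>G) s * (Gamma b / Gamma (lam\<^sub>H * real s + b))"
      unfolding mittag_leffler_moment_def p2 p1 p3 b_def[symmetric] ..
    moreover have "(- c\<^sub>H) ^ s \<noteq> 0" using cH by simp
    ultimately show ?thesis using A Gb by (simp add: L_def)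
  qed
  \<comment> \<open>Truncated subtraction; \<open>half\<close> shows that it is eventually exact and
    that \<open>m n\<close> is comparable with \<open>n\<close>.\<close>
  define m where "m n = n - j n * s" for n
  have small_s: "(\<lambda>n. 1 - real s * (real (j n) / real n)) \<longlonglongrightarrow> 1 - real s * 0"
    by (intro tendsto_intros small)
  have "\<forall>\<^sub>F n in sequentially. 1 / 2 < 1 - real s * (real (j n) / real n)"
    using small_s by (intro order_tendstoD(1)) auto
  hence half: "\<forall>\<^sub>F n in sequentially. j n * s \<le> n \<and> real n / 2 \<le> real (m n)
      \<and> real (m n) / real n = 1 - real s * (real (j n) / real n)"
    using eventually_gt_at_top[of 0]
  proof eventually_elim
    case (elim n)
    have "real n / 2 < real n - real (j n * s)" using elim by (simp add: field_simps)
    moreover from this have "j n * s \<le> n" by linarith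
    moreover from this have "real (m n) = real n - real (j n * s)" by (simp add: m_def of_nat_diff)
    ultimately show ?case using elim by (simp add: field_simps)
  qed
  have mtop: "filterlim m at_top sequentially"
  proof -
    have "filterlim (\<lambda>n. real n / 2) at_top sequentially" by real_asymp
    hence "filterlim (\<lambda>n. real (m n)) at_top sequentially"
      by (rule filterlim_at_top_mono) (use half in \<open>auto elim: eventually_mono\<close>)
    thus ?thesis by (simp add: filterlim_sequentially_iff_filterlim_real)
  qed
  have "(\<lambda>n. real (m n) / real n) \<longlonglongrightarrow> 1"
  proof (rule Lim_transform_eventually)
    show "(\<lambda>n. 1 - real s * (real (j n) / real n)) \<longlonglongrightarrow> 1" using small_s by simp
    show "\<forall>\<^sub>F n in sequentially. 1 - real s * (real (j n) / real n) = real (m n) / real n"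
      using half by eventually_elim simp
  qed
  hence "(\<lambda>n. T s (m n) / T 0 n * (- c\<^sub>H) ^ s * (real (m n) / real n) powr (lam\<^sub>H * real s + b - 1)) \<longlonglongrightarrow>
     L s / L 0 * (- c\<^sub>H) ^ s * 1 powr (lam\<^sub>H * real s + b - 1)"
    by (intro tendsto_mult tendsto_divide tendsto_const tendsto_powr filterlim_compose[OF T mtop, folded L_def] T[of 0, folded L_def] L0)
       auto
  hence "(\<lambda>n. T s (m n) / T 0 n * (- c\<^sub>H) ^ s * (real (m n) / real n) powr (lam\<^sub>H * real s + b - 1)) \<longlonglongrightarrow>
     mittag_leffler_moment lam\<^sub>H (- lam\<^sub>G * lam\<^sub>H) (real_of_ereal (- min 0 lam\<^sub>M)) s"
    using ml by simp
  thus ?thesis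
  proof (rule Lim_transform_eventually)
    show "\<forall>\<^sub>F n in sequentially. T s (m n) / T 0 n * (- c\<^sub>H) ^ s * (real (m n) / real n) powr (lam\<^sub>H * real s + b - 1) =
      fact s * measure_pmf.expectation (component_count_pmf G H M n (j n)) (\<lambda>k. real (k choose s)) / \<xi> n ^ s"
      using half k0 eventually_gt_at_top[of 0]
    proof eventually_elim
      case (elim n)
      have n: "0 < n" "0 < m n" using elim by (auto intro: Nat.gr0I)
      define h where "h = fps_nth H (j n)"
      have h: "0 < h" using h_pos by (simp add: h_def)
      have nz: "fps_nth (fps_compose G H * M) n \<noteq> 0" using elim(2) by (auto simp: T_def k_def)
      have shift: "fps_nth (k s * fps_X ^ (j n * s)) n = fps_nth (k s) (m n)"
        using elim(1) by (simp add: fps_X_power_mult_right_nth m_def)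
      have E: "fact s * measure_pmf.expectation (component_count_pmf G H M n (j n)) (\<lambda>k. real (k choose s)) =
          h ^ s * fps_nth (k s) (m n) / fps_nth (k 0) n"
        using component_count_pmf_binomial_moment(2)[OF nonneg H_0 j_pos[of n] nz, of s] shift
        by (simp add: k_def h_def)
      have \<rho>n: "\<rho>\<^sub>H ^ n = \<rho>\<^sub>H ^ m n * (\<rho>\<^sub>H ^ j n) ^ s"
        using elim(1) by (simp add: m_def power_mult[symmetric] power_add[symmetric])
      have e1: "real (m n) powr (1 - (lam\<^sub>H * real s + b)) = 1 / real (m n) powr (lam\<^sub>H * real s + b - 1)"
        by (simp add: powr_minus_divide[symmetric])
      have e2: "real n powr (1 - b) = (real n powr lam\<^sub>H) ^ s / real n powr (lam\<^sub>H * real s + b - 1)"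
        using n by (simp add: powr_power powr_diff[symmetric] mult.commute)
      have e3: "(real (m n) / real n) powr (lam\<^sub>H * real s + b - 1) =
          real (m n) powr (lam\<^sub>H * real s + b - 1) / real n powr (lam\<^sub>H * real s + b - 1)"
        using n by (simp add: powr_divide)
      define P Q R where "P = real (m n) powr (lam\<^sub>H * real s + b - 1)"
        and "Q = real n powr (lam\<^sub>H * real s + b - 1)" and "R = (real n powr lam\<^sub>H) ^ s"
      have nzs: "P \<noteq> 0" "Q \<noteq> 0" "R \<noteq> 0" "\<rho>\<^sub>H ^ m n \<noteq> 0" "(\<rho>\<^sub>H ^ j n) ^ s \<noteq> 0" "(- c\<^sub>H) ^ s \<noteq> 0" "h ^ s \<noteq> 0"
          "fps_nth (k 0) n \<noteq> 0"
        using n \<rho> cH h nz by (auto simp: P_def Q_def R_def k_def)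
      have "T s (m n) / T 0 n * (- c\<^sub>H) ^ s * (real (m n) / real n) powr (lam\<^sub>H * real s + b - 1) =
         (fps_nth (k s) (m n) * \<rho>\<^sub>H ^ m n * (1 / P)) / (fps_nth (k 0) n * (\<rho>\<^sub>H ^ m n * (\<rho>\<^sub>H ^ j n) ^ s) * (R / Q)) * (- c\<^sub>H) ^ s * (P / Q)"
        unfolding T_def \<rho>n e1 e3 P_def Q_def R_def using e2 by simp
      also have "\<dots> = h ^ s * fps_nth (k s) (m n) / fps_nth (k 0) n / ((\<rho>\<^sub>H ^ j n) ^ s / (- c\<^sub>H) ^ s * h ^ s * R)"
      proof -
        have "(K * a * (1 / P)) / (K\<^sub>0 * (a * e) * (R / Q)) * c * (P / Q) = d * K / K\<^sub>0 / (e / c * d * R)"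
          if "P \<noteq> 0" "Q \<noteq> 0" "a \<noteq> 0" "c \<noteq> 0" "d \<noteq> 0" "K\<^sub>0 \<noteq> 0" for K K\<^sub>0 P Q R a c d e :: real
          using that by (simp add: divide_simps)
        thus ?thesis using nzs by blast
      qed
      also have "(\<rho>\<^sub>H ^ j n) ^ s / (- c\<^sub>H) ^ s * h ^ s * R = \<xi> n ^ s"
        unfolding xi R_def h_def power_mult_distrib power_divide ..
      finally show ?case unfolding E .
    qed
  qed
qed

text \<open>The asymptotics at \<open>n - j\<close> are replaced by bounds valid at every index,
  which eventually give a constant times \<open>x powr (- (1 + lam\<^sub>H)) * ratio powr q\<close>
  as a bound for the mean when \<open>j \<le> n\<close>. If \<open>n - j\<close> is comparable with
  \<open>n\<close>, the second factor is bounded. Otherwise \<open>j \<ge> n / 2\<close>, the first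
  factor is at most of order \<open>1 / n\<close>, and \<open>q > -1\<close> prevents the second
  from compensating this.\<close>

lemma composition_scheme_mean_tendsto_0:
  fixes G H M :: "real fps" and lam\<^sub>M :: ereal and j :: "nat \<Rightarrow> nat"
  assumes scheme: "composition_scheme G H M \<rho>\<^sub>G lam\<^sub>G c\<^sub>G \<rho>\<^sub>H lam\<^sub>H c\<^sub>H lam\<^sub>M"
    and crit: "critical H M \<rho>\<^sub>G \<rho>\<^sub>H"
    and lamH: "0 < lam\<^sub>H" "lam\<^sub>H < 1"
    and pur: "pure lam\<^sub>G lam\<^sub>H lam\<^sub>M"
    and j_pos: "\<And>n. 1 \<le> j n"
    and h_pos: "\<And>n. 0 < fps_nth H (j n)"
    and large: "filterlim (\<lambda>n. real (j n) / real n powr (lam\<^sub>H / (1 + lam\<^sub>H))) at_top sequentially"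
  shows "(\<lambda>n. measure_pmf.expectation (component_count_pmf G H M n (j n)) real) \<longlonglongrightarrow> 0"
proof -
  interpret composition_scheme G H M \<rho>\<^sub>G lam\<^sub>G c\<^sub>G \<rho>\<^sub>H lam\<^sub>H c\<^sub>H lam\<^sub>M by fact
  define \<delta> where "\<delta> = lam\<^sub>H / (1 + lam\<^sub>H)"
  have \<delta>: "\<delta> * (1 + lam\<^sub>H) = lam\<^sub>H" using lamH by (auto simp: \<delta>_def)
  define b where "b = - lam\<^sub>G * lam\<^sub>H + real_of_ereal (- min 0 lam\<^sub>M)"
  note asy = composition_coeff_asymptotics[OF scheme crit lamH pur, folded b_def]
  note \<rho> = asy(4)
  define k where "k s = fps_compose ((fps_deriv ^^ s) G) H * M" for s
  define T where "T s n = fps_nth (k s) n * \<rho>\<^sub>H ^ n * real n powr (1 - (lam\<^sub>H * real s + b))" for s n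
  obtain A where A: "A \<noteq> 0" and T: "\<And>s. T s \<longlonglongrightarrow> A * pochhammer (- lam\<^sub>G) s / (- c\<^sub>H) ^ s / Gamma (lam\<^sub>H * real s + b)"
    using asy(7) unfolding T_def[abs_def] k_def by blast
  define t\<^sub>0 where "t\<^sub>0 = A / Gamma b"
  have t0: "t\<^sub>0 \<noteq> 0" using A asy(6) by (simp add: t\<^sub>0_def Gamma_eq_zero_iff)
  have T0: "T 0 \<longlonglongrightarrow> t\<^sub>0" using T[of 0] by (simp add: t\<^sub>0_def)
  have nz: "\<forall>\<^sub>F n in sequentially. fps_nth (fps_compose G H * M) n \<noteq> 0"
    using tendsto_imp_eventually_ne[OF T0 t0] by eventually_elim (auto simp: T_def k_def)
  define x where "x n = real (j n) / real n powr \<delta>" for n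
  have xtop: "filterlim x at_top sequentially" using large by (simp add: x_def[abs_def] \<delta>_def)
  have "((\<lambda>y. y powr (- (1 + lam\<^sub>H))) \<longlongrightarrow> 0) (at_top :: real filter)" using lamH by real_asymp
  hence xp: "(\<lambda>n. x n powr (- (1 + lam\<^sub>H))) \<longlonglongrightarrow> 0" using xtop by (rule filterlim_compose)
  define W where "W i = fps_nth H i * \<rho>\<^sub>H ^ i * real i powr (lam\<^sub>H + 1)" for i
  have W: "W \<longlonglongrightarrow> c\<^sub>H / Gamma (- lam\<^sub>H)" using asy(1) unfolding W_def[abs_def] .
  have jp: "0 < real (j n)" for n using j_pos[of n] by simp
  \<comment> \<open>The exponent of \<open>n\<close> in the coefficients for \<open>s = 1\<close>.
    It may be negative, but it exceeds -1 because \<open>b > - lam\<^sub>H\<close>.\<close>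
  define q where "q = lam\<^sub>H + b - 1"
  have q: "-1 < q" using asy(5) by (simp add: q_def)
  obtain B\<^sub>1 where B1: "\<And>i. \<bar>T 1 i\<bar> \<le> B\<^sub>1"
    using convergent_imp_Bseq[OF convergentI[OF T[of 1]]] by (auto simp: Bseq_def)
  define B where "B = max \<bar>fps_nth (k 1) 0\<bar> (B\<^sub>1 * 2 powr \<bar>q\<bar>)"
  have B: "0 \<le> B" by (simp add: B_def)
  \<comment> \<open>The argument \<open>i + 1\<close> includes \<open>i = 0\<close>, which occurs
    for \<open>j = n\<close> and where \<open>real i powr q\<close> would be 0.\<close>
  have kB: "\<bar>fps_nth (k 1) i\<bar> * \<rho>\<^sub>H ^ i \<le> B * real (i + 1) powr q" for i
  proof (cases "i = 0")
    case False
    hence i: "0 < real i" by simp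
    have "\<bar>fps_nth (k 1) i\<bar> * \<rho>\<^sub>H ^ i = \<bar>T 1 i\<bar> * real i powr q"
    proof -
      have "\<bar>T 1 i\<bar> = \<bar>fps_nth (k 1) i\<bar> * \<rho>\<^sub>H ^ i * real i powr (- q)"
        using \<rho> by (simp add: T_def abs_mult q_def algebra_simps)
      moreover have "real i powr (- q) * real i powr q = 1" using i by (simp add: powr_add[symmetric])
      ultimately show ?thesis by (simp add: mult.assoc)
    qed
    also have "real i powr q = (real i / real (i + 1)) powr q * real (i + 1) powr q"
      using i by (simp add: powr_divide)
    also have "\<bar>T 1 i\<bar> * ((real i / real (i + 1)) powr q * real (i + 1) powr q) \<le>
        B\<^sub>1 * (2 powr \<bar>q\<bar> * real (i + 1) powr q)"
      using B1[of i] i by (intro mult_mono mult_right_mono powr_between_half_double) (auto simp: field_simps)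
    also have "\<dots> \<le> B * real (i + 1) powr q"
      unfolding mult.assoc[symmetric] by (intro mult_right_mono) (auto simp: B_def)
    finally show ?thesis .
  qed (simp add: B_def)
  obtain B\<^sub>2 where B2: "\<And>i. \<bar>W i\<bar> \<le> B\<^sub>2"
    using convergent_imp_Bseq[OF convergentI[OF W]] by (auto simp: Bseq_def)
  have B20: "0 \<le> B\<^sub>2" using B2[of 0] by linarith
  define C where "C = B\<^sub>2 * B / (\<bar>t\<^sub>0\<bar> / 2)"
  have C: "0 \<le> C" using B B20 t0 by (simp add: C_def)
  have T0ev: "\<forall>\<^sub>F n in sequentially. \<bar>t\<^sub>0\<bar> / 2 < \<bar>T 0 n\<bar>"
    using order_tendstoD(1)[OF tendsto_rabs[OF T0], of "\<bar>t\<^sub>0\<bar> / 2"] t0 by simp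
  define g where "g n = C * (2 powr \<bar>q\<bar> * x n powr (- (1 + lam\<^sub>H)) +
     2 powr (1 + lam\<^sub>H) * (real n powr (-1) + real n powr (- 1 - q)))" for n
  have glim: "g \<longlonglongrightarrow> 0"
  proof -
    have "(\<lambda>n. real n powr (-1)) \<longlonglongrightarrow> 0" "(\<lambda>n. real n powr (- 1 - q)) \<longlonglongrightarrow> 0"
      using q by real_asymp+
    hence "g \<longlonglongrightarrow> C * (2 powr \<bar>q\<bar> * 0 + 2 powr (1 + lam\<^sub>H) * (0 + 0))"
      unfolding g_def by (intro tendsto_intros xp)
    thus ?thesis by simp
  qed
  show ?thesis
  proof (rule Lim_null_comparison[OF _ glim])
    show "\<forall>\<^sub>F n in sequentially. norm (measure_pmf.expectation (component_count_pmf G H M n (j n)) real) \<le> g n"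
      using nz T0ev eventually_gt_at_top[of 0]
    proof eventually_elim
      case (elim n)
      define i where "i = n - j n"
      have n: "0 < real n" using elim by simp
      have "measure_pmf.expectation (component_count_pmf G H M n (j n)) real =
        fps_nth H (j n) * fps_nth (k 1 * fps_X ^ j n) n / fps_nth (k 0) n"
        using component_count_pmf_binomial_moment(2)[OF nonneg H_0 j_pos[of n] elim(1), of 1]
        by (simp add: k_def)
      hence E: "measure_pmf.expectation (component_count_pmf G H M n (j n)) real =
        fps_nth H (j n) * (if n < j n then 0 else fps_nth (k 1) i) / fps_nth (k 0) n"
        by (simp add: fps_X_power_mult_right_nth i_def)
      have g0: "0 \<le> g n" unfolding g_def using C by (intro mult_nonneg_nonneg add_nonneg_nonneg) auto
      show ?case
      proof (cases "n < j n")
        case False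
        have ni: "n = i + j n" using False by (simp add: i_def)
        \<comment> \<open>At most 1 because \<open>j \<ge> 1\<close>, and at least
          \<open>1 / n\<close>, which is the worst case for negative \<open>q\<close>.\<close>
        define ratio where "ratio = real (i + 1) / real n"
        have ratio: "0 < ratio" "ratio \<le> 1" using n j_pos[of n] ni by (auto simp: ratio_def)
        have nq: "real n powr q = real n powr lam\<^sub>H * real n powr (b - 1)"
          using n by (simp add: powr_add[symmetric] q_def algebra_simps)
        have iq: "real (i + 1) powr q = ratio powr q * real n powr q"
          unfolding ratio_def using n by (simp add: powr_divide)
        have k0: "\<bar>t\<^sub>0\<bar> / 2 * real n powr (b - 1) \<le> \<bar>fps_nth (k 0) n\<bar> * \<rho>\<^sub>H ^ n"
        proof -
          have "\<bar>T 0 n\<bar> * real n powr (b - 1) = \<bar>fps_nth (k 0) n\<bar> * \<rho>\<^sub>H ^ n * (real n powr (1 - b) * real n powr (b - 1))"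
            using \<rho> by (simp add: T_def abs_mult mult_ac)
          also have "real n powr (1 - b) * real n powr (b - 1) = 1" using n by (simp add: powr_add[symmetric])
          finally have "\<bar>fps_nth (k 0) n\<bar> * \<rho>\<^sub>H ^ n = \<bar>T 0 n\<bar> * real n powr (b - 1)" by simp
          moreover have "\<bar>t\<^sub>0\<bar> / 2 * real n powr (b - 1) \<le> \<bar>T 0 n\<bar> * real n powr (b - 1)"
            using elim(2) by (intro mult_right_mono) auto
          ultimately show ?thesis by simp
        qed
        have hW: "fps_nth H (j n) * \<rho>\<^sub>H ^ j n \<le> B\<^sub>2 * real (j n) powr (- (1 + lam\<^sub>H))"
        proof -
          have "real (j n) powr (lam\<^sub>H + 1) * real (j n) powr (- (1 + lam\<^sub>H)) = 1"
            using jp[of n] by (simp add: powr_add[symmetric])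
          hence "fps_nth H (j n) * \<rho>\<^sub>H ^ j n = W (j n) * real (j n) powr (- (1 + lam\<^sub>H))"
            by (simp add: W_def mult.assoc)
          moreover have "W (j n) \<le> B\<^sub>2" using B2[of "j n"] by linarith
          ultimately show ?thesis by (simp add: mult_right_mono)
        qed
        have xe: "x n powr (- (1 + lam\<^sub>H)) = real (j n) powr (- (1 + lam\<^sub>H)) * real n powr lam\<^sub>H"
        proof -
          have "x n powr (- (1 + lam\<^sub>H)) = real (j n) powr (- (1 + lam\<^sub>H)) / real n powr (\<delta> * (- (1 + lam\<^sub>H)))"
            unfolding x_def using n jp[of n] by (simp add: powr_divide powr_powr)
          also have "\<delta> * (- (1 + lam\<^sub>H)) = - lam\<^sub>H" using \<delta> by (simp only: mult_minus_right)
          finally show ?thesis unfolding powr_minus[of _ "lam\<^sub>H"] by (simp add: divide_inverse)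
        qed
        have main: "x n powr (- (1 + lam\<^sub>H)) * ratio powr q \<le> 2 powr \<bar>q\<bar> * x n powr (- (1 + lam\<^sub>H)) +
           2 powr (1 + lam\<^sub>H) * (real n powr (-1) + real n powr (- 1 - q))"
        proof (cases "1 / 2 \<le> ratio")
          case True
          have "ratio powr q \<le> 2 powr \<bar>q\<bar>" using True ratio by (intro powr_between_half_double) auto
          hence "x n powr (- (1 + lam\<^sub>H)) * ratio powr q \<le> x n powr (- (1 + lam\<^sub>H)) * 2 powr \<bar>q\<bar>"
            by (intro mult_left_mono) auto
          moreover have "0 \<le> 2 powr (1 + lam\<^sub>H) * (real n powr (-1) + real n powr (- 1 - q))" by simp
          ultimately show ?thesis unfolding mult.commute[of "2 powr \<bar>q\<bar>"] by linarith
        next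
          case False
          hence "real (i + 1) < real n / 2" using n by (simp add: ratio_def field_simps)
          moreover have "real n = real i + real (j n)" using ni by (metis of_nat_add)
          ultimately have jn: "real n / 2 \<le> real (j n)" by simp
          have "real (j n) powr (- (1 + lam\<^sub>H)) \<le> (real n / 2) powr (- (1 + lam\<^sub>H))"
            using jn n lamH by (intro powr_mono2') auto
          hence "x n powr (- (1 + lam\<^sub>H)) \<le> (real n / 2) powr (- (1 + lam\<^sub>H)) * real n powr lam\<^sub>H"
            unfolding xe by (intro mult_right_mono) auto
          also have "\<dots> = 2 powr (1 + lam\<^sub>H) * (real n powr (- (1 + lam\<^sub>H)) * real n powr lam\<^sub>H)"
          proof -
            have "(real n / 2) powr (- (1 + lam\<^sub>H)) = 2 powr (1 + lam\<^sub>H) * real n powr (- (1 + lam\<^sub>H))"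
              using n powr_divide[of "real n" 2 "- (1 + lam\<^sub>H)"] powr_minus[of 2 "1 + lam\<^sub>H"]
              by (simp only: divide_inverse inverse_inverse_eq mult.commute)
            thus ?thesis by simp
          qed
          also have "real n powr (- (1 + lam\<^sub>H)) * real n powr lam\<^sub>H = real n powr (-1)"
            by (simp add: powr_add[symmetric])
          finally have 1: "x n powr (- (1 + lam\<^sub>H)) \<le> 2 powr (1 + lam\<^sub>H) * real n powr (-1)" .
          have 2: "ratio powr q \<le> 1 + real n powr (- q)"
          proof (cases "0 \<le> q")
            case True
            have "ratio powr q \<le> 1 powr q" using True ratio by (intro powr_mono2) auto
            thus ?thesis by (simp add: add_increasing2)
          next
            case False
            have "ratio powr q \<le> (1 / real n) powr q"
              using False n by (intro powr_mono2') (auto simp: ratio_def divide_right_mono)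
            also have "\<dots> = real n powr (- q)" using n by (simp add: powr_divide powr_minus_divide)
            finally show ?thesis by simp
          qed
          have "x n powr (- (1 + lam\<^sub>H)) * ratio powr q \<le>
              (2 powr (1 + lam\<^sub>H) * real n powr (-1)) * (1 + real n powr (- q))"
            using 1 2 by (intro mult_mono) auto
          also have "\<dots> = 2 powr (1 + lam\<^sub>H) * (real n powr (-1) + real n powr (- 1 - q))"
          proof -
            have "real n powr (- 1 - q) = real n powr (-1) * real n powr (- q)"
              using powr_add[of "real n" "-1" "-q"] by simp
            thus ?thesis by (simp only: distrib_left mult.assoc mult_1_right)
          qed
          also have "\<dots> \<le> 2 powr \<bar>q\<bar> * x n powr (- (1 + lam\<^sub>H)) + \<dots>" by simp
          finally show ?thesis .
        qed
        have "norm (measure_pmf.expectation (component_count_pmf G H M n (j n)) real) = fps_nth H (j n) * \<bar>fps_nth (k 1) i\<bar> / \<bar>fps_nth (k 0) n\<bar>"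
          unfolding E using False h_pos[of n] by (simp add: abs_mult)
        also have "\<dots> = (fps_nth H (j n) * \<rho>\<^sub>H ^ j n) * (\<bar>fps_nth (k 1) i\<bar> * \<rho>\<^sub>H ^ i) / (\<bar>fps_nth (k 0) n\<bar> * \<rho>\<^sub>H ^ n)"
        proof -
          have "\<rho>\<^sub>H ^ n = \<rho>\<^sub>H ^ i * \<rho>\<^sub>H ^ j n" by (subst ni) (simp add: power_add)
          thus ?thesis using \<rho> by simp
        qed
        also have "\<dots> \<le> (B\<^sub>2 * real (j n) powr (- (1 + lam\<^sub>H))) * (B * real (i + 1) powr q) / (\<bar>t\<^sub>0\<bar> / 2 * real n powr (b - 1))"
        proof (rule frac_le[OF _ mult_mono[OF hW kB] _ k0])
          show "0 < \<bar>t\<^sub>0\<bar> / 2 * real n powr (b - 1)" using t0 n by simp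
        qed (use B20 B \<rho> in auto)
        also have "\<dots> = C * (x n powr (- (1 + lam\<^sub>H)) * ratio powr q)"
        proof -
          have "(u * a) * (v * (e * (f * y))) / (t * y) = u * v / t * ((a * f) * e)"
            if "y \<noteq> 0" for u v a e f t y :: real
            using that by simp
          thus ?thesis unfolding iq nq xe C_def using n by simp
        qed
        also have "\<dots> \<le> g n" unfolding g_def using main C by (intro mult_left_mono)
        finally show ?thesis .
      qed (use g0 in \<open>simp add: E\<close>)
    qed
  qed
qed

theorem theorem5p1:
  fixes G H M :: "real fps"
    and \<rho>\<^sub>G lam\<^sub>G c\<^sub>G \<rho>\<^sub>H lam\<^sub>H c\<^sub>H :: real
    and lam\<^sub>M :: ereal
    and j :: "nat \<Rightarrow> nat"
    and \<xi> :: "nat \<Rightarrow> real"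
    and L :: "real measure"
  assumes scheme: "composition_scheme G H M \<rho>\<^sub>G lam\<^sub>G c\<^sub>G \<rho>\<^sub>H lam\<^sub>H c\<^sub>H lam\<^sub>M"
    and crit: "critical H M \<rho>\<^sub>G \<rho>\<^sub>H"
    and lamH: "0 < lam\<^sub>H" "lam\<^sub>H < 1"
    and pur: "pure lam\<^sub>G lam\<^sub>H lam\<^sub>M"
    and j_pos: "\<And>n. 1 \<le> j n"
    and h_pos: "\<And>n. 0 < fps_nth H (j n)"
    and xi: "\<And>n. \<xi> n = \<rho>\<^sub>H ^ j n / (- c\<^sub>H) * fps_nth H (j n) * real n powr lam\<^sub>H"
    and L: "mittag_leffler3 lam\<^sub>H (- lam\<^sub>G * lam\<^sub>H) (real_of_ereal (- min 0 lam\<^sub>M)) L"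
  shows
    "((\<lambda>n. real (j n) / real n powr (lam\<^sub>H / (1 + lam\<^sub>H))) \<longlonglongrightarrow> 0 \<longrightarrow>
        filterlim \<xi> at_top sequentially \<and>
        weak_conv_m (\<lambda>n. scaled_law (component_count_pmf G H M n (j n)) (\<xi> n)) L \<and>
        moments_converge (\<lambda>n. scaled_law (component_count_pmf G H M n (j n)) (\<xi> n)) L)
     \<and> (\<forall>r \<xi>\<^sub>0. 0 < r \<longrightarrow>
        (\<lambda>n. real (j n)) \<sim>[sequentially] (\<lambda>n. r * real n powr (lam\<^sub>H / (1 + lam\<^sub>H))) \<longrightarrow>
        \<xi>\<^sub>0 = r powr (- (1 + lam\<^sub>H)) * (1 / (- Gamma (- lam\<^sub>H))) \<longrightarrow>
        \<xi> \<longlonglongrightarrow> \<xi>\<^sub>0 \<and>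
        weak_conv_m (\<lambda>n. real_law (component_count_pmf G H M n (j n)))
          (real_law (mixed_poisson_pmf \<xi>\<^sub>0 L)) \<and>
        moments_converge (\<lambda>n. real_law (component_count_pmf G H M n (j n)))
          (real_law (mixed_poisson_pmf \<xi>\<^sub>0 L)))
     \<and> (filterlim (\<lambda>n. real (j n) / real n powr (lam\<^sub>H / (1 + lam\<^sub>H))) at_top sequentially \<longrightarrow>
        \<xi> \<longlonglongrightarrow> 0 \<and>
        weak_conv_m (\<lambda>n. real_law (component_count_pmf G H M n (j n))) (return borel 0))"
proof -
  interpret composition_scheme G H M \<rho>\<^sub>G lam\<^sub>G c\<^sub>G \<rho>\<^sub>H lam\<^sub>H c\<^sub>H lam\<^sub>M by fact
  define \<delta> where "\<delta> = lam\<^sub>H / (1 + lam\<^sub>H)"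
  have \<delta>: "0 < \<delta>" "\<delta> < 1" "\<delta> * (1 + lam\<^sub>H) = lam\<^sub>H" using lamH by (auto simp: \<delta>_def)
  define \<gamma> where "\<gamma> = real_of_ereal (- min 0 lam\<^sub>M)"
  define \<beta> where "\<beta> = - lam\<^sub>G * lam\<^sub>H"
  define b where "b = \<beta> + \<gamma>"
  note asy = composition_coeff_asymptotics[OF scheme crit lamH pur, folded \<gamma>_def \<beta>_def, folded b_def]
  note cH = asy(2) and Gam = asy(3) and \<rho> = asy(4)
  define p where "p n = component_count_pmf G H M n (j n)" for n
  define k where "k s = fps_compose ((fps_deriv ^^ s) G) H * M" for s
  define T where "T s n = fps_nth (k s) n * \<rho>\<^sub>H ^ n * real n powr (1 - (lam\<^sub>H * real s + b))" for s n
  obtain A where A: "A \<noteq> 0" and T: "\<And>s. T s \<longlonglongrightarrow> A * pochhammer (- lam\<^sub>G) s / (- c\<^sub>H) ^ s / Gamma (lam\<^sub>H * real s + b)"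
    using asy(7) unfolding T_def[abs_def] k_def by blast
  define t\<^sub>0 where "t\<^sub>0 = A / Gamma b"
  have t0: "t\<^sub>0 \<noteq> 0" using A asy(6) by (simp add: t\<^sub>0_def Gamma_eq_zero_iff)
  have T0: "T 0 \<longlonglongrightarrow> t\<^sub>0" using T[of 0] by (simp add: t\<^sub>0_def)
  have nz: "\<forall>\<^sub>F n in sequentially. fps_nth (fps_compose G H * M) n \<noteq> 0"
    using tendsto_imp_eventually_ne[OF T0 t0] by eventually_elim (auto simp: T_def k_def)
  have fin: "\<forall>\<^sub>F n in sequentially. finite (set_pmf (p n))"
    unfolding p_def using nz by eventually_elim (rule component_count_pmf_binomial_moment(1)[OF nonneg H_0 j_pos])

  \<comment> \<open>For positive \<open>lam\<^sub>G\<close> purity makes \<open>lam\<^sub>M\<close>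
    positive, hence \<gamma> = 0; this is the range in which \<beta> is negative.\<close>
  have bg: "(0 < \<beta> \<and> 0 \<le> \<gamma>) \<or> (- lam\<^sub>H < \<beta> \<and> \<beta> < 0 \<and> \<gamma> = 0)"
  proof (cases "lam\<^sub>G < 0")
    case True
    have "0 \<le> \<gamma>" unfolding \<gamma>_def by (cases lam\<^sub>M) (auto simp: min_def)
    thus ?thesis using True lamH by (simp add: \<beta>_def mult_neg_pos)
  next
    case False
    hence lG: "0 < lam\<^sub>G" "lam\<^sub>G < 1" "ereal (min (lam\<^sub>G * lam\<^sub>H) lam\<^sub>H) < lam\<^sub>M" using pur by (auto simp: pure_def)
    have "0 \<le> ereal (min (lam\<^sub>G * lam\<^sub>H) lam\<^sub>H)" using lG lamH by (simp add: min_def)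
    hence "0 < lam\<^sub>M" using lG(3) by (meson le_less_trans)
    hence "\<gamma> = 0" by (simp add: \<gamma>_def min_def less_imp_le)
    moreover have "lam\<^sub>G * lam\<^sub>H < 1 * lam\<^sub>H" using lG lamH by (intro mult_strict_right_mono)
    ultimately show ?thesis using lG lamH by (simp add: \<beta>_def)
  qed
  define m where "m = mittag_leffler_moment lam\<^sub>H \<beta> \<gamma>"
  note Lmom = mittag_leffler3_moments[OF lamH bg L[folded \<gamma>_def \<beta>_def], folded m_def]
  interpret L: real_distribution L by (rule Lmom(1))
  have Lnn: "AE x in L. 0 \<le> x" using Lmom(2) by eventually_elim simp
  have mL: "(\<integral>x. x ^ s \<partial>L) = m s" for s using Lmom(3)[of s] by (simp add: has_bochner_integral_iff)
  have Lexp: "integrable L (\<lambda>x. exp (t * x))" for t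
    by (rule exp_integrable_of_summable_moments[OF L.prob_space_axioms L.events_eq_borel Lnn Lmom(3)])
       (unfold m_def, rule summable_mittag_leffler_moment[OF lamH])
  have mom: "(\<lambda>n. fact s * measure_pmf.expectation (p n) (\<lambda>k. real (k choose s)) / \<xi> n ^ s) \<longlonglongrightarrow> (\<integral>x. x ^ s \<partial>L)"
    if "(\<lambda>n. real (j n) / real n) \<longlonglongrightarrow> 0" for s
    unfolding mL m_def \<beta>_def \<gamma>_def p_def
    by (rule composition_scheme_moments_converge[OF scheme crit lamH pur j_pos h_pos xi that])

  define x where "x n = real (j n) / real n powr \<delta>" for n
  define W where "W i = fps_nth H i * \<rho>\<^sub>H ^ i * real i powr (lam\<^sub>H + 1)" for i
  define w where "w = c\<^sub>H / Gamma (- lam\<^sub>H)"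
  have W: "W \<longlonglongrightarrow> w" using asy(1) unfolding W_def[abs_def] w_def .
  have w: "0 < w" using cH Gam by (simp add: w_def divide_neg_neg)
  have jp: "0 < real (j n)" for n using j_pos[of n] by simp
  have Wpos: "0 < W (j n)" for n using h_pos[of n] \<rho> jp[of n] by (simp add: W_def)
  \<comment> \<open>Expressing \<open>h_j\<close> by \<open>W\<close> leaves a function of
    \<open>x\<close> alone, by the identity
    \<open>\<delta> * (1 + lam\<^sub>H) = lam\<^sub>H\<close>.\<close>
  have xi_eq: "\<xi> n = W (j n) / (- c\<^sub>H) * x n powr (- (1 + lam\<^sub>H))" if "0 < n" for n
  proof -
    have "x n powr (- (1 + lam\<^sub>H)) = real (j n) powr (- (1 + lam\<^sub>H)) / real n powr (\<delta> * (- (1 + lam\<^sub>H)))"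
      unfolding x_def using that jp[of n] by (simp add: powr_divide powr_powr)
    also have "\<delta> * (- (1 + lam\<^sub>H)) = - lam\<^sub>H" using \<delta>(3) by (simp only: mult_minus_right)
    also have "real (j n) powr (- (1 + lam\<^sub>H)) / real n powr (- lam\<^sub>H) =
        real n powr lam\<^sub>H / real (j n) powr (lam\<^sub>H + 1)"
      unfolding powr_minus add.commute[of 1] by (simp add: divide_inverse)
    finally have e: "x n powr (- (1 + lam\<^sub>H)) = real n powr lam\<^sub>H / real (j n) powr (lam\<^sub>H + 1)" .
    have "real (j n) powr (lam\<^sub>H + 1) \<noteq> 0" using jp[of n] by simp
    thus ?thesis unfolding e xi W_def by simp
  qed
  have xpos: "0 < x n" if "0 < n" for n using that jp[of n] by (simp add: x_def)
  have j_x: "real (j n) = x n * real n powr \<delta>" if "0 < n" for n using that by (simp add: x_def)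
  \<comment> \<open>A convergent \<open>x\<close> makes \<open>j\<close> at most of order
    \<open>n powr \<delta>\<close>, and \<delta> < 1.\<close>
  have jn_small: "(\<lambda>n. real (j n) / real n) \<longlonglongrightarrow> 0" if "x \<longlonglongrightarrow> l" for l
  proof (rule Lim_transform_eventually)
    have "(\<lambda>n. real n powr (\<delta> - 1)) \<longlonglongrightarrow> 0" using \<delta> by real_asymp
    from tendsto_mult[OF that this] show "(\<lambda>n. x n * real n powr (\<delta> - 1)) \<longlonglongrightarrow> 0" by simp
    show "\<forall>\<^sub>F n in sequentially. x n * real n powr (\<delta> - 1) = real (j n) / real n"
      using eventually_gt_at_top[of 0] by eventually_elim (simp add: j_x powr_diff)
  qed
  have j_top: "filterlim j at_top sequentially" if "\<forall>\<^sub>F n in sequentially. e \<le> x n" "0 < e" for e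
  proof -
    have "filterlim (\<lambda>n. e * real n powr \<delta>) at_top sequentially" using that(2) \<delta> by real_asymp
    hence "filterlim (\<lambda>n. real (j n)) at_top sequentially"
    proof (rule filterlim_at_top_mono)
      show "\<forall>\<^sub>F n in sequentially. e * real n powr \<delta> \<le> real (j n)"
        using that(1) eventually_gt_at_top[of 0] by eventually_elim (auto simp: j_x intro!: mult_right_mono)
    qed
    thus ?thesis by (simp add: filterlim_sequentially_iff_filterlim_real)
  qed
  have xi_ev: "\<forall>\<^sub>F n in sequentially. W (j n) / (- c\<^sub>H) * x n powr (- (1 + lam\<^sub>H)) = \<xi> n"
    using eventually_gt_at_top[of 0] by eventually_elim (simp add: xi_eq)

  \<comment> \<open>Sizes below the threshold\<close>
  have case1: "filterlim \<xi> at_top sequentially \<and> weak_conv_m (\<lambda>n. scaled_law (p n) (\<xi> n)) L \<and>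
        moments_converge (\<lambda>n. scaled_law (p n) (\<xi> n)) L" if x0: "x \<longlonglongrightarrow> 0"
  proof -
    obtain J where J: "\<And>i. i \<ge> J \<Longrightarrow> w / 2 < W i"
      using order_tendstoD(1)[OF W, of "w / 2"] w by (auto simp: eventually_sequentially)
    define S where "S = insert (w / 2) (W ` {i. i < J \<and> 0 < W i})"
    define d where "d = Min S"
    have S: "finite S" "S \<noteq> {}" by (auto simp: S_def)
    have d: "0 < d" using Min_in[OF S] w by (auto simp: d_def S_def)
    have Wd: "d \<le> W (j n)" for n
    proof (cases "j n < J")
      case True
      hence "W (j n) \<in> S" using Wpos[of n] by (auto simp: S_def)
      thus ?thesis unfolding d_def using S by (intro Min_le)
    next
      case False
      have "d \<le> w / 2" unfolding d_def using S by (intro Min_le) (auto simp: S_def)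
      thus ?thesis using J[of "j n"] False by simp
    qed
    have "filterlim x (at_right 0) sequentially"
      unfolding filterlim_at
    proof
      show "\<forall>\<^sub>F n in sequentially. x n \<in> {0<..} \<and> x n \<noteq> 0"
        using eventually_gt_at_top[of 0]
      proof eventually_elim
        case (elim n)
        thus ?case using xpos[of n] by auto
      qed
    qed (rule x0)
    moreover have "filterlim (\<lambda>y. d / (- c\<^sub>H) * y powr (- (1 + lam\<^sub>H))) at_top (at_right (0::real))"
    proof -
      have base: "filterlim (\<lambda>y. D * y powr e) at_top (at_right (0::real))" if "0 < D" "e < 0" for D e :: real
        using that by real_asymp
      show ?thesis by (rule base) (use d cH lamH in \<open>auto simp: divide_pos_neg\<close>)
    qed
    ultimately have "filterlim (\<lambda>n. d / (- c\<^sub>H) * x n powr (- (1 + lam\<^sub>H))) at_top sequentially"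
      by (rule filterlim_compose[rotated])
    hence xi_top: "filterlim \<xi> at_top sequentially"
    proof (rule filterlim_at_top_mono)
      show "\<forall>\<^sub>F n in sequentially. d / (- c\<^sub>H) * x n powr (- (1 + lam\<^sub>H)) \<le> \<xi> n"
        using xi_ev
      proof eventually_elim
        case (elim n)
        have "d / (- c\<^sub>H) \<le> W (j n) / (- c\<^sub>H)" using Wd[of n] cH by (intro divide_right_mono) auto
        thus ?case unfolding elim[symmetric] by (rule mult_right_mono) simp
      qed
    qed
    with weak_conv_scaled_law[OF fin xi_top mom[OF jn_small[OF x0]] Lmom(1) Lnn Lexp] show ?thesis by simp
  qed

  \<comment> \<open>Sizes at the threshold\<close>
  have case2: "\<xi> \<longlonglongrightarrow> \<xi>\<^sub>0 \<and> weak_conv_m (\<lambda>n. real_law (p n)) (real_law (mixed_poisson_pmf \<xi>\<^sub>0 L)) \<and>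
        moments_converge (\<lambda>n. real_law (p n)) (real_law (mixed_poisson_pmf \<xi>\<^sub>0 L))"
    if r: "0 < r" and jr: "(\<lambda>n. real (j n)) \<sim>[sequentially] (\<lambda>n. r * real n powr \<delta>)"
      and xi0: "\<xi>\<^sub>0 = r powr (- (1 + lam\<^sub>H)) * (1 / (- Gamma (- lam\<^sub>H)))" for r \<xi>\<^sub>0
  proof -
    have "(\<lambda>n. real (j n) / (r * real n powr \<delta>)) \<longlonglongrightarrow> 1"
      using jr by (rule asymp_equivD_strong) (use j_pos in \<open>auto intro!: always_eventually simp: Suc_le_eq\<close>)
    from tendsto_mult[OF tendsto_const[of r] this] have xr: "x \<longlonglongrightarrow> r"
      using r by (simp add: x_def[abs_def])
    \<comment> \<open>Here \<open>j\<close> is forced to infinity, so the limit of \<open>W\<close>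
      applies along \<open>j\<close>.\<close>
    have "\<forall>\<^sub>F n in sequentially. r / 2 \<le> x n"
      using order_tendstoD(1)[OF xr, of "r / 2"] r by (auto elim: eventually_mono)
    hence "filterlim j at_top sequentially" by (rule j_top) (use r in simp)
    hence "(\<lambda>n. W (j n)) \<longlonglongrightarrow> w" by (rule filterlim_compose[OF W])
    hence "(\<lambda>n. W (j n) / (- c\<^sub>H) * x n powr (- (1 + lam\<^sub>H))) \<longlonglongrightarrow> w / (- c\<^sub>H) * r powr (- (1 + lam\<^sub>H))"
      using xr r cH by (intro tendsto_mult tendsto_divide tendsto_powr tendsto_const) auto
    also have "w / (- c\<^sub>H) * r powr (- (1 + lam\<^sub>H)) = \<xi>\<^sub>0" using cH by (simp add: w_def xi0)
    finally have xilim: "\<xi> \<longlonglongrightarrow> \<xi>\<^sub>0" using xi_ev by (rule Lim_transform_eventually)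
    have xi0pos: "0 < \<xi>\<^sub>0" unfolding xi0 using r Gam by (intro mult_pos_pos) auto
    have "(\<lambda>n. fact s * measure_pmf.expectation (p n) (\<lambda>k. real (k choose s))) \<longlonglongrightarrow> \<xi>\<^sub>0 ^ s * (\<integral>x. x ^ s \<partial>L)" for s
    proof (rule Lim_transform_eventually)
      show "(\<lambda>n. \<xi> n ^ s * (fact s * measure_pmf.expectation (p n) (\<lambda>k. real (k choose s)) / \<xi> n ^ s)) \<longlonglongrightarrow> \<xi>\<^sub>0 ^ s * (\<integral>x. x ^ s \<partial>L)"
        by (intro tendsto_mult tendsto_power xilim mom jn_small[OF xr])
      show "\<forall>\<^sub>F n in sequentially. \<xi> n ^ s * (fact s * measure_pmf.expectation (p n) (\<lambda>k. real (k choose s)) / \<xi> n ^ s)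
         = fact s * measure_pmf.expectation (p n) (\<lambda>k. real (k choose s))"
        using order_tendstoD(1)[OF xilim xi0pos] by eventually_elim simp
    qed
    from weak_conv_real_law_mixed_poisson[OF fin less_imp_le[OF xi0pos] this Lmom(1) Lnn Lexp] xilim
    show ?thesis by simp
  qed

  \<comment> \<open>Sizes above the threshold\<close>
  have case3: "\<xi> \<longlonglongrightarrow> 0 \<and> weak_conv_m (\<lambda>n. real_law (p n)) (return borel 0)"
    if xtop: "filterlim x at_top sequentially"
  proof -
    have "\<forall>\<^sub>F n in sequentially. 1 \<le> x n" using xtop by (simp add: filterlim_at_top)
    hence "filterlim j at_top sequentially" by (rule j_top) simp
    hence Wj: "(\<lambda>n. W (j n)) \<longlonglongrightarrow> w" by (rule filterlim_compose[OF W])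
    have "((\<lambda>y. y powr (- (1 + lam\<^sub>H))) \<longlongrightarrow> 0) (at_top :: real filter)" using lamH by real_asymp
    hence xp: "(\<lambda>n. x n powr (- (1 + lam\<^sub>H))) \<longlonglongrightarrow> 0" using xtop by (rule filterlim_compose)
    have "(\<lambda>n. W (j n) / (- c\<^sub>H) * x n powr (- (1 + lam\<^sub>H))) \<longlonglongrightarrow> w / (- c\<^sub>H) * 0"
      using cH by (intro tendsto_mult tendsto_divide tendsto_const Wj xp) auto
    hence "(\<lambda>n. W (j n) / (- c\<^sub>H) * x n powr (- (1 + lam\<^sub>H))) \<longlonglongrightarrow> 0" by simp
    hence xilim: "\<xi> \<longlonglongrightarrow> 0" using xi_ev by (rule Lim_transform_eventually)

    have "(\<lambda>n. measure_pmf.expectation (p n) real) \<longlonglongrightarrow> 0"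
      unfolding p_def by (rule composition_scheme_mean_tendsto_0[OF scheme crit lamH pur j_pos h_pos xtop[unfolded x_def[abs_def] \<delta>_def]])
    with weak_conv_real_law_0[OF fin] xilim show ?thesis by simp
  qed
  show ?thesis
    using case1 case2 case3 unfolding x_def[abs_def] \<delta>_def p_def by blast
qed

end
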